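(* Let $n \ge 2$ be an integer, let $\mathcal{G}$ be the complex Green operator on $L^2(\mathbb{S}^{2n-1})$ (functions on the unit sphere of $\mathbb{C}^n$), and let $r \in [1,\infty)$. Then the Schatten $r$-norm of $\mathcal{G}$ satisfies $\|\mathcal{G}\|_r < \infty$ if and only if $r > n$.
   Context: $\mathbb{S}^{2n-1}$ is the unit sphere in $\mathbb{C}^n$, with the CR structure induced from $\mathbb{C}^n$, and $L^2(\mathbb{S}^{2n-1})$ is taken with respect to surface measure. For $p,q \ge 0$, $\mathcal{H}_{p,q}(\mathbb{S}^{2n-1})$ denotes the space of restrictions to $\mathbb{S}^{2n-1}$ of harmonic polynomials $f(z,\overline z)$ on $\mathbb{C}^n$ that are homogeneous of bidegree $(p,q)$, i.e. $f(\lambda_1 z, \lambda_2 \overline z) = \lambda_1^p \lambda_2^q f(z,\overline z)$. These spaces are finite-dimensional, pairwise orthogonal, and $L^2(\mathbb{S}^{2n-1}) = \bigoplus_{p,q\ge 0} \mathcal{H}_{p,q}(\mathbb{S}^{2n-1})$ (Hilbert direct sum). The Kohn Laplacian $\square_b = \overline{\partial}_b\overline{\partial}_b^* + \overline{\partial}_b^*\overline{\partial}_b$ acting on functions is a self-adjoint, densely defined, closed operator on $L^2(\mathbb{S}^{2n-1})$. It is normalized so that it acts on $\mathcal{H}_{p,q}(\mathbb{S}^{2n-1})$ as multiplication by the eigenvalue $2q(p+n-1)$; together with the orthogonal decomposition $L^2(\mathbb{S}^{2n-1}) = \bigoplus_{p,q\ge 0} \mathcal{H}_{p,q}(\mathbb{S}^{2n-1})$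 this determines $\square_b$. In particular, for $n\ge 2$, $\ker \square_b$ is the closed span of the $\mathcal{H}_{p,0}(\mathbb{S}^{2n-1})$, $p \ge 0$. The complex Green operator $\mathcal{G}: L^2(\mathbb{S}^{2n-1}) \to L^2(\mathbb{S}^{2n-1})$ is the linear operator which is $0$ on $\ker \square_b$ and is the inverse of $\square_b$ on $(\ker\square_b)^\perp$; that is, $\mathcal{G}$ acts on $\mathcal{H}_{p,q}(\mathbb{S}^{2n-1})$ as multiplication by $\frac{1}{2q(p+n-1)}$ for $q \ge 1$ and as $0$ for $q = 0$. It is compact and positive semi-definite. For a compact positive semi-definite operator $T$ on a separable Hilbert space with eigenvalues $\lambda_1(T) \ge \lambda_2(T) \ge \dots \ge 0$ (repeated according to multiplicity) and $r\in[1,\infty)$, the Schatten $r$-norm is $\|T\|_r = \left(\sum_{k=1}^\infty \lambda_k(T)^r\right)^{1/r} \in [0,\infty]$. *)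

theory Defs
  imports "HOL-Analysis.Analysis"
begin

section \<open>Surface measure on the unit sphere of complex n-space\<close>

text \<open>The dimension is \<open>n = CARD('n)\<close>. The surface measure of \<open>A\<close> is obtained from the
  Lebesgue measure of the cone over \<open>A\<close> by integration in polar coordinates:
  \<open>\<sigma>(A) = 2n \<cdot> vol {t x | 0 < t \<le> 1, x \<in> A}\<close>, where \<open>2n = DIM(complex ^ 'n)\<close>.\<close>

definition sphere_measure :: "(complex ^ 'n::finite) measure" where
  "sphere_measure =
     scale_measure (ennreal (real DIM(complex ^ 'n)))
       (distr (restrict_space lborel (cball 0 1 - {0}))
              (restrict_space borel (sphere 0 1))
              (\<lambda>x. x /\<^sub>R norm x))"

lemma space_sphere_measure [simp]:
  "space (sphere_measure :: (complex ^ 'n::finite) measure) = sphere 0 1"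
  by (simp add: sphere_measure_def space_scale_measure space_restrict_space)

lemma sets_sphere_measure [simp, measurable_cong]:
  "sets (sphere_measure :: (complex ^ 'n::finite) measure) =
     sets (restrict_space borel (sphere 0 1))"
  by (simp add: sphere_measure_def)

lemma emeasure_sphere_measure:
  fixes A :: "(complex ^ 'n::finite) set"
  assumes "A \<in> sets sphere_measure"
  shows "emeasure sphere_measure A =
    ennreal (real DIM(complex ^ 'n)) *
      emeasure lborel {x \<in> cball 0 1 - {0}. x /\<^sub>R norm x \<in> A}"
proof -
  let ?C = "cball 0 1 - {0} :: (complex ^ 'n) set"
  have C: "?C \<in> sets borel" by auto
  have "(\<lambda>x. x /\<^sub>R norm x) \<in> measurable (restrict_space lborel ?C)
          (restrict_space borel (sphere 0 1 :: (complex ^ 'n) set))"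
    by (rule measurable_restrict_space2)
       (auto simp: space_restrict_space intro!: measurable_restrict_space1)
  moreover have "(\<lambda>x. x /\<^sub>R norm x) -` A \<inter> space (restrict_space lborel ?C) =
      {x \<in> ?C. x /\<^sub>R norm x \<in> A}"
    by (auto simp: space_restrict_space)
  moreover have "emeasure (restrict_space lborel ?C) {x \<in> ?C. x /\<^sub>R norm x \<in> A} =
      emeasure lborel {x \<in> ?C. x /\<^sub>R norm x \<in> A}"
    by (rule emeasure_restrict_space) (use C in auto)
  ultimately show ?thesis
    using assms by (simp add: sphere_measure_def emeasure_distr)
qed


section \<open>The Hilbert space of square-integrable functions on the sphere\<close>

definition square_integrable :: "(complex ^ 'n::finite \<Rightarrow> complex) \<Rightarrow> bool" where
  "square_integrable f \<longleftrightarrow>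
     f \<in> borel_measurable sphere_measure \<and> integrable sphere_measure (\<lambda>x. (norm (f x))\<^sup>2)"

lemma square_integrable_0: "square_integrable (\<lambda>_. 0)"
  by (simp add: square_integrable_def)

lemma square_integrable_add:
  assumes "square_integrable f" "square_integrable g"
  shows "square_integrable (\<lambda>x. f x + g x)"
proof -
  have [measurable]: "f \<in> borel_measurable sphere_measure" "g \<in> borel_measurable sphere_measure"
    using assms by (auto simp: square_integrable_def)
  have *: "(norm (a + b))\<^sup>2 \<le> 2 * (norm a)\<^sup>2 + 2 * (norm b)\<^sup>2" for a b :: complex
  proof -
    have "(norm (a + b))\<^sup>2 \<le> (norm a + norm b)\<^sup>2"
      by (intro power_mono norm_triangle_ineq) auto
    also have "\<dots> \<le> 2 * (norm a)\<^sup>2 + 2 * (norm b)\<^sup>2"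
      using sum_squares_bound[of "norm a" "norm b"] by (simp add: power2_sum)
    finally show ?thesis .
  qed
  have "integrable sphere_measure (\<lambda>x. 2 * (norm (f x))\<^sup>2 + 2 * (norm (g x))\<^sup>2)"
    using assms by (auto simp: square_integrable_def)
  then have "integrable sphere_measure (\<lambda>x. (norm (f x + g x))\<^sup>2)"
    by (rule Bochner_Integration.integrable_bound) (use * in \<open>auto intro!: AE_I2\<close>)
  then show ?thesis by (simp add: square_integrable_def)
qed

lemma square_integrable_cmult:
  assumes "square_integrable f"
  shows "square_integrable (\<lambda>x. c * f x)"
  using assms by (auto simp: square_integrable_def norm_mult power_mult_distrib)

lemma borel_measurable_cnj [measurable]: "cnj \<in> borel_measurable borel"
  by (intro borel_measurable_continuous_onI continuous_intros)

lemma integrable_mult_cnj: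
  assumes "square_integrable f" "square_integrable g"
  shows "integrable sphere_measure (\<lambda>x. f x * cnj (g x))"
proof -
  have [measurable]: "f \<in> borel_measurable sphere_measure" "g \<in> borel_measurable sphere_measure"
    using assms by (auto simp: square_integrable_def)
  have *: "norm a * norm b \<le> (norm a)\<^sup>2 + (norm b)\<^sup>2" for a b :: complex
    using sum_squares_bound[of "norm a" "norm b"]
      mult_nonneg_nonneg[OF norm_ge_zero[of a] norm_ge_zero[of b]] by linarith
  have "integrable sphere_measure (\<lambda>x. (norm (f x))\<^sup>2 + (norm (g x))\<^sup>2)"
    using assms by (auto simp: square_integrable_def)
  then show ?thesis
    by (rule Bochner_Integration.integrable_bound)
       (use * in \<open>auto intro!: AE_I2 simp: norm_mult\<close>)
qed

definition L2_eq ::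
  "(complex ^ 'n::finite \<Rightarrow> complex) \<Rightarrow> (complex ^ 'n \<Rightarrow> complex) \<Rightarrow> bool" where
  "L2_eq f g \<longleftrightarrow> square_integrable f \<and> square_integrable g \<and> (AE x in sphere_measure. f x = g x)"

lemma L2_eqI:
  assumes "square_integrable f" "\<And>x. f x = g x"
  shows "L2_eq f g"
proof -
  have "g = f" using assms(2) by auto
  with assms(1) show ?thesis by (simp add: L2_eq_def)
qed

lemma L2_eq_integral_cong:
  assumes "L2_eq f f'" "L2_eq g g'"
  shows "(\<integral>x. f x * cnj (g x) \<partial>sphere_measure) = (\<integral>x. f' x * cnj (g' x) \<partial>sphere_measure)"
proof (rule integral_cong_AE)
  show "AE x in sphere_measure. f x * cnj (g x) = f' x * cnj (g' x)"
    using assms by (auto simp: L2_eq_def elim: eventually_elim2)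
  show "(\<lambda>x. f x * cnj (g x)) \<in> borel_measurable sphere_measure"
    "(\<lambda>x. f' x * cnj (g' x)) \<in> borel_measurable sphere_measure"
    using assms by (simp_all add: L2_eq_def integrable_mult_cnj borel_measurable_integrable)
qed

quotient_type 'n sphere_L2 = "complex ^ 'n::finite \<Rightarrow> complex" / partial: L2_eq
proof (rule part_equivpI)
  show "\<exists>f. L2_eq f f"
    using square_integrable_0 by (auto simp: L2_eq_def)
  show "symp L2_eq"
    by (auto simp: symp_def L2_eq_def elim: eventually_mono)
  show "transp L2_eq"
    by (rule transpI) (auto simp: L2_eq_def elim: eventually_elim2)
qed

instantiation sphere_L2 :: (finite) real_inner
begin

lift_definition zero_sphere_L2 :: "'a sphere_L2" is "\<lambda>_. 0"
  by (simp add: L2_eq_def square_integrable_0)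

lift_definition plus_sphere_L2 :: "'a sphere_L2 \<Rightarrow> 'a sphere_L2 \<Rightarrow> 'a sphere_L2"
  is "\<lambda>f g x. f x + g x"
  by (auto simp: L2_eq_def square_integrable_add elim: eventually_elim2)

lift_definition uminus_sphere_L2 :: "'a sphere_L2 \<Rightarrow> 'a sphere_L2" is "\<lambda>f x. - f x"
  using square_integrable_cmult[of _ "-1"] by (auto simp: L2_eq_def)

lift_definition scaleR_sphere_L2 :: "real \<Rightarrow> 'a sphere_L2 \<Rightarrow> 'a sphere_L2"
  is "\<lambda>c f x. of_real c * f x"
  by (auto simp: L2_eq_def square_integrable_cmult)

lift_definition inner_sphere_L2 :: "'a sphere_L2 \<Rightarrow> 'a sphere_L2 \<Rightarrow> real"
  is "\<lambda>f g. Re (\<integral>x. f x * cnj (g x) \<partial>sphere_measure)"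
  by (simp add: L2_eq_integral_cong)

definition minus_sphere_L2 :: "'a sphere_L2 \<Rightarrow> 'a sphere_L2 \<Rightarrow> 'a sphere_L2" where
  "minus_sphere_L2 f g = f + (- g)"

definition norm_sphere_L2 :: "'a sphere_L2 \<Rightarrow> real" where
  "norm_sphere_L2 f = sqrt (inner f f)"

definition sgn_sphere_L2 :: "'a sphere_L2 \<Rightarrow> 'a sphere_L2" where
  "sgn_sphere_L2 f = inverse (norm f) *\<^sub>R f"

definition dist_sphere_L2 :: "'a sphere_L2 \<Rightarrow> 'a sphere_L2 \<Rightarrow> real" where
  "dist_sphere_L2 f g = norm (f - g)"

definition uniformity_sphere_L2 :: "('a sphere_L2 \<times> 'a sphere_L2) filter" where
  "uniformity_sphere_L2 = (INF e\<in>{0 <..}. principal {(x, y). dist x y < e})"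

definition open_sphere_L2 :: "'a sphere_L2 set \<Rightarrow> bool" where
  "open_sphere_L2 U = (\<forall>x\<in>U. \<forall>\<^sub>F (x', y) in uniformity. x' = x \<longrightarrow> y \<in> U)"

instance
proof
  fix f g h :: "'a sphere_L2" and a b :: real and U :: "'a sphere_L2 set"
  show "f + g + h = f + (g + h)"
    by transfer (rule L2_eqI, simp add: L2_eq_def square_integrable_add square_integrable_cmult,
                 simp add: algebra_simps)
  show "f + g = g + f"
    by transfer (rule L2_eqI, simp add: L2_eq_def square_integrable_add square_integrable_cmult,
                 simp add: algebra_simps)
  show "0 + f = f"
    by transfer (auto simp: L2_eq_def)
  show "- f + f = 0"
    by transfer (auto simp: L2_eq_def square_integrable_0)
  show "f - g = f + - g"
    by (simp add: minus_sphere_L2_def)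
  show "a *\<^sub>R (f + g) = a *\<^sub>R f + a *\<^sub>R g"
    by transfer (rule L2_eqI, simp add: L2_eq_def square_integrable_add square_integrable_cmult,
                 simp add: algebra_simps)
  show "(a + b) *\<^sub>R f = a *\<^sub>R f + b *\<^sub>R f"
    by transfer (rule L2_eqI, simp add: L2_eq_def square_integrable_add square_integrable_cmult,
                 simp add: algebra_simps)
  show "a *\<^sub>R b *\<^sub>R f = (a * b) *\<^sub>R f"
    by transfer (rule L2_eqI, simp add: L2_eq_def square_integrable_add square_integrable_cmult,
                 simp add: algebra_simps)
  show "1 *\<^sub>R f = f"
    by transfer (auto simp: L2_eq_def)
  show "dist f g = norm (f - g)"
    by (rule dist_sphere_L2_def)
  show "sgn f = inverse (norm f) *\<^sub>R f"
    by (rule sgn_sphere_L2_def)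
  show "(uniformity :: ('a sphere_L2 \<times> 'a sphere_L2) filter) =
      (INF e\<in>{0 <..}. principal {(x, y). dist x y < e})"
    by (rule uniformity_sphere_L2_def)
  show "open U = (\<forall>x\<in>U. \<forall>\<^sub>F (x', y) in uniformity. x' = x \<longrightarrow> y \<in> U)"
    by (rule open_sphere_L2_def)
  show "norm f = sqrt (inner f f)"
    by (rule norm_sphere_L2_def)
  show "inner f g = inner g f"
  proof transfer
    fix f g :: "complex ^ 'a \<Rightarrow> complex"
    have "(\<integral>x. g x * cnj (f x) \<partial>sphere_measure) = cnj (\<integral>x. f x * cnj (g x) \<partial>sphere_measure)"
      by (subst Bochner_Integration.integral_cnj[symmetric]) (simp add: mult.commute)
    then show "Re (\<integral>x. f x * cnj (g x) \<partial>sphere_measure) =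
        Re (\<integral>x. g x * cnj (f x) \<partial>sphere_measure)" by simp
  qed
  show "inner (f + g) h = inner f h + inner g h"
    by transfer (simp add: L2_eq_def distrib_right integrable_mult_cnj)
  show "inner (a *\<^sub>R f) g = a * inner f g"
    by transfer (simp add: L2_eq_def mult.assoc)
  have sq: "Re (\<integral>x. u x * cnj (u x) \<partial>sphere_measure) = (\<integral>x. (norm (u x))\<^sup>2 \<partial>sphere_measure)"
    for u :: "complex ^ 'a \<Rightarrow> complex"
    by (simp only: complex_norm_square[symmetric] integral_complex_of_real Re_complex_of_real)
  show "0 \<le> inner f f"
    by transfer (simp add: sq)
  show "(inner f f = 0) = (f = 0)"
    by transfer
       (auto simp: sq L2_eq_def square_integrable_0 square_integrable_def
          integral_nonneg_eq_0_iff_AE)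
qed

end

text \<open>Complex structure. The complex inner product is linear in its first argument, and the
  class operation \<^const>\<open>inner\<close> is its real part.\<close>

lift_definition scaleC :: "complex \<Rightarrow> 'n::finite sphere_L2 \<Rightarrow> 'n sphere_L2"
  is "\<lambda>c f x. c * f x"
  by (auto simp: L2_eq_def square_integrable_cmult)

lift_definition cinner :: "'n::finite sphere_L2 \<Rightarrow> 'n sphere_L2 \<Rightarrow> complex"
  is "\<lambda>f g. \<integral>x. f x * cnj (g x) \<partial>sphere_measure"
  by (rule L2_eq_integral_cong)

interpretation complex_L2: vector_space scaleC
proof
  fix a b :: complex and f g :: "'n::finite sphere_L2"
  show "scaleC a (f + g) = scaleC a f + scaleC a g"
    by transfer (rule L2_eqI, simp add: L2_eq_def square_integrable_add square_integrable_cmult,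
                 simp add: algebra_simps)
  show "scaleC (a + b) f = scaleC a f + scaleC b f"
    by transfer (rule L2_eqI, simp add: L2_eq_def square_integrable_add square_integrable_cmult,
                 simp add: algebra_simps)
  show "scaleC a (scaleC b f) = scaleC (a * b) f"
    by transfer (rule L2_eqI, simp add: L2_eq_def square_integrable_add square_integrable_cmult,
                 simp add: algebra_simps)
  show "scaleC 1 f = f"
    by transfer (auto simp: L2_eq_def)
qed

lemma scaleC_of_real: "scaleC (of_real c) f = c *\<^sub>R f"
  by transfer (auto simp: L2_eq_def square_integrable_cmult)

lemma inner_eq_Re_cinner: "inner f g = Re (cinner f g)"
  by transfer simp

definition orthogonal_complement :: "'n::finite sphere_L2 set \<Rightarrow> 'n sphere_L2 set" where
  "orthogonal_complement S = {f. \<forall>g\<in>S. cinner f g = 0}"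


section \<open>Spherical harmonics of bidegree (p,q)\<close>

text \<open>A polynomial \<open>f(z, cnj z)\<close> is represented by the polynomial \<open>F z w\<close> in two independent
  vectors of variables, evaluated at \<open>w = cnj z\<close>.\<close>

definition vcnj :: "complex ^ 'n \<Rightarrow> complex ^ 'n" where
  "vcnj z = (\<chi> i. cnj (z $ i))"

definition polynomial2 :: "(complex ^ 'n::finite \<Rightarrow> complex ^ 'n \<Rightarrow> complex) \<Rightarrow> bool" where
  "polynomial2 F \<longleftrightarrow>
     (\<exists>(I :: (('n \<Rightarrow> nat) \<times> ('n \<Rightarrow> nat)) set) c. finite I \<and>
        (\<forall>z w. F z w =
          (\<Sum>(\<alpha>, \<beta>)\<in>I. c (\<alpha>, \<beta>) * (\<Prod>i\<in>UNIV. (z $ i) ^ \<alpha> i) * (\<Prod>i\<in>UNIV. (w $ i) ^ \<beta> i))))"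

definition bihomogeneous ::
  "nat \<Rightarrow> nat \<Rightarrow> (complex ^ 'n::finite \<Rightarrow> complex ^ 'n \<Rightarrow> complex) \<Rightarrow> bool" where
  "bihomogeneous p q F \<longleftrightarrow>
     (\<forall>a b z. F (a *s z) (b *s vcnj z) = a ^ p * b ^ q * F z (vcnj z))"

definition laplacian :: "('a::euclidean_space \<Rightarrow> complex) \<Rightarrow> 'a \<Rightarrow> complex" where
  "laplacian f x =
     (\<Sum>b\<in>Basis. vector_derivative
        (\<lambda>s. vector_derivative (\<lambda>t. f (x + t *\<^sub>R b)) (at s)) (at 0))"

text \<open>Elements of \<^typ>\<open>'n sphere_L2\<close> only see the restriction of a function to the sphere, since
  \<^const>\<open>sphere_measure\<close> lives on \<^term>\<open>sphere 0 1\<close>.\<close>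

definition bidegree_harmonics :: "nat \<Rightarrow> nat \<Rightarrow> 'n::finite sphere_L2 set" where
  "bidegree_harmonics p q =
     {abs_sphere_L2 (\<lambda>z. F z (vcnj z)) | F.
        polynomial2 F \<and> bihomogeneous p q F \<and> (\<forall>z. laplacian (\<lambda>z. F z (vcnj z)) z = 0)}"


section \<open>The Kohn Laplacian and the complex Green operator\<close>

text \<open>The Kohn Laplacian is unbounded; it is given by its graph. With respect to the Hilbert direct
  sum decomposition into the spaces \<^term>\<open>bidegree_harmonics p q\<close> it multiplies the \<open>(p,q)\<close> component
  by \<open>2 q (p + n - 1)\<close>, and its domain consists of those \<open>f\<close> for which the resulting orthogonal
  series converges.\<close>

definition kohn_eigenvalue :: "'n::finite itself \<Rightarrow> nat \<Rightarrow> nat \<Rightarrow> real" where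
  "kohn_eigenvalue _ p q = 2 * real q * (real p + real CARD('n) - 1)"

definition kohn_laplacian :: "('n::finite sphere_L2 \<times> 'n sphere_L2) set" where
  "kohn_laplacian =
     {(f, g). \<exists>F. (\<forall>p q. F (p, q) \<in> bidegree_harmonics p q) \<and>
        (F has_sum f) UNIV \<and>
        ((\<lambda>(p, q). kohn_eigenvalue TYPE('n) p q *\<^sub>R F (p, q)) has_sum g) UNIV}"

definition kohn_kernel :: "'n::finite sphere_L2 set" where
  "kohn_kernel = {f. (f, 0) \<in> kohn_laplacian}"

definition is_complex_green_operator :: "('n::finite sphere_L2 \<Rightarrow> 'n sphere_L2) \<Rightarrow> bool" where
  "is_complex_green_operator G \<longleftrightarrow>
     Vector_Spaces.linear scaleC scaleC G \<and>
     (\<forall>f\<in>kohn_kernel. G f = 0) \<and>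
     (\<forall>f\<in>orthogonal_complement kohn_kernel.
        G f \<in> orthogonal_complement kohn_kernel \<and> (G f, f) \<in> kohn_laplacian)"

definition complex_green_operator :: "'n::finite sphere_L2 \<Rightarrow> 'n sphere_L2" where
  "complex_green_operator = (THE G. is_complex_green_operator G)"


section \<open>Schatten norms\<close>

definition eigenspace :: "('n::finite sphere_L2 \<Rightarrow> 'n sphere_L2) \<Rightarrow> complex \<Rightarrow> 'n sphere_L2 set" where
  "eigenspace T \<mu> = {f. T f = scaleC \<mu> f}"

text \<open>The eigenvalues of a compact positive semi-definite operator in decreasing order, each repeated
  according to its multiplicity. When there are infinitely many positive eigenvalues the sequence
  consists of these (a zero eigenvalue is never reached); otherwise it is eventually \<open>0\<close>.
  Finiteness of the level sets is required separately because \<^const>\<open>card\<close> and the dimension are \<open>0\<close>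
  in the infinite case.\<close>

definition is_eigenvalue_sequence ::
  "('n::finite sphere_L2 \<Rightarrow> 'n sphere_L2) \<Rightarrow> (nat \<Rightarrow> real) \<Rightarrow> bool" where
  "is_eigenvalue_sequence T l \<longleftrightarrow>
     decseq l \<and> (\<forall>k. 0 \<le> l k) \<and>
     (\<forall>\<mu>>0. finite {k. l k = \<mu>} \<and>
        card {k. l k = \<mu>} = complex_L2.dim (eigenspace T (of_real \<mu>)))"

lemma is_eigenvalue_sequence_unique:
  assumes "is_eigenvalue_sequence T l" "is_eigenvalue_sequence T m"
  shows "l = m"
proof -
  have *: False
    if l: "is_eigenvalue_sequence T l" and m: "is_eigenvalue_sequence T m"
      and eq: "\<And>j. j < k \<Longrightarrow> l j = m j" and less: "m k < l k" for l m k
  proof -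
    have pos: "0 < l k"
      using m less by (auto simp: is_eigenvalue_sequence_def intro: le_less_trans)
    have "{j. m j = l k} \<subseteq> {j. l j = l k} - {k}"
    proof safe
      fix j assume j: "m j = l k"
      have "j < k"
      proof (rule ccontr)
        assume "\<not> j < k"
        then have "m j \<le> m k"
          using m by (auto simp: is_eigenvalue_sequence_def decseq_def)
        then show False using j less by simp
      qed
      then show "l j = l k" using eq[of j] j by simp
    qed (use less in auto)
    then have "{j. m j = l k} \<subset> {j. l j = l k}" by auto
    moreover have "finite {j. l j = l k}" "card {j. m j = l k} = card {j. l j = l k}"
      using l m pos by (auto simp: is_eigenvalue_sequence_def)
    ultimately show False
      using psubset_card_mono[of "{j. l j = l k}" "{j. m j = l k}"] by simp
  qed
  have "l k = m k" for k
  proof (induction k rule: less_induct)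
    case (less k)
    then show ?case
      using *[OF assms, of k] *[OF assms(2) assms(1), of k] by (metis linorder_neqE)
  qed
  then show ?thesis by auto
qed

definition eigenvalue_sequence ::
  "('n::finite sphere_L2 \<Rightarrow> 'n sphere_L2) \<Rightarrow> nat \<Rightarrow> real" where
  "eigenvalue_sequence T = (THE l. is_eigenvalue_sequence T l)"

definition schatten_norm :: "real \<Rightarrow> ('n::finite sphere_L2 \<Rightarrow> 'n sphere_L2) \<Rightarrow> ennreal" where
  "schatten_norm r T =
     (let s = (\<Sum>k. ennreal (eigenvalue_sequence T k powr r))
      in if s = \<infinity> then \<infinity> else ennreal (enn2real s powr (1 / r)))"

end

theory Submission
  imports Defs
begin

text \<open>The eigenvalue \<open>1 / (2 q (p + n - 1))\<close> of the Green operator has as multiplicity the sum of the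
  dimensions of the spaces of harmonics of bidegree \<open>(p, q)\<close> attached to it, so the \<open>r\<close>-th power of the
  Schatten norm is the double series \<open>\<Sum> dim H\<^sub>p\<^sub>q / (2 q (p + n - 1))\<^sup>r\<close> over \<open>p \<ge> 0\<close>, \<open>q \<ge> 1\<close>. Counting
  monomials gives \<open>dim H\<^sub>p\<^sub>q \<le> ((p + 1) (q + 1))\<^sup>n\<^sup>-\<^sup>1\<close>, which suffices for convergence when \<open>r > n\<close>; an
  explicit independent family shows that \<open>dim H\<^sub>p\<^sub>1\<close> grows at least like \<open>p\<^sup>n\<^sup>-\<^sup>1\<close>, so for \<open>r \<le> n\<close> the row
  \<open>q = 1\<close> already dominates a harmonic series.

  That these are all the eigenvalues rests on the orthogonal decomposition of \<open>L\<^sup>2\<close> into the spaces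
  \<open>H\<^sub>p\<^sub>q\<close>. Every polynomial is \<open>H + |z|\<^sup>2 G\<close> with \<open>H\<close> harmonic, because an equation
  \<open>l G + |z|\<^sup>2 \<Delta> G = F\<close> with \<open>l > 0\<close> is solvable by recursion on the degree; polynomials are total by
  Stone-Weierstrass. Orthogonality follows from Green's identity. Since a homogeneous function
  has proportional integrals over the sphere and, against the weight \<open>(1 - |z|\<^sup>2)\<^sub>+\<^sup>m\<close>, over the ball, all
  integrations by parts can be done on the ball, where the weight kills the boundary terms.\<close>

section \<open>Polynomials in two vectors of variables\<close>

text \<open>The threshold r = n is the same in p and in q because both estimates depend only on y =
  q (p + 1): the dimension is at most (2 y)^(n-1) and the eigenvalue at most 1 / (2 y), so the
  double series is bounded by a product of two single series with exponent n - 1 - r. Keeping z and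
  w independent turns Wirtinger derivatives into ordinary complex derivatives and conjugation into
  an exchange of the two variables. The price is a pair of homogeneity notions:
  \<open>bihom\<close>, at all (z, w), is stable under differentiation and drives the harmonic
  decomposition; \<open>bihomogeneous\<close>, only at w = \<open>vcnj\<close> z, is what membership
  in the harmonics provides, and orthogonality and the dimension bounds must live with it. Since the
  Green operator is given by a description, it has to be identified with an orthogonal series, and
  the convergence of that series requires completeness of the quotient space. Distinct pairs (p, q)
  may share an eigenvalue, so multiplicities are collected over the fibres of the integer q (p + n -
  1), half the Kohn eigenvalue, before series are compared.\<close>

type_synonym 'n bifun = "complex ^ 'n \<Rightarrow> complex ^ 'n \<Rightarrow> complex"

lemma polynomial2_monomial:
  fixes \<alpha> \<beta> :: "'n::finite \<Rightarrow> nat"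
  shows "polynomial2 (\<lambda>z w. c * (\<Prod>i\<in>UNIV. (z $ i) ^ \<alpha> i) * (\<Prod>i\<in>UNIV. (w $ i) ^ \<beta> i))"
  unfolding polynomial2_def
  by (rule exI[of _ "{(\<alpha>, \<beta>)}"], rule exI[of _ "\<lambda>_. c"]) auto

lemma polynomial2_const [intro]: "polynomial2 (\<lambda>z w. c)"
  using polynomial2_monomial[of c "\<lambda>_. 0" "\<lambda>_. 0"] by simp

lemma prod_power_single:
  fixes z :: "complex ^ 'n::finite"
  shows "(\<Prod>j\<in>UNIV. (z $ j) ^ (if j = i then 1 else 0)) = z $ i"
  by (simp add: if_distrib[of "\<lambda>k. _ ^ k"] prod.delta cong: if_cong)

lemma polynomial2_fst [intro]: "polynomial2 (\<lambda>z w. z $ (i :: 'n::finite))"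
  using polynomial2_monomial[of 1 "\<lambda>j. if j = i then 1 else 0" "\<lambda>_. 0"] by (simp add: prod_power_single)

lemma polynomial2_snd [intro]: "polynomial2 (\<lambda>z w. w $ (i :: 'n::finite))"
  using polynomial2_monomial[of 1 "\<lambda>_. 0" "\<lambda>j. if j = i then 1 else 0"] by (simp add: prod_power_single)

lemma polynomial2_add [intro]:
  assumes "polynomial2 F" "polynomial2 G"
  shows "polynomial2 (\<lambda>z w. F z w + G z w)"
proof -
  obtain I c where I: "finite I" and F: "\<And>z w. F z w =
      (\<Sum>(\<alpha>, \<beta>)\<in>I. c (\<alpha>, \<beta>) * (\<Prod>i\<in>UNIV. (z $ i) ^ \<alpha> i) * (\<Prod>i\<in>UNIV. (w $ i) ^ \<beta> i))"
    using assms(1) unfolding polynomial2_def by blast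
  obtain J d where J: "finite J" and G: "\<And>z w. G z w =
      (\<Sum>(\<alpha>, \<beta>)\<in>J. d (\<alpha>, \<beta>) * (\<Prod>i\<in>UNIV. (z $ i) ^ \<alpha> i) * (\<Prod>i\<in>UNIV. (w $ i) ^ \<beta> i))"
    using assms(2) unfolding polynomial2_def by blast
  define e where "e s = (if s \<in> I then c s else 0) + (if s \<in> J then d s else 0)" for s
  have "F z w + G z w = (\<Sum>(\<alpha>, \<beta>)\<in>I \<union> J. e (\<alpha>, \<beta>) * (\<Prod>i\<in>UNIV. (z $ i) ^ \<alpha> i) * (\<Prod>i\<in>UNIV. (w $ i) ^ \<beta> i))"
    for z w
  proof -
    have "F z w = (\<Sum>(\<alpha>, \<beta>)\<in>I \<union> J. (if (\<alpha>, \<beta>) \<in> I then c (\<alpha>, \<beta>) else 0) * (\<Prod>i\<in>UNIV. (z $ i) ^ \<alpha> i) * (\<Prod>i\<in>UNIV. (w $ i) ^ \<beta> i))"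
      unfolding F by (rule sum.mono_neutral_cong_left) (use I J in auto)
    moreover have "G z w = (\<Sum>(\<alpha>, \<beta>)\<in>I \<union> J. (if (\<alpha>, \<beta>) \<in> J then d (\<alpha>, \<beta>) else 0) * (\<Prod>i\<in>UNIV. (z $ i) ^ \<alpha> i) * (\<Prod>i\<in>UNIV. (w $ i) ^ \<beta> i))"
      unfolding G by (rule sum.mono_neutral_cong_left) (use I J in auto)
    ultimately show ?thesis
      by (simp add: e_def sum.distrib[symmetric] distrib_right case_prod_unfold)
  qed
  then show ?thesis unfolding polynomial2_def using I J by (intro exI[of _ "I \<union> J"] exI[of _ e]) auto
qed

lemma polynomial2_sum [intro]:
  assumes "\<And>s. s \<in> S \<Longrightarrow> polynomial2 (F s)"
  shows "polynomial2 (\<lambda>z w. \<Sum>s\<in>S. F s z w)"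
  using assms by (induction S rule: infinite_finite_induct) auto

lemma polynomial2_mult [intro]:
  assumes "polynomial2 F" "polynomial2 G"
  shows "polynomial2 (\<lambda>z w. F z w * G z w)"
proof -
  obtain I c where F: "\<And>z w. F z w =
      (\<Sum>(\<alpha>, \<beta>)\<in>I. c (\<alpha>, \<beta>) * (\<Prod>i\<in>UNIV. (z $ i) ^ \<alpha> i) * (\<Prod>i\<in>UNIV. (w $ i) ^ \<beta> i))"
    using assms(1) unfolding polynomial2_def by blast
  obtain J d where G: "\<And>z w. G z w =
      (\<Sum>(\<alpha>, \<beta>)\<in>J. d (\<alpha>, \<beta>) * (\<Prod>i\<in>UNIV. (z $ i) ^ \<alpha> i) * (\<Prod>i\<in>UNIV. (w $ i) ^ \<beta> i))"
    using assms(2) unfolding polynomial2_def by blast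
  have "F z w * G z w = (\<Sum>s\<in>I. \<Sum>t\<in>J. (c s * d t) *
      (\<Prod>i\<in>UNIV. (z $ i) ^ (fst s i + fst t i)) * (\<Prod>i\<in>UNIV. (w $ i) ^ (snd s i + snd t i)))" for z w
    unfolding F G sum_product
    by (intro sum.cong refl) (simp add: case_prod_unfold power_add prod.distrib)
  moreover have "polynomial2 (\<lambda>z w. \<Sum>s\<in>I. \<Sum>t\<in>J. (c s * d t) *
      (\<Prod>i\<in>UNIV. (z $ i) ^ (fst s i + fst t i)) * (\<Prod>i\<in>UNIV. (w $ i) ^ (snd s i + snd t i)))"
    by (intro polynomial2_sum polynomial2_monomial)
  ultimately show ?thesis by simp
qed

text \<open>Monomials are products of coordinates, so polynomials form the algebra generated by
  constants and coordinates. Differential identities then need checking only on generators, sums and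
  products.\<close>

lemma polynomial2_induct [consumes 1, case_names const fst snd add mult]:
  fixes F :: "'n::finite bifun"
  assumes F: "polynomial2 F"
    and const: "\<And>c. P (\<lambda>z w. c)"
    and fst: "\<And>i. P (\<lambda>z w. z $ i)"
    and snd: "\<And>i. P (\<lambda>z w. w $ i)"
    and add: "\<And>F G. polynomial2 F \<Longrightarrow> polynomial2 G \<Longrightarrow> P F \<Longrightarrow> P G \<Longrightarrow> P (\<lambda>z w. F z w + G z w)"
    and mult: "\<And>F G. polynomial2 F \<Longrightarrow> polynomial2 G \<Longrightarrow> P F \<Longrightarrow> P G \<Longrightarrow> P (\<lambda>z w. F z w * G z w)"
  shows "P F"
proof -
  \<comment> \<open>Carrying \<open>polynomial2\<close> along supplies the side conditions of
    \<open>add\<close> and \<open>mult\<close> for every partial sum and product.\<close>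
  let ?Q = "\<lambda>F. polynomial2 F \<and> P F"
  have Qm: "?Q (\<lambda>z w. F z w * G z w)" if "?Q F" "?Q G" for F G using that mult by auto
  have Qc: "?Q (\<lambda>z w. c)" for c using const by auto
  have Qpow: "?Q (\<lambda>z w. F z w ^ k)" if "?Q F" for F k
  proof (induction k)
    case 0 then show ?case using Qc[of 1] by simp
  next
    case (Suc k) then show ?case using Qm[OF that Suc] by simp
  qed
  have Qprod: "?Q (\<lambda>z w. \<Prod>s\<in>S. F s z w)" if "\<And>s. ?Q (F s)" for F and S :: "'n set"
  proof (induction S rule: infinite_finite_induct)
    case (insert x S) then show ?case using Qm[OF that[of x] insert.IH] by simp
  qed (use Qc in auto)
  have Qsum: "?Q (\<lambda>z w. \<Sum>s\<in>S. F s z w)" if "\<And>s. ?Q (F s)" for F and S :: "(('n \<Rightarrow> nat) \<times> ('n \<Rightarrow> nat)) set"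
  proof (induction S rule: infinite_finite_induct)
    case (insert x S) then show ?case using add[of "F x" "\<lambda>z w. \<Sum>s\<in>S. F s z w"] that[of x] by auto
  qed (use Qc in auto)
  obtain I c where F: "\<And>z w. F z w =
      (\<Sum>(\<alpha>, \<beta>)\<in>I. c (\<alpha>, \<beta>) * (\<Prod>i\<in>UNIV. (z $ i) ^ \<alpha> i) * (\<Prod>i\<in>UNIV. (w $ i) ^ \<beta> i))"
    using assms(1) unfolding polynomial2_def by blast
  have "F = (\<lambda>z w. \<Sum>s\<in>I. c s * (\<Prod>i\<in>UNIV. (z $ i) ^ fst s i) * (\<Prod>i\<in>UNIV. (w $ i) ^ snd s i))"
    by (simp add: F case_prod_unfold fun_eq_iff)
  moreover have "?Q \<dots>"
    by (intro Qsum Qm Qprod Qpow Qc) (use fst snd in auto)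
  ultimately show ?thesis by simp
qed

text \<open>With z and w independent these are ordinary complex derivatives. After the substitution
  w = \<open>vcnj\<close> z, \<open>pdz\<close> and \<open>pdw\<close> are the Wirtinger derivatives
  in the i-th coordinate and its conjugate.\<close>

definition pdz :: "'n \<Rightarrow> ('n::finite bifun) \<Rightarrow>
    'n bifun" where
  "pdz i F z w = deriv (\<lambda>t. F (z + t *s axis i 1) w) 0"

definition pdw :: "'n \<Rightarrow> ('n::finite bifun) \<Rightarrow>
    'n bifun" where
  "pdw i F z w = deriv (\<lambda>t. F z (w + t *s axis i 1)) 0"

lemma polynomial2_line_differentiable:
  assumes "polynomial2 F"
  shows "(\<lambda>t. F (z + t *s u) (w + t *s v)) field_differentiable (at x)"
  using assms
  by (induction F rule: polynomial2_induct)
    (auto intro!: derivative_intros field_differentiable_add field_differentiable_mult)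

lemma polynomial2_differentiable_z:
  "polynomial2 F \<Longrightarrow> (\<lambda>t. F (z + t *s u) w) field_differentiable (at x)"
  using polynomial2_line_differentiable[of F z u w 0 x] by simp

lemma polynomial2_differentiable_w:
  "polynomial2 F \<Longrightarrow> (\<lambda>t. F z (w + t *s u)) field_differentiable (at x)"
  using polynomial2_line_differentiable[of F z 0 w u x] by simp

lemma pdz_const [simp]: "pdz i (\<lambda>z w. c) = (\<lambda>z w. 0)"
  and pdw_const [simp]: "pdw i (\<lambda>z w. c) = (\<lambda>z w. 0)"
  and pdz_snd [simp]: "pdz i (\<lambda>z w. w $ j) = (\<lambda>z w. 0)"
  and pdw_fst [simp]: "pdw i (\<lambda>z w. z $ j) = (\<lambda>z w. 0)"
  by (simp_all add: pdz_def pdw_def fun_eq_iff)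

lemma pdz_fst [simp]: "pdz i (\<lambda>z w. z $ j) = (\<lambda>z w. if i = j then 1 else 0)"
  and pdw_snd [simp]: "pdw i (\<lambda>z w. w $ j) = (\<lambda>z w. if i = j then 1 else 0)"
  by (auto simp: pdz_def pdw_def fun_eq_iff axis_def)

lemma pdz_add:
  assumes "polynomial2 F" "polynomial2 G"
  shows "pdz i (\<lambda>z w. F z w + G z w) = (\<lambda>z w. pdz i F z w + pdz i G z w)"
  by (auto simp: pdz_def fun_eq_iff polynomial2_differentiable_z assms)

lemma pdw_add:
  assumes "polynomial2 F" "polynomial2 G"
  shows "pdw i (\<lambda>z w. F z w + G z w) = (\<lambda>z w. pdw i F z w + pdw i G z w)"
  by (auto simp: pdw_def fun_eq_iff polynomial2_differentiable_w assms)

lemma pdz_mult: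
  assumes "polynomial2 F" "polynomial2 G"
  shows "pdz i (\<lambda>z w. F z w * G z w) = (\<lambda>z w. F z w * pdz i G z w + pdz i F z w * G z w)"
  by (auto simp: pdz_def fun_eq_iff polynomial2_differentiable_z assms)

lemma pdw_mult:
  assumes "polynomial2 F" "polynomial2 G"
  shows "pdw i (\<lambda>z w. F z w * G z w) = (\<lambda>z w. F z w * pdw i G z w + pdw i F z w * G z w)"
  by (auto simp: pdw_def fun_eq_iff polynomial2_differentiable_w assms)

lemma pdz_cmult:
  "polynomial2 F \<Longrightarrow> pdz i (\<lambda>z w. c * F z w) = (\<lambda>z w. c * pdz i F z w)"
  using pdz_mult[OF polynomial2_const, of F i c] by simp

lemma pdw_cmult:
  "polynomial2 F \<Longrightarrow> pdw i (\<lambda>z w. c * F z w) = (\<lambda>z w. c * pdw i F z w)"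
  using pdw_mult[OF polynomial2_const, of F i c] by simp

lemma pdz_sum:
  assumes "\<And>s. s \<in> S \<Longrightarrow> polynomial2 (F s)"
  shows "pdz i (\<lambda>z w. \<Sum>s\<in>S. F s z w) = (\<lambda>z w. \<Sum>s\<in>S. pdz i (F s) z w)"
  using assms by (induction S rule: infinite_finite_induct) (auto simp: pdz_add polynomial2_sum)

lemma pdw_sum:
  assumes "\<And>s. s \<in> S \<Longrightarrow> polynomial2 (F s)"
  shows "pdw i (\<lambda>z w. \<Sum>s\<in>S. F s z w) = (\<lambda>z w. \<Sum>s\<in>S. pdw i (F s) z w)"
  using assms by (induction S rule: infinite_finite_induct) (auto simp: pdw_add polynomial2_sum)

lemma polynomial2_pdz [intro]: "polynomial2 F \<Longrightarrow> polynomial2 (pdz i F)"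
  by (induction F rule: polynomial2_induct) (auto simp: pdz_add pdz_mult)

lemma polynomial2_pdw [intro]: "polynomial2 F \<Longrightarrow> polynomial2 (pdw i F)"
  by (induction F rule: polynomial2_induct) (auto simp: pdw_add pdw_mult)

lemma pdz_pdw_commute: "polynomial2 F \<Longrightarrow> pdz i (pdw j F) = pdw j (pdz i F)"
proof (induction F rule: polynomial2_induct)
  case (mult F G)
  then show ?case
    by (simp add: pdz_add pdw_add pdz_mult pdw_mult polynomial2_pdz polynomial2_pdw polynomial2_mult
      algebra_simps)
qed (auto simp: pdz_add pdw_add polynomial2_pdz polynomial2_pdw)

text \<open>Both arguments move along lines at once, which covers the curve t -> (x + t b,
  \<open>vcnj\<close> (x + t b)). Parameter 0 suffices because the base point is arbitrary.\<close>

lemma polynomial2_chain: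
  assumes "polynomial2 F"
  shows "((\<lambda>t. F (z + t *s u) (w + t *s v)) has_field_derivative
    (\<Sum>i\<in>UNIV. u $ i * pdz i F z w + v $ i * pdw i F z w)) (at 0)"
  using assms
proof (induction F rule: polynomial2_induct)
  case (add F G)
  then show ?case
    by (auto intro!: derivative_eq_intros simp: pdz_add pdw_add sum.distrib algebra_simps)
next
  case (mult F G)
  have "((\<lambda>t. F (z + t *s u) (w + t *s v) * G (z + t *s u) (w + t *s v)) has_field_derivative
     (\<Sum>i\<in>UNIV. u $ i * pdz i F z w + v $ i * pdw i F z w) * G z w +
      (\<Sum>i\<in>UNIV. u $ i * pdz i G z w + v $ i * pdw i G z w) * F z w) (at 0)"
    using DERIV_mult[OF mult.IH] by simp
  moreover have "(\<Sum>i\<in>UNIV. u $ i * pdz i F z w + v $ i * pdw i F z w) * G z w +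
      (\<Sum>i\<in>UNIV. u $ i * pdz i G z w + v $ i * pdw i G z w) * F z w =
      (\<Sum>i\<in>UNIV. u $ i * pdz i (\<lambda>z w. F z w * G z w) z w + v $ i * pdw i (\<lambda>z w. F z w * G z w) z w)"
    by (simp add: mult pdz_mult pdw_mult sum_distrib_right sum_distrib_left
      sum.distrib[symmetric] algebra_simps)
  ultimately show ?case by simp
next
  case (fst i)
  show ?case by (auto intro!: derivative_eq_intros simp: if_distrib[of "(*) _"] cong: if_cong)
next
  case (snd i)
  show ?case by (auto intro!: derivative_eq_intros simp: if_distrib[of "(*) _"] cong: if_cong)
qed auto

section \<open>Wirtinger calculus and the harmonic decomposition\<close>

lemma vcnj_nth [simp]: "vcnj z $ i = cnj (z $ i)"
  by (simp add: vcnj_def)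

lemma vcnj_vcnj [simp]: "vcnj (vcnj z) = z"
  by (simp add: vec_eq_iff)

text \<open>This is the polynomial whose restriction to w = \<open>vcnj\<close> z is the complex
  conjugate of that of F. It exchanges the roles of z and w.\<close>

definition pcnj :: "('n::finite bifun) \<Rightarrow>
    'n bifun" where
  "pcnj F z w = cnj (F (vcnj w) (vcnj z))"

lemma polynomial2_pcnj [intro]: "polynomial2 F \<Longrightarrow> polynomial2 (pcnj F)"
  unfolding pcnj_def by (induction F rule: polynomial2_induct) auto

lemma pdz_pcnj: "polynomial2 F \<Longrightarrow> pdz i (pcnj F) = pcnj (pdw i F)"
proof (induction F rule: polynomial2_induct)
  case (add F G)
  have "pdz i (\<lambda>z w. pcnj F z w + pcnj G z w) = pcnj (\<lambda>z w. pdw i F z w + pdw i G z w)"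
    by (simp add: pdz_add add polynomial2_pcnj) (simp add: pcnj_def fun_eq_iff)
  then show ?case by (simp add: pdw_add add) (simp add: pcnj_def[abs_def])
next
  case (mult F G)
  have "pdz i (\<lambda>z w. pcnj F z w * pcnj G z w) = pcnj (\<lambda>z w. F z w * pdw i G z w + pdw i F z w * G z w)"
    by (simp add: pdz_mult mult polynomial2_pcnj) (simp add: pcnj_def fun_eq_iff)
  then show ?case by (simp add: pdw_mult mult) (simp add: pcnj_def[abs_def])
qed (auto simp: pcnj_def[abs_def])

lemma pcnj_pcnj [simp]: "pcnj (pcnj F) = F"
  by (simp add: pcnj_def fun_eq_iff)

lemma pdw_pcnj: "polynomial2 F \<Longrightarrow> pdw i (pcnj F) = pcnj (pdz i F)"
  using pdz_pcnj[of "pcnj F" i] by (metis pcnj_pcnj polynomial2_pcnj)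

text \<open>A quarter of the Laplacian, written with Wirtinger derivatives; see
  \<open>laplacian_polynomial2\<close>.\<close>

definition lap2 :: "('n::finite bifun) \<Rightarrow>
    'n bifun" where
  "lap2 F z w = (\<Sum>i\<in>UNIV. pdz i (pdw i F) z w)"

lemma lap2_pcnj: "polynomial2 F \<Longrightarrow> lap2 (pcnj F) = pcnj (lap2 F)"
  by (simp add: lap2_def[abs_def] fun_eq_iff pdz_pcnj pdw_pcnj polynomial2_pdz pdz_pdw_commute)
     (simp add: pcnj_def)

text \<open>The real directional derivative of z -> F z (\<open>vcnj\<close> z): when z moves along
  b, the second argument moves along \<open>vcnj\<close> b.\<close>

definition ddir :: "complex ^ 'n \<Rightarrow> ('n::finite bifun) \<Rightarrow>
    'n bifun" where
  "ddir b F z w = (\<Sum>i\<in>UNIV. b $ i * pdz i F z w + cnj (b $ i) * pdw i F z w)"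

lemma polynomial2_ddir [intro]: "polynomial2 F \<Longrightarrow> polynomial2 (ddir b F)"
  unfolding ddir_def[abs_def]
  by (intro polynomial2_sum polynomial2_add polynomial2_mult polynomial2_const polynomial2_pdz polynomial2_pdw)

lemma polynomial2_vector_derivative:
  assumes "polynomial2 F"
  shows "((\<lambda>t. F (x + t *\<^sub>R b) (vcnj (x + t *\<^sub>R b))) has_vector_derivative
    ddir b F (x + s *\<^sub>R b) (vcnj (x + s *\<^sub>R b))) (at s)"
proof -
  \<comment> \<open>Moving the base point to the point of differentiation reduces the claim to
    \<open>polynomial2_chain\<close> at parameter 0, composed with t -> t - s.\<close>
  define y where "y = x + s *\<^sub>R b"
  have "((\<lambda>t::real. of_real (t - s) :: complex) has_vector_derivative 1) (at s)"
    by (auto intro!: derivative_eq_intros)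
  moreover have "((\<lambda>t. F (y + t *s b) (vcnj y + t *s vcnj b)) has_field_derivative
      ddir b F y (vcnj y)) (at (of_real (s - s)))"
    using polynomial2_chain[OF assms, of y b "vcnj y" "vcnj b"] by (simp add: ddir_def)
  ultimately have "((\<lambda>t. F (y + t *s b) (vcnj y + t *s vcnj b)) \<circ> (\<lambda>t. of_real (t - s))
      has_vector_derivative 1 * ddir b F y (vcnj y)) (at s)"
    by (rule field_vector_diff_chain_at)
  moreover have "y + of_real (t - s) *s b = x + t *\<^sub>R b" for t
    by (simp add: y_def vec_eq_iff) (simp add: scaleR_conv_of_real algebra_simps)
  moreover have "vcnj y + of_real (t - s) *s vcnj b = vcnj (x + t *\<^sub>R b)" for t
    by (simp add: y_def vec_eq_iff) (simp add: scaleR_conv_of_real algebra_simps)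
  ultimately show ?thesis by (simp only: o_def y_def[symmetric] mult_1)
qed

lemma ddir_axis_1: "ddir (axis j 1) F z w = pdz j F z w + pdw j F z w"
  by (simp add: ddir_def axis_def if_distrib[of "\<lambda>x. x * _"] if_distrib[of cnj] sum.distrib cong: if_cong)

lemma ddir_axis_ii: "ddir (axis j \<i>) F z w = \<i> * (pdz j F z w - pdw j F z w)"
  by (simp add: ddir_def axis_def if_distrib[of "\<lambda>x. x * _"] if_distrib[of cnj] sum.distrib
    right_diff_distrib sum_subtractf cong: if_cong)

lemma sum_Basis_complex_vec:
  fixes g :: "complex ^ 'n::finite \<Rightarrow> 'b::comm_monoid_add"
  shows "(\<Sum>b\<in>Basis. g b) = (\<Sum>i\<in>UNIV. g (axis i 1) + g (axis i \<i>))"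
proof -
  have *: "(Basis :: (complex ^ 'n) set) = (\<Union>i\<in>UNIV. {axis i 1, axis i \<i>})"
    by (auto simp: Basis_vec_def Basis_complex_def)
  have "(\<Sum>b\<in>Basis. g b) = (\<Sum>i\<in>UNIV. \<Sum>b\<in>{axis i 1, axis i \<i>}. g b)"
    unfolding * by (rule sum.UNION_disjoint) (auto simp: axis_eq_axis)
  also have "\<dots> = (\<Sum>i\<in>UNIV. g (axis i 1) + g (axis i \<i>))"
    by (intro sum.cong refl) (simp add: axis_eq_axis complex_eq_iff)
  finally show ?thesis .
qed

text \<open>The real and imaginary directions of a coordinate act as \<open>pdz + pdw\<close> and
  \<open>\<i> (pdz - pdw)\<close>; the sum of their squares is 4 \<open>pdz\<close>
  \<open>pdw\<close>.\<close>

lemma laplacian_polynomial2: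
  fixes F :: "'n::finite bifun"
  assumes F: "polynomial2 F"
  shows "laplacian (\<lambda>z. F z (vcnj z)) z = 4 * lap2 F z (vcnj z)"
proof -
  have 1: "vector_derivative (\<lambda>t. G (x + t *\<^sub>R b) (vcnj (x + t *\<^sub>R b))) (at s) =
      ddir b G (x + s *\<^sub>R b) (vcnj (x + s *\<^sub>R b))" if "polynomial2 G" for G and x b :: "complex ^ 'n" and s
    using polynomial2_vector_derivative[OF that] by (rule vector_derivative_at)
  have "laplacian (\<lambda>z. F z (vcnj z)) z = (\<Sum>b\<in>Basis. ddir b (ddir b F) z (vcnj z))"
    unfolding laplacian_def
    by (intro sum.cong refl) (simp add: 1 F polynomial2_ddir)
  also have "\<dots> = (\<Sum>i\<in>UNIV. 4 * pdz i (pdw i F) z (vcnj z))"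
    unfolding sum_Basis_complex_vec
  proof (intro sum.cong refl)
    fix i :: 'n
    have a: "ddir (axis i 1) F = (\<lambda>z w. pdz i F z w + pdw i F z w)"
      by (simp add: fun_eq_iff ddir_axis_1)
    have b: "ddir (axis i \<i>) F = (\<lambda>z w. \<i> * (pdz i F z w + (-1) * pdw i F z w))"
      by (simp add: fun_eq_iff ddir_axis_ii)
    have p: "polynomial2 (pdz i F)" "polynomial2 (pdw i F)" "polynomial2 (\<lambda>z w. (-1) * pdw i F z w)"
      "polynomial2 (\<lambda>z w. pdz i F z w + (-1) * pdw i F z w)"
      using F by (intro polynomial2_add polynomial2_mult polynomial2_const polynomial2_pdz polynomial2_pdw; assumption)+
    show "ddir (axis i 1) (ddir (axis i 1) F) z (vcnj z) + ddir (axis i \<i>) (ddir (axis i \<i>) F) z (vcnj z) =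
        4 * pdz i (pdw i F) z (vcnj z)"
      unfolding ddir_axis_1 ddir_axis_ii a b pdz_cmult[OF p(4)] pdw_cmult[OF p(4)]
        pdz_add[OF p(1) p(3)] pdw_add[OF p(1) p(3)] pdz_add[OF p(1) p(2)] pdw_add[OF p(1) p(2)]
        pdz_cmult[OF p(2)] pdw_cmult[OF p(2)]
      by (simp add: pdz_pdw_commute[OF F] algebra_simps)
  qed
  finally show ?thesis by (simp add: lap2_def sum_distrib_left)
qed

section \<open>Euler's identity and bihomogeneous polynomials\<close>

lemma euler:
  assumes F: "polynomial2 F"
    and hom: "\<And>a. a \<noteq> 0 \<Longrightarrow> F (z + (a - 1) *s u) (w + (a - 1) *s v) = a ^ p * F z w"
  shows "(\<Sum>i\<in>UNIV. u $ i * pdz i F z w + v $ i * pdw i F z w) = of_nat p * F z w"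
proof (rule DERIV_unique[OF polynomial2_chain[OF F]])
  show "((\<lambda>t. F (z + t *s u) (w + t *s v)) has_field_derivative of_nat p * F z w) (at 0)"
  \<comment> \<open>The homogeneity relation is differentiated in t = a - 1 at 0. On the unit ball 1
    + t is nonzero, so the hypothesis applies there.\<close>
  proof (rule has_field_derivative_transform_within_open[where S="ball 0 1"])
    show "((\<lambda>t. (1 + t) ^ p * F z w) has_field_derivative of_nat p * F z w) (at 0)"
      by (auto intro!: derivative_eq_intros)
    fix t :: complex assume t: "t \<in> ball 0 1"
    have "1 + t \<noteq> 0"
    proof
      assume "1 + t = 0"
      then have "t = - 1" by (simp add: eq_neg_iff_add_eq_0 add.commute)
      with t show False by simp
    qed
    then show "(1 + t) ^ p * F z w = F (z + t *s u) (w + t *s v)" using hom[of "1 + t"] by simp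
  qed auto
qed

lemma add_smult_self: "z + (a - 1) *s z = a *s (z :: complex ^ 'n)"
  by (simp add: vec_eq_iff algebra_simps)

lemma euler_z:
  assumes "polynomial2 F" "\<And>a. a \<noteq> 0 \<Longrightarrow> F (a *s z) w = a ^ p * F z w"
  shows "(\<Sum>i\<in>UNIV. z $ i * pdz i F z w) = of_nat p * F z w"
  using euler[of F z z w 0 p] assms by (simp add: add_smult_self)

lemma euler_w:
  assumes "polynomial2 F" "\<And>a. a \<noteq> 0 \<Longrightarrow> F z (a *s w) = a ^ p * F z w"
  shows "(\<Sum>i\<in>UNIV. w $ i * pdw i F z w) = of_nat p * F z w"
  using euler[of F z 0 w w p] assms by (simp add: add_smult_self)

text \<open>Asking for the relation at all pairs (z, w), and not only at w = \<open>vcnj\<close> z,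
  makes it pass to partial derivatives. Nonzero scalars allow the division in
  \<open>bihom_pdz\<close>; \<open>bihomD\<close> recovers the zero scalars by continuity.\<close>

definition bihom :: "nat \<Rightarrow> nat \<Rightarrow> ('n::finite bifun) \<Rightarrow> bool" where
  "bihom p q F \<longleftrightarrow> polynomial2 F \<and>
     (\<forall>a b z w. a \<noteq> 0 \<longrightarrow> b \<noteq> 0 \<longrightarrow> F (a *s z) (b *s w) = a ^ p * b ^ q * F z w)"

lemma bihomD:
  assumes "bihom p q F"
  shows "F (a *s z) (b *s w) = a ^ p * b ^ q * F z w"
proof -
  have F: "polynomial2 F" using assms by (simp add: bihom_def)
  have cz: "isCont (\<lambda>a. F (a *s z) w) x" for z w x
    using polynomial2_differentiable_z[OF F, of 0 z w x] by (simp add: field_differentiable_imp_continuous_at)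
  have cw: "isCont (\<lambda>a. F z (a *s w)) x" for z w x
    using polynomial2_differentiable_w[OF F, of z 0 w x] by (simp add: field_differentiable_imp_continuous_at)
  have ext: "f 0 = g 0" if "isCont f 0" "isCont g 0" "\<And>x. x \<noteq> 0 \<Longrightarrow> f x = g x" for f g :: "complex \<Rightarrow> complex"
  proof (rule tendsto_unique[of "at 0"])
    show "(f \<longlongrightarrow> f 0) (at 0)" using that by (simp add: isCont_def)
    show "(f \<longlongrightarrow> g 0) (at 0)"
      using that(2) unfolding isCont_def
      by (rule Lim_transform_eventually) (auto simp: eventually_at_filter that(3))
  qed auto
  have 1: "F (a *s z) (b *s w) = a ^ p * b ^ q * F z w" if "b \<noteq> 0" for a b z w
  proof (cases "a = 0")
    case True
    have "(\<lambda>a. F (a *s z) (b *s w)) 0 = (\<lambda>a. a ^ p * b ^ q * F z w) 0"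
      by (rule ext[OF cz]) (use assms that in \<open>auto simp: bihom_def\<close>)
    then show ?thesis using True by simp
  qed (use assms that in \<open>auto simp: bihom_def\<close>)
  show ?thesis
  proof (cases "b = 0")
    case True
    have "(\<lambda>b. F (a *s z) (b *s w)) 0 = (\<lambda>b. a ^ p * b ^ q * F z w) 0"
      by (rule ext[OF cw]) (use 1 in auto)
    then show ?thesis using True by simp
  qed (use 1 in auto)
qed

lemma bihom_imp_polynomial2: "bihom p q F \<Longrightarrow> polynomial2 F"
  by (simp add: bihom_def)

lemma bihom_imp_bihomogeneous: "bihom p q F \<Longrightarrow> bihomogeneous p q F"
  by (simp add: bihomogeneous_def bihomD)

lemma bihom_add: "bihom p q F \<Longrightarrow> bihom p q G \<Longrightarrow> bihom p q (\<lambda>z w. F z w + G z w)"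
  by (auto simp: bihom_def algebra_simps)

lemma bihom_cmult: "bihom p q F \<Longrightarrow> bihom p q (\<lambda>z w. c * F z w)"
  by (auto simp: bihom_def)

lemma bihom_zero: "bihom p q (\<lambda>z w. 0)"
  by (auto simp: bihom_def)

lemma bihom_sum: "(\<And>s. s \<in> S \<Longrightarrow> bihom p q (F s)) \<Longrightarrow> bihom p q (\<lambda>z w. \<Sum>s\<in>S. F s z w)"
  by (induction S rule: infinite_finite_induct) (auto simp: bihom_zero bihom_add)

lemma bihom_pdz:
  assumes "bihom (Suc p) q F"
  shows "bihom p q (pdz i F)"
  unfolding bihom_def
proof (intro conjI allI impI)
  have F: "polynomial2 F" using assms by (simp add: bihom_def)
  then show "polynomial2 (pdz i F)" ..
  fix a b :: complex and z w :: "complex ^ 'a" assume ab: "a \<noteq> 0" "b \<noteq> 0"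
  \<comment> \<open>A step t after scaling by a is a step t / a before scaling, so the chain rule
    lowers the power of a by one.\<close>
  have *: "F (a *s z + t *s axis i 1) (b *s w) = (a ^ Suc p * b ^ q) * F (z + (t / a) *s axis i 1) w" for t
  proof -
    have "a *s z + t *s axis i 1 = a *s (z + (t / a) *s axis i 1)"
      using ab by (simp add: vec_eq_iff algebra_simps)
    then show ?thesis using bihomD[OF assms, of a "z + (t / a) *s axis i 1" b w] by simp
  qed
  obtain D where D: "((\<lambda>t. F (z + t *s axis i 1) w) has_field_derivative D) (at 0)"
    using polynomial2_differentiable_z[OF F, of z "axis i 1" w 0] by (auto simp: field_differentiable_def)
  have "((\<lambda>t. (a ^ Suc p * b ^ q) * F (z + (t / a) *s axis i 1) w) has_field_derivative
      (a ^ Suc p * b ^ q) * (D * (1 / a))) (at 0)"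
    by (intro DERIV_cmult DERIV_chain2[where g="\<lambda>t. t / a"])
       (use D ab in \<open>auto intro!: derivative_eq_intros\<close>)
  then have "pdz i F (a *s z) (b *s w) = (a ^ Suc p * b ^ q) * (D * (1 / a))"
    unfolding pdz_def * by (rule DERIV_imp_deriv)
  moreover have "pdz i F z w = D" unfolding pdz_def using D by (rule DERIV_imp_deriv)
  ultimately show "pdz i F (a *s z) (b *s w) = a ^ p * b ^ q * pdz i F z w" using ab by simp
qed

lemma bihom_swap: "bihom p q F \<Longrightarrow> bihom q p (pcnj F)"
proof -
  have *: "vcnj (a *s z) = cnj a *s vcnj z" for a and z :: "complex ^ 'a"
    by (simp add: vec_eq_iff)
  assume "bihom p q F"
  then show ?thesis
    by (auto simp: bihom_def * pcnj_def polynomial2_pcnj)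
qed

lemma bihom_pdw:
  assumes "bihom p (Suc q) F"
  shows "bihom p q (pdw i F)"
proof -
  have "polynomial2 F" using assms by (simp add: bihom_def)
  then have "pdz i (pcnj F) = pcnj (pdw i F)" by (rule pdz_pcnj)
  then have "pdw i F = pcnj (pdz i (pcnj F))" by simp
  then show ?thesis using bihom_swap[OF bihom_pdz[OF bihom_swap[OF assms]]] by simp
qed

lemma bihom_0_pdz:
  assumes "bihom 0 q F"
  shows "pdz i F = (\<lambda>z w. 0)"
proof -
  \<comment> \<open>\<open>bihomD\<close> admits the scalar 0, and 0 ^ 0 = 1, so F does not depend
    on z.\<close>
  have "F z w = F 0 w" for z w
    using bihomD[OF assms, of 0 z 1 w] by simp
  then have "F = (\<lambda>z w. F 0 w)" by (simp add: fun_eq_iff)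
  then have "pdz i F z w = pdz i (\<lambda>z w. F 0 w) z w" for z w by simp
  then show ?thesis by (simp add: pdz_def fun_eq_iff)
qed

lemma bihom_lap2: "bihom (Suc p) (Suc q) F \<Longrightarrow> bihom p q (lap2 F)"
  unfolding lap2_def[abs_def] by (intro bihom_sum bihom_pdz bihom_pdw)

lemma lap2_bihom_0:
  assumes "bihom p q F" "p = 0 \<or> q = 0"
  shows "lap2 F z w = 0"
proof -
  have F: "polynomial2 F" using assms by (simp add: bihom_def)
  have "pdz i (pdw i F) = (\<lambda>z w. 0)" for i
  proof (cases "p = 0")
    case True
    then have "pdz i F = (\<lambda>z w. 0)" using bihom_0_pdz[of q F i] assms by simp
    then show ?thesis by (simp add: pdz_pdw_commute F)
  next
    case False
    then have "pdz i (pcnj F) = (\<lambda>z w. 0)" using bihom_0_pdz bihom_swap assms by blast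
    then have "pcnj (pdw i F) = (\<lambda>z w. 0)" using pdz_pcnj[OF F] by simp
    then have "pdw i F = pcnj (\<lambda>z w. 0)" by (metis pcnj_pcnj)
    then show ?thesis by (simp add: pcnj_def[abs_def])
  qed
  then show ?thesis by (simp add: lap2_def)
qed

lemma lap2_add:
  assumes "polynomial2 F" "polynomial2 G"
  shows "lap2 (\<lambda>z w. F z w + G z w) = (\<lambda>z w. lap2 F z w + lap2 G z w)"
  by (simp add: lap2_def[abs_def] pdw_add pdz_add assms polynomial2_pdw sum.distrib)

lemma lap2_cmult:
  assumes "polynomial2 F"
  shows "lap2 (\<lambda>z w. c * F z w) = (\<lambda>z w. c * lap2 F z w)"
  by (simp add: lap2_def[abs_def] pdw_cmult pdz_cmult assms polynomial2_pdw sum_distrib_left)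

section \<open>Splitting off the harmonic part\<close>

definition rad2 :: "'n::finite bifun" where
  "rad2 z w = (\<Sum>i\<in>UNIV. z $ i * w $ i)"

lemma rad2_vcnj: "rad2 z (vcnj z) = of_real ((norm z)\<^sup>2)"
  by (simp add: rad2_def norm_vec_def L2_set_def sum_nonneg complex_norm_square power2_eq_square)
     (simp add: complex_norm_square[symmetric] power2_eq_square)

lemma bihom_rad2_mult:
  assumes "bihom p q F"
  shows "bihom (Suc p) (Suc q) (\<lambda>z w. rad2 z w * F z w)"
proof -
  have "rad2 (a *s z) (b *s w) = a * b * rad2 z w" for a b and z w :: "complex ^ 'a"
    by (simp add: rad2_def sum_distrib_left algebra_simps)
  moreover have "polynomial2 (rad2 :: complex ^ 'a \<Rightarrow> _)" unfolding rad2_def[abs_def]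
    by (intro polynomial2_sum polynomial2_mult polynomial2_fst polynomial2_snd)
  ultimately show ?thesis using assms by (auto simp: bihom_def)
qed

text \<open>In the product rule each coordinate contributes one copy of F, from both derivatives
  hitting \<open>rad2\<close>; the mixed terms give p F and q F by Euler's identity.\<close>

lemma lap2_rad2_mult:
  fixes F :: "'n::finite bifun"
  assumes "bihom p q F"
  shows "lap2 (\<lambda>z w. rad2 z w * F z w) z w =
    of_nat (CARD('n) + p + q) * F z w + rad2 z w * lap2 F z w"
proof -
  have F: "polynomial2 F" using assms by (simp add: bihom_def)
  have R: "polynomial2 (rad2 :: complex ^ 'n \<Rightarrow> _)" unfolding rad2_def[abs_def]
    by (intro polynomial2_sum polynomial2_mult polynomial2_fst polynomial2_snd)
  have Rw: "pdw i rad2 = (\<lambda>z w. z $ i)" for i :: 'n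
    unfolding rad2_def[abs_def]
    by (subst pdw_sum) (auto simp: pdw_mult polynomial2_fst polynomial2_snd if_distrib[of "(*) _"] cong: if_cong)
  have Rz: "pdz i rad2 = (\<lambda>z w. w $ i)" for i :: 'n
    unfolding rad2_def[abs_def]
    by (subst pdz_sum) (auto simp: pdz_mult polynomial2_fst polynomial2_snd if_distrib[of "\<lambda>x. x * _"] cong: if_cong)
  have "pdz i (pdw i (\<lambda>z w. rad2 z w * F z w)) z w =
      F z w + z $ i * pdz i F z w + w $ i * pdw i F z w + rad2 z w * pdz i (pdw i F) z w" for i
    by (simp add: pdw_mult R F Rw pdz_add pdz_mult polynomial2_pdw polynomial2_mult polynomial2_fst Rz)
  then have "lap2 (\<lambda>z w. rad2 z w * F z w) z w = of_nat CARD('n) * F z w +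
     (\<Sum>i\<in>UNIV. z $ i * pdz i F z w) + (\<Sum>i\<in>UNIV. w $ i * pdw i F z w) + rad2 z w * lap2 F z w"
    by (simp add: lap2_def sum.distrib sum_distrib_left)
  also have "(\<Sum>i\<in>UNIV. z $ i * pdz i F z w) = of_nat p * F z w"
    by (rule euler_z[OF F]) (use bihomD[OF assms, of _ z 1 w] in simp)
  also have "(\<Sum>i\<in>UNIV. w $ i * pdw i F z w) = of_nat q * F z w"
    by (rule euler_w[OF F]) (use bihomD[OF assms, of 1 z _ w] in simp)
  finally show ?thesis by (simp add: algebra_simps)
qed

text \<open>The ansatz G = (F - \<open>rad2\<close> H) / l solves the equation once
  \<open>lap2\<close> G = H. By \<open>lap2_rad2_mult\<close> this says (l + n + p' + q') H +
  \<open>rad2\<close> \<open>lap2\<close> H = \<open>lap2\<close> F: an equation of the same form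
  with both degrees lowered by one and a larger, hence still positive, constant. In degree 0 the
  Laplacian term vanishes and G = F / l.\<close>

lemma rad2_lap2_solve:
  fixes F :: "'n::finite bifun"
  assumes "bihom p q F" "l > 0"
  shows "\<exists>G. bihom p q G \<and> (\<forall>z w. of_nat l * G z w + rad2 z w * lap2 G z w = F z w)"
  using assms
proof (induction p arbitrary: q l F rule: less_induct)
  case (less p)
  show ?case
  proof (cases "p = 0 \<or> q = 0")
    case True
    let ?G = "\<lambda>z w. (1 / of_nat l) * F z w"
    have "bihom p q ?G" using less.prems by (intro bihom_cmult)
    moreover from this True have "lap2 ?G z w = 0" for z w by (rule lap2_bihom_0)
    ultimately show ?thesis using less.prems by (intro exI[of _ ?G]) simp
  next
    case False
    then obtain p' q' where pq: "p = Suc p'" "q = Suc q'" by (metis not0_implies_Suc)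
    note F = less.prems(1)
    let ?m = "CARD('n) + p' + q'"
    have "bihom p' q' (lap2 F)" using F pq by (simp add: bihom_lap2)
    with less.IH[of p' q' "lap2 F" "l + ?m"] less.prems pq
    obtain H where H: "bihom p' q' H" and
      eq: "\<And>z w. of_nat (l + ?m) * H z w + rad2 z w * lap2 H z w = lap2 F z w" by auto
    define G where "G = (\<lambda>z w. (1 / of_nat l) * (F z w + (-1) * (rad2 z w * H z w)))"
    have RH: "bihom p q (\<lambda>z w. rad2 z w * H z w)" using bihom_rad2_mult[OF H] pq by simp
    have RH': "bihom p q (\<lambda>z w. (-1) * (rad2 z w * H z w))" by (intro bihom_cmult RH)
    have G: "bihom p q G" unfolding G_def by (intro bihom_cmult bihom_add F RH)
    have "lap2 G z w = (1 / of_nat l) * (lap2 F z w - lap2 (\<lambda>z w. rad2 z w * H z w) z w)" for z w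
      unfolding G_def
      by (simp only: lap2_cmult[OF bihom_imp_polynomial2[OF bihom_add[OF F RH']]]
        lap2_add[OF bihom_imp_polynomial2[OF F] bihom_imp_polynomial2[OF RH']]
        lap2_cmult[OF bihom_imp_polynomial2[OF RH]]) simp
    then have "of_nat l * lap2 G z w = of_nat l * H z w" for z w
      using less.prems(2) by (simp add: lap2_rad2_mult[OF H] eq[symmetric]) (simp add: algebra_simps)
    then have "lap2 G z w = H z w" for z w using less.prems(2) by simp
    then have "of_nat l * G z w + rad2 z w * lap2 G z w = F z w" for z w
      using less.prems(2) by (simp add: G_def)
    with G show ?thesis by blast
  qed
qed

text \<open>F - \<open>rad2\<close> G is harmonic exactly when (n + p + q) G + \<open>rad2\<close>
  \<open>lap2\<close> G = \<open>lap2\<close> F, which is \<open>rad2_lap2_solve\<close> with l = n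
  + p + q.\<close>

lemma harmonic_decomposition:
  fixes F :: "'n::finite bifun"
  assumes F: "bihom (Suc p) (Suc q) F"
  obtains H G where "bihom (Suc p) (Suc q) H" "\<And>z w. lap2 H z w = 0" "bihom p q G"
    "\<And>z w. F z w = H z w + rad2 z w * G z w"
proof -
  have "CARD('n) + p + q > 0" by simp
  from rad2_lap2_solve[OF bihom_lap2[OF F] this] obtain G where G: "bihom p q G" and
    eq: "\<And>z w. of_nat (CARD('n) + p + q) * G z w + rad2 z w * lap2 G z w = lap2 F z w" by blast
  note RG = bihom_rad2_mult[OF G]
  note RG' = bihom_cmult[OF RG, of "-1"]
  show ?thesis
  proof
    show "bihom (Suc p) (Suc q) (\<lambda>z w. F z w + (-1) * (rad2 z w * G z w))"
      by (intro bihom_add F RG')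
    show "lap2 (\<lambda>z w. F z w + (-1) * (rad2 z w * G z w)) z w = 0" for z w
      by (simp only: lap2_add[OF bihom_imp_polynomial2[OF F] bihom_imp_polynomial2[OF RG']]
        lap2_cmult[OF bihom_imp_polynomial2[OF RG]] lap2_rad2_mult[OF G] eq[symmetric]) simp
  qed (use G in auto)
qed

text \<open>The remainder G has both degrees lowered by one, so splitting repeatedly ends at p = 0
  or q = 0, where every polynomial is harmonic.\<close>

lemma harmonic_decomposition_induct [consumes 1, case_names harmonic add]:
  fixes F :: "'n::finite bifun"
  assumes "bihom p q F"
    and harm: "\<And>p q H. bihom p q H \<Longrightarrow> (\<And>z w. lap2 H z w = 0) \<Longrightarrow> P H"
    and add: "\<And>H G. polynomial2 H \<Longrightarrow> polynomial2 G \<Longrightarrow> P H \<Longrightarrow> P G \<Longrightarrow>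
      P (\<lambda>z w. H z w + rad2 z w * G z w)"
  shows "P F"
  using assms(1)
proof (induction p arbitrary: q F)
  case 0
  then show ?case by (intro harm[OF 0]) (auto intro: lap2_bihom_0)
next
  case (Suc p)
  show ?case
  proof (cases q)
    case 0
    then show ?thesis using Suc.prems by (intro harm[OF Suc.prems]) (auto intro: lap2_bihom_0)
  next
    case (Suc q')
    from Suc.prems Suc obtain H G where "bihom (Suc p) (Suc q') H" "\<And>z w. lap2 H z w = 0" "bihom p q' G"
      "\<And>z w. F z w = H z w + rad2 z w * G z w" by (auto elim: harmonic_decomposition)
    then have "F = (\<lambda>z w. H z w + rad2 z w * G z w)" "P H" "P G" "polynomial2 H" "polynomial2 G"
      using harm Suc.IH by (auto simp: fun_eq_iff intro: bihom_imp_polynomial2)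
    then show ?thesis using add by simp
  qed
qed

section \<open>Integration by parts on the unit ball\<close>

lemma integrable_compact_support:
  fixes h :: "'a::euclidean_space \<Rightarrow> 'b::{banach, second_countable_topology}"
  assumes "continuous_on UNIV h" "compact S" "\<And>x. x \<notin> S \<Longrightarrow> h x = 0"
  shows "integrable lborel h"
proof -
  have "integrable lborel (\<lambda>x. indicator S x *\<^sub>R h x)"
    using assms by (intro borel_integrable_compact) (auto intro: continuous_on_subset)
  moreover have "(\<lambda>x. indicator S x *\<^sub>R h x) = h"
    using assms(3) by (auto simp: fun_eq_iff indicator_def)
  ultimately show ?thesis by simp
qed

lemma integral_lborel_translate:
  fixes h :: "'a::euclidean_space \<Rightarrow> complex"
  assumes "h \<in> borel_measurable borel"
  shows "(\<integral>x. h (x + c) \<partial>lborel) = (\<integral>x. h x \<partial>lborel)"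
proof -
  have "(\<integral>x. h x \<partial>lborel) = (\<integral>x. h x \<partial>distr lborel borel ((+) c))"
    by (simp add: lborel_distr_plus)
  also have "\<dots> = (\<integral>x. h (c + x) \<partial>lborel)"
    by (rule integral_distr) (use assms in auto)
  finally show ?thesis by (simp add: add.commute)
qed

text \<open>By translation invariance the integrals of the difference quotients of \<open>h\<close> vanish.\<close>

lemma integral_directional_derivative_eq_0:
  fixes h :: "'a::euclidean_space \<Rightarrow> complex"
  assumes deriv: "\<And>x s. ((\<lambda>t. h (x + t *\<^sub>R b)) has_vector_derivative h' (x + s *\<^sub>R b)) (at s)"
    and cont: "continuous_on UNIV h" "continuous_on UNIV h'"
    and supp: "\<And>x. norm x \<ge> 1 \<Longrightarrow> h x = 0" "\<And>x. norm x \<ge> 1 \<Longrightarrow> h' x = 0"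
    and b: "norm b = 1"
  shows "(\<integral>x. h' x \<partial>lborel) = 0"
proof -
  define q where "q k x = (h (x + inverse (real (Suc k)) *\<^sub>R b) - h x) / of_real (inverse (real (Suc k)))" for k x
  have int_h: "integrable lborel h"
    by (rule integrable_compact_support[where S="cball 0 1"]) (use cont supp in auto)
  have [measurable]: "h \<in> borel_measurable borel" "h' \<in> borel_measurable borel"
    using cont by (auto intro: borel_measurable_continuous_onI)
  have "bounded (h' ` cball 0 1)"
    using cont by (intro compact_imp_bounded compact_continuous_image) (auto intro: continuous_on_subset)
  then obtain B where "B > 0" and "\<forall>y\<in>h' ` cball 0 1. norm y \<le> B"
    unfolding bounded_pos by blast
  then have B: "norm (h' x) \<le> B" for x using supp(2)[of x] by (cases "norm x \<le> 1") auto
  \<comment> \<open>The mean value inequality bounds the quotient by B. The step has length at most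
    1, so the quotient vanishes outside radius 2. Together this dominates the quotients uniformly in
    k.\<close>
  have q_bound: "norm (q k x) \<le> B * indicator (cball 0 2) x" for k x
  proof (cases "norm x \<le> 2")
    case True
    let ?d = "inverse (real (Suc k))"
    have bound: "norm (h (x + ?d *\<^sub>R b) - h (x + 0 *\<^sub>R b)) \<le> B * norm (?d - 0)"
    proof (rule differentiable_bound[where S=UNIV])
      fix s :: real
      show "((\<lambda>t. h (x + t *\<^sub>R b)) has_derivative (\<lambda>t. t *\<^sub>R h' (x + s *\<^sub>R b))) (at s within UNIV)"
        using deriv[of x s] by (simp add: has_vector_derivative_def)
      show "onorm (\<lambda>t. t *\<^sub>R h' (x + s *\<^sub>R b)) \<le> B"
        using B[of "x + s *\<^sub>R b"] \<open>B > 0\<close> by (intro onorm_le) (simp add: mult.commute[of B] mult_left_mono)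
    qed auto
    have quot: "norm (u / of_real d) \<le> B" if "norm u \<le> B * norm (d - 0)" "d > 0" for u :: complex and d
      using that by (simp add: norm_divide divide_le_eq)
    have "norm (q k x) \<le> B" unfolding q_def by (rule quot) (use bound in simp_all)
    then show ?thesis using True by simp
  next
    case False
    have "norm (inverse (real (Suc k)) *\<^sub>R b) \<le> 1" using b by (simp add: field_simps)
    then have "norm (x + inverse (real (Suc k)) *\<^sub>R b) \<ge> 1"
      using False norm_diff_ineq[of x "inverse (real (Suc k)) *\<^sub>R b"] by linarith
    with False show ?thesis using supp by (simp add: q_def)
  qed
  have "(\<lambda>k. \<integral>x. q k x \<partial>lborel) \<longlonglongrightarrow> (\<integral>x. h' x \<partial>lborel)"
  proof (rule integral_dominated_convergence[where w="\<lambda>x. B * indicator (cball 0 2) x"])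
    show "integrable lborel (\<lambda>x. B * indicator (cball 0 2) x :: real)"
      by (intro integrable_mult_right integrable_real_indicator emeasure_lborel_cball_finite) auto
    show "AE x in lborel. (\<lambda>k. q k x) \<longlonglongrightarrow> h' x"
    proof (rule AE_I2)
      fix x
      have "((\<lambda>t. (h (x + t *\<^sub>R b) - h x) /\<^sub>R t) \<longlongrightarrow> h' x) (at 0)"
      proof -
        have "((\<lambda>t. norm (h (x + t *\<^sub>R b) - h x - t *\<^sub>R h' x) / norm t) \<longlongrightarrow> 0) (at 0)"
          using deriv[of x 0] by (simp add: has_vector_derivative_def has_derivative_at)
        moreover have "\<forall>\<^sub>F t in at 0. norm (h (x + t *\<^sub>R b) - h x - t *\<^sub>R h' x) / norm t =
            norm ((h (x + t *\<^sub>R b) - h x) /\<^sub>R t - h' x)"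
        proof (simp add: eventually_at_filter, intro always_eventually allI impI)
          fix t :: real assume "t \<noteq> 0"
          then have "(h (x + t *\<^sub>R b) - h x) /\<^sub>R t - h' x = (h (x + t *\<^sub>R b) - h x - t *\<^sub>R h' x) /\<^sub>R t"
            by (simp add: scaleR_diff_right)
          then show "norm (h (x + t *\<^sub>R b) - h x - t *\<^sub>R h' x) / \<bar>t\<bar> =
            norm ((h (x + t *\<^sub>R b) - h x) /\<^sub>R t - h' x)" by (simp add: divide_inverse mult.commute)
        qed
        ultimately have "((\<lambda>t. norm ((h (x + t *\<^sub>R b) - h x) /\<^sub>R t - h' x)) \<longlongrightarrow> 0) (at 0)"
          by (rule Lim_transform_eventually)
        then show ?thesis by (simp only: tendsto_norm_zero_iff LIM_zero_iff)
      qed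
      moreover have "filterlim (\<lambda>k. inverse (real (Suc k))) (at 0) sequentially"
        unfolding filterlim_at by (auto intro: LIMSEQ_inverse_real_of_nat simp del: of_nat_Suc)
      ultimately have "(\<lambda>k. (h (x + inverse (real (Suc k)) *\<^sub>R b) - h x) /\<^sub>R inverse (real (Suc k))) \<longlonglongrightarrow> h' x"
        by (rule filterlim_compose)
      then show "(\<lambda>k. q k x) \<longlonglongrightarrow> h' x"
        by (simp add: q_def scaleR_conv_of_real field_simps)
    qed
  qed (use q_bound in \<open>auto simp: q_def\<close>)
  moreover have "(\<integral>x. q k x \<partial>lborel) = 0" for k
  proof -
    have "integrable lborel (\<lambda>x. h (x + c))" for c
      by (rule integrable_compact_support[where S="cball (-c) 1"])
         (use cont supp in \<open>auto simp: dist_norm norm_minus_commute add.commute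
           intro!: continuous_intros continuous_on_compose2[of UNIV h]\<close>)
    then show ?thesis
      using int_h integral_lborel_translate[of h] by (simp add: q_def)
  qed
  ultimately show ?thesis by (simp add: LIMSEQ_const_iff)
qed

text \<open>Squaring makes the positive part differentiable at 0, and the derivative is again a
  multiple of the positive part. This is why integration by parts leads from
  \<open>ball_integral 2\<close> to \<open>ball_integral 1\<close>.\<close>

lemma has_real_derivative_max_0_power2:
  "((\<lambda>s::real. (max 0 s)\<^sup>2) has_real_derivative 2 * max 0 s) (at s)"
proof (cases s "0 :: real" rule: linorder_cases)
  case less
  show ?thesis
    by (rule has_field_derivative_transform_within_open[of "\<lambda>_. 0" _ _ "{..<0}"]) (use less in auto)
next
  case greater
  show ?thesis
    by (rule has_field_derivative_transform_within_open[of "\<lambda>s. s\<^sup>2" _ _ "{0<..}"])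
       (use greater in \<open>auto intro!: derivative_eq_intros\<close>)
next
  case equal
  have "(\<lambda>h. ((max 0 (0 + h))\<^sup>2 - (max 0 0)\<^sup>2) / h) \<midarrow>0\<rightarrow> (0::real)"
  proof (rule Lim_null_comparison)
    show "\<forall>\<^sub>F h in at 0. norm (((max 0 (0 + h))\<^sup>2 - (max 0 0)\<^sup>2) / h) \<le> \<bar>h :: real\<bar>"
      by (auto simp: eventually_at_filter max_def power2_eq_square)
    show "(\<lambda>h. \<bar>h :: real\<bar>) \<midarrow>0\<rightarrow> 0" by (rule tendsto_rabs_zero) simp
  qed
  then show ?thesis using equal by (simp add: DERIV_def)
qed

definition ball_integral :: "nat \<Rightarrow> ('n::finite bifun) \<Rightarrow> complex" where
  "ball_integral m F = (\<integral>x. F x (vcnj x) * of_real ((max 0 (1 - (norm x)\<^sup>2)) ^ m) \<partial>lborel)"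

lemma continuous_on_vcnj [continuous_intros]:
  "continuous_on S f \<Longrightarrow> continuous_on S (\<lambda>x. vcnj (f x))"
  unfolding vcnj_def by (intro continuous_intros)

lemma continuous_on_polynomial2:
  "polynomial2 F \<Longrightarrow> continuous_on S (\<lambda>x. F x (vcnj x))"
  by (induction F rule: polynomial2_induct) (auto intro!: continuous_intros)

text \<open>For m > 0 the weight vanishes outside the unit ball; for m = 0 it would be 1 everywhere,
  since 0 ^ 0 = 1.\<close>

lemma integrable_ball_weight:
  fixes f :: "complex ^ 'n::finite \<Rightarrow> complex"
  assumes "continuous_on UNIV f" "m > 0"
  shows "integrable lborel (\<lambda>x. f x * of_real ((max 0 (1 - (norm x)\<^sup>2)) ^ m))"
proof (rule integrable_compact_support[where S="cball 0 1"])
  fix x :: "complex ^ 'n" assume "x \<notin> cball 0 1"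
  then have "1 \<le> (norm x)\<^sup>2" by simp
  then show "f x * of_real ((max 0 (1 - (norm x)\<^sup>2)) ^ m) = 0" using assms(2) by (simp add: max_def)
qed (use assms in \<open>auto intro!: continuous_intros\<close>)

lemma ball_integral_add:
  assumes "polynomial2 F" "polynomial2 G" "m > 0"
  shows "ball_integral m (\<lambda>z w. F z w + G z w) = ball_integral m F + ball_integral m G"
  unfolding ball_integral_def distrib_right
  by (intro Bochner_Integration.integral_add integrable_ball_weight continuous_on_polynomial2 assms)

lemma ball_integral_cmult: "ball_integral m (\<lambda>z w. c * F z w) = c * ball_integral m F"
  unfolding ball_integral_def mult.assoc by simp

lemma ball_integral_zero: "ball_integral m (\<lambda>z w. 0) = 0"
  unfolding ball_integral_def by simp

lemma ball_integral_cong: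
  "(\<And>z. F z (vcnj z) = G z (vcnj z)) \<Longrightarrow> ball_integral m F = ball_integral m G"
  unfolding ball_integral_def by simp

lemma ball_integral_sum:
  assumes "finite S" "\<And>s. s \<in> S \<Longrightarrow> polynomial2 (F s)" "m > 0"
  shows "ball_integral m (\<lambda>z w. \<Sum>s\<in>S. F s z w) = (\<Sum>s\<in>S. ball_integral m (F s))"
  using assms by (induction S rule: finite_induct) (auto simp: ball_integral_zero ball_integral_add polynomial2_sum)

text \<open>The factor 4 comes from the weight: the derivative of (1 - |x|^2)^2 along b is -4 (1 -
  |x|^2) (x \<bullet> b) inside the ball.\<close>

lemma ball_integral_ddir:
  fixes F :: "'n::finite bifun"
  assumes F: "polynomial2 F" and b: "norm b = 1"
  shows "ball_integral 2 (ddir b F) =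
    4 * (\<integral>x. (of_real (x \<bullet> b) * F x (vcnj x)) * of_real ((max 0 (1 - (norm x)\<^sup>2)) ^ 1) \<partial>lborel)"
proof -
  define w where "w x = max 0 (1 - (norm x)\<^sup>2)" for x :: "complex ^ 'n"
  let ?F = "\<lambda>x. F x (vcnj x)" and ?F' = "\<lambda>x. ddir b F x (vcnj x)"
  define h' where "h' x = ?F' x * of_real ((w x)\<^sup>2) + ?F x * of_real (- 4 * w x * (x \<bullet> b))" for x
  have wd: "((\<lambda>t. (w (x + t *\<^sub>R b))\<^sup>2) has_real_derivative - 4 * w (x + s *\<^sub>R b) * ((x + s *\<^sub>R b) \<bullet> b)) (at s)" for x s
  proof -
    have eq: "1 - (norm (x + t *\<^sub>R b))\<^sup>2 = 1 - (x \<bullet> x + 2 * t * (x \<bullet> b) + t\<^sup>2)" for t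
      unfolding power2_norm_eq_inner[of "x + t *\<^sub>R b"]
      using b by (simp add: inner_add_left inner_add_right inner_commute power2_eq_square norm_eq_1)
    have "((\<lambda>t. 1 - (norm (x + t *\<^sub>R b))\<^sup>2) has_real_derivative - 2 * ((x + s *\<^sub>R b) \<bullet> b)) (at s)"
      unfolding eq using b by (auto intro!: derivative_eq_intros simp: inner_add_left norm_eq_1)
    from DERIV_chain2[OF has_real_derivative_max_0_power2 this]
    show ?thesis by (simp add: w_def algebra_simps)
  qed
  have cF: "continuous_on UNIV ?F" "continuous_on UNIV ?F'"
    using F by (auto intro: continuous_on_polynomial2)
  have cw: "continuous_on UNIV w" unfolding w_def by (intro continuous_intros)
  have w0: "w x = 0" if "norm x \<ge> 1" for x
    using power_mono[OF that, of 2] by (simp add: w_def max_def)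
  have "(\<integral>x. h' x \<partial>lborel) = 0"
  proof (rule integral_directional_derivative_eq_0[where h="\<lambda>x. ?F x * of_real ((w x)\<^sup>2)" and b=b])
    fix x s
    have "((\<lambda>t. complex_of_real ((w (x + t *\<^sub>R b))\<^sup>2)) has_vector_derivative
        of_real (- 4 * w (x + s *\<^sub>R b) * ((x + s *\<^sub>R b) \<bullet> b))) (at s)"
      using wd[of x s] by (intro has_vector_derivative_of_real)
    from has_vector_derivative_mult[OF polynomial2_vector_derivative[OF F, of x b s] this]
    show "((\<lambda>t. ?F (x + t *\<^sub>R b) * of_real ((w (x + t *\<^sub>R b))\<^sup>2)) has_vector_derivative h' (x + s *\<^sub>R b)) (at s)"
      by (simp add: h'_def add.commute)
  qed (use cF cw w0 b in \<open>auto simp: h'_def intro!: continuous_intros\<close>)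
  moreover have "(\<integral>x. h' x \<partial>lborel) = ball_integral 2 (ddir b F) +
    (\<integral>x. (- 4) * ((of_real (x \<bullet> b) * ?F x) * of_real ((w x) ^ 1)) \<partial>lborel)"
    unfolding ball_integral_def w_def[symmetric]
  proof (subst Bochner_Integration.integral_add[symmetric])
    show "integrable lborel (\<lambda>x. ?F' x * of_real ((w x)\<^sup>2))"
      unfolding w_def by (intro integrable_ball_weight cF) simp
    show "integrable lborel (\<lambda>x. (- 4) * ((of_real (x \<bullet> b) * ?F x) * of_real ((w x) ^ 1)))"
      unfolding w_def by (intro integrable_mult_right integrable_ball_weight continuous_intros cF) simp
    show "(\<integral>x. h' x \<partial>lborel) = (\<integral>x. ?F' x * of_real ((w x)\<^sup>2) + (- 4) * ((of_real (x \<bullet> b) * ?F x) * of_real ((w x) ^ 1)) \<partial>lborel)"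
      by (rule arg_cong[where f="integral\<^sup>L lborel"]) (simp add: h'_def fun_eq_iff algebra_simps)
  qed
  ultimately show ?thesis unfolding w_def by (simp add: add_eq_0_iff2)
qed

lemma inner_axis_ii: "x \<bullet> axis j \<i> = Im (x $ j)"
  by (simp add: inner_axis)

lemma inner_axis_one: "x \<bullet> axis j (1::complex) = Re (x $ j)"
  by (simp add: inner_axis)

text \<open>Integration by parts moves \<open>pdz j\<close> onto the weight (1 - |z|^2)^2, whose
  derivative is -2 (1 - |z|^2) times the conjugate coordinate; hence the factor w $ j, and z $ j for
  \<open>pdw\<close>. The real directions yield only the sum and the difference of the two formulas,
  which are then solved for each.\<close>

lemma
  fixes F :: "'n::finite bifun"
  assumes F: "polynomial2 F"
  shows ball_integral_pdz: "ball_integral 2 (pdz j F) = 2 * ball_integral 1 (\<lambda>z w. w $ j * F z w)"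
    and ball_integral_pdw: "ball_integral 2 (pdw j F) = 2 * ball_integral 1 (\<lambda>z w. z $ j * F z w)"
proof -
  have norm_axis: "norm (axis j 1 :: complex ^ 'n) = 1" "norm (axis j \<i> :: complex ^ 'n) = 1"
    by (intro norm_Basis; simp add: axis_in_Basis_iff Basis_complex_def)+
  have half: "4 * ((1/2) * x) = 2 * x" for x :: complex by simp
  have re: "complex_of_real (Re c) = (1/2) * (c + cnj c)" and im: "complex_of_real (Im c) = (- \<i> / 2) * (c - cnj c)" for c
    by (simp_all add: complex_eq_iff)
  define A where "A = ball_integral 1 (\<lambda>z w. z $ j * F z w)"
  define B where "B = ball_integral 1 (\<lambda>z w. w $ j * F z w)"
  have p: "polynomial2 (pdz j F)" "polynomial2 (pdw j F)" "polynomial2 (\<lambda>z w. (-1) * pdw j F z w)"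
    "polynomial2 (\<lambda>z w. z $ j * F z w)" "polynomial2 (\<lambda>z w. w $ j * F z w)"
    "polynomial2 (\<lambda>z w. (-1) * (w $ j * F z w))"
    using F by (intro polynomial2_pdz polynomial2_pdw polynomial2_mult polynomial2_const
      polynomial2_fst polynomial2_snd; assumption)+
  have "ball_integral 2 (ddir (axis j 1) F) = 4 * ball_integral 1 (\<lambda>z w. (1/2) * (z $ j * F z w + w $ j * F z w))"
    unfolding ball_integral_ddir[OF F norm_axis(1)] ball_integral_def[of 1]
    by (intro arg_cong[where f="(*) 4"] Bochner_Integration.integral_cong refl)
       (simp add: inner_axis_one re algebra_simps)
  moreover have "ddir (axis j 1) F = (\<lambda>z w. pdz j F z w + pdw j F z w)" by (simp add: fun_eq_iff ddir_axis_1)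
  ultimately have 1: "ball_integral 2 (pdz j F) + ball_integral 2 (pdw j F) = 2 * (A + B)"
    unfolding ball_integral_cmult ball_integral_add[OF p(4,5) zero_less_one]
      A_def[symmetric] B_def[symmetric] by (simp only: ball_integral_add[OF p(1,2) zero_less_numeral] half)
  have "ball_integral 2 (ddir (axis j \<i>) F) =
      4 * ball_integral 1 (\<lambda>z w. (- \<i> / 2) * (z $ j * F z w + (-1) * (w $ j * F z w)))"
    unfolding ball_integral_ddir[OF F norm_axis(2)] ball_integral_def[of 1]
    by (intro arg_cong[where f="(*) 4"] Bochner_Integration.integral_cong refl)
       (simp add: inner_axis_ii im algebra_simps)
  moreover have "ball_integral 2 (ddir (axis j \<i>) F) = ball_integral 2 (\<lambda>z w. \<i> * (pdz j F z w + (-1) * pdw j F z w))"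
    by (rule ball_integral_cong) (simp add: ddir_axis_ii)
  ultimately have "\<i> * (ball_integral 2 (pdz j F) - ball_integral 2 (pdw j F)) = - \<i> * (2 * (A - B))"
    unfolding ball_integral_cmult ball_integral_add[OF p(1,3) zero_less_numeral]
      ball_integral_add[OF p(4,6) zero_less_one] by (simp add: A_def B_def)
  then have 2: "ball_integral 2 (pdz j F) - ball_integral 2 (pdw j F) = - (2 * (A - B))"
    by (simp only: mult_minus_left mult_minus_right[symmetric] mult_cancel_left complex_i_not_zero simp_thms)
  show "ball_integral 2 (pdz j F) = 2 * ball_integral 1 (\<lambda>z w. w $ j * F z w)"
    unfolding B_def[symmetric] using 1 2 by algebra
  show "ball_integral 2 (pdw j F) = 2 * ball_integral 1 (\<lambda>z w. z $ j * F z w)"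
    unfolding A_def[symmetric] using 1 2 by algebra
qed

text \<open>Up to a factor, both sides are the ball integral of \<open>\<Sum>\<^sub>i pdz i F * pdw i G\<close>.\<close>

lemma green:
  fixes F G :: "'n::finite bifun"
  assumes F: "polynomial2 F" and G: "polynomial2 G"
    and harm: "\<And>z. lap2 F z (vcnj z) = 0" "\<And>z. lap2 G z (vcnj z) = 0"
    and euler: "\<And>z. (\<Sum>i\<in>UNIV. z $ i * pdz i F z (vcnj z)) = p * F z (vcnj z)"
      "\<And>z. (\<Sum>i\<in>UNIV. vcnj z $ i * pdw i G z (vcnj z)) = s * G z (vcnj z)"
  shows "p * ball_integral 1 (\<lambda>z w. F z w * G z w) = s * ball_integral 1 (\<lambda>z w. F z w * G z w)"
proof -
  have p: "polynomial2 (\<lambda>z w. F z w * pdw i G z w)" "polynomial2 (\<lambda>z w. pdz i F z w * G z w)"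
    "polynomial2 (\<lambda>z w. pdz i F z w * pdw i G z w)" for i
    using F G by auto
  have e1: "(\<Sum>i\<in>UNIV. z $ i * (pdz i F z (vcnj z) * G z (vcnj z))) = p * (F z (vcnj z) * G z (vcnj z))" for z
    using arg_cong[OF euler(1)[of z], of "\<lambda>x. x * G z (vcnj z)"] by (simp add: sum_distrib_right mult.assoc)
  have e2: "(\<Sum>i\<in>UNIV. vcnj z $ i * (F z (vcnj z) * pdw i G z (vcnj z))) = s * (F z (vcnj z) * G z (vcnj z))" for z
    using arg_cong[OF euler(2)[of z], of "\<lambda>x. F z (vcnj z) * x"]
    by (simp add: sum_distrib_left mult.left_commute)
  have "2 * (s * ball_integral 1 (\<lambda>z w. F z w * G z w)) =
      2 * ball_integral 1 (\<lambda>z w. \<Sum>i\<in>UNIV. w $ i * (F z w * pdw i G z w))"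
    unfolding ball_integral_cmult[symmetric]
    by (intro ball_integral_cong) (simp only: e2)
  also have "\<dots> = (\<Sum>i\<in>UNIV. 2 * ball_integral 1 (\<lambda>z w. w $ i * (F z w * pdw i G z w)))"
    by (subst ball_integral_sum) (use p in \<open>auto simp: sum_distrib_left\<close>)
  also have "\<dots> = (\<Sum>i\<in>UNIV. ball_integral 2 (pdz i (\<lambda>z w. F z w * pdw i G z w)))"
    by (simp only: ball_integral_pdz[OF p(1)])
  also have "\<dots> = ball_integral 2 (\<lambda>z w. \<Sum>i\<in>UNIV. pdz i (\<lambda>z w. F z w * pdw i G z w) z w)"
    by (subst ball_integral_sum) (use p in auto)
  also have "\<dots> = ball_integral 2 (\<lambda>z w. \<Sum>i\<in>UNIV. pdz i F z w * pdw i G z w)"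
    by (intro ball_integral_cong)
       (use harm(2) in \<open>simp add: pdz_mult F G polynomial2_pdw sum.distrib sum_distrib_left[symmetric] lap2_def\<close>)
  also have "\<dots> = ball_integral 2 (\<lambda>z w. \<Sum>i\<in>UNIV. pdw i (\<lambda>z w. pdz i F z w * G z w) z w)"
    by (intro ball_integral_cong)
       (use harm(1) in \<open>simp add: pdw_mult F G polynomial2_pdz sum.distrib sum_distrib_right[symmetric] lap2_def pdz_pdw_commute\<close>)
  also have "\<dots> = (\<Sum>i\<in>UNIV. ball_integral 2 (pdw i (\<lambda>z w. pdz i F z w * G z w)))"
    by (subst ball_integral_sum) (use p in auto)
  also have "\<dots> = (\<Sum>i\<in>UNIV. 2 * ball_integral 1 (\<lambda>z w. z $ i * (pdz i F z w * G z w)))"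
    by (simp only: ball_integral_pdw[OF p(2)])
  also have "\<dots> = 2 * ball_integral 1 (\<lambda>z w. \<Sum>i\<in>UNIV. z $ i * (pdz i F z w * G z w))"
    by (subst ball_integral_sum) (use p in \<open>auto simp: sum_distrib_left\<close>)
  also have "\<dots> = 2 * (p * ball_integral 1 (\<lambda>z w. F z w * G z w))"
    unfolding ball_integral_cmult[symmetric]
    by (intro ball_integral_cong) (simp only: e1)
  finally show ?thesis by auto
qed

text \<open>Infinitesimal rotation invariance in the i-th coordinate: the integrals of
  \<open>pdz i\<close> (z_i F) and \<open>pdw i\<close> (w_i F) both equal twice the integral of z_i
  w_i F with weight exponent 1, while the integrands differ by c F.\<close>

lemma ball_integral_torus_weight:
  fixes F :: "'n::finite bifun"
  assumes F: "polynomial2 F"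
    and weight: "\<And>z. z $ i * pdz i F z (vcnj z) - vcnj z $ i * pdw i F z (vcnj z) = c * F z (vcnj z)"
    and c: "c \<noteq> 0"
  shows "ball_integral 2 F = 0"
proof -
  have p: "polynomial2 (\<lambda>z w. z $ i * F z w)" "polynomial2 (\<lambda>z w. w $ i * F z w)"
    using F by (intro polynomial2_mult polynomial2_fst polynomial2_snd; assumption)+
  have p': "polynomial2 (pdw i (\<lambda>z w. w $ i * F z w))" "polynomial2 (\<lambda>z w. c * F z w)"
    using p F by auto
  have "ball_integral 2 (pdz i (\<lambda>z w. z $ i * F z w)) = ball_integral 2 (pdw i (\<lambda>z w. w $ i * F z w))"
    unfolding ball_integral_pdz[OF p(1)] ball_integral_pdw[OF p(2)] by (simp add: mult.left_commute)
  also have "ball_integral 2 (pdz i (\<lambda>z w. z $ i * F z w)) =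
      ball_integral 2 (\<lambda>z w. pdw i (\<lambda>z w. w $ i * F z w) z w + c * F z w)"
    by (rule ball_integral_cong)
       (use weight in \<open>simp add: pdz_mult pdw_mult F polynomial2_fst polynomial2_snd algebra_simps\<close>)
  finally show ?thesis
    using c by (simp add: ball_integral_add[OF p'] ball_integral_cmult)
qed

section \<open>Sphere integrals as ball integrals\<close>

definition unit_cone :: "(complex ^ 'n::finite) set \<Rightarrow> (complex ^ 'n) set" where
  "unit_cone A = {x \<in> cball 0 1 - {0}. x /\<^sub>R norm x \<in> A}"

lemma measurable_normalize:
  "(\<lambda>x :: complex ^ 'n::finite. x /\<^sub>R norm x) \<in> measurable
    (restrict_space lborel (cball 0 1 - {0})) (restrict_space borel (sphere 0 1))"
  by (rule measurable_restrict_space2)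
     (auto simp: space_restrict_space intro!: measurable_restrict_space1)

lemma sets_unit_cone:
  fixes A :: "(complex ^ 'n::finite) set"
  assumes "A \<in> sets (restrict_space borel (sphere 0 1))"
  shows "unit_cone A \<in> sets lborel"
proof -
  have "(\<lambda>x. x /\<^sub>R norm x) -` A \<inter> space (restrict_space lborel (cball 0 1 - {0})) \<in>
      sets (restrict_space lborel (cball 0 1 - {0}))"
    using measurable_normalize assms by (rule measurable_sets)
  moreover have "(\<lambda>x. x /\<^sub>R norm x) -` A \<inter> space (restrict_space lborel (cball 0 1 - {0})) = unit_cone A"
    by (auto simp: unit_cone_def space_restrict_space)
  ultimately show ?thesis by (auto simp: sets_restrict_space)
qed

lemma emeasure_lborel_scaleR_vimage:
  fixes X :: "'a::euclidean_space set"
  assumes "X \<in> sets lborel" "t > 0"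
  shows "emeasure lborel X = ennreal (t ^ DIM('a)) * emeasure lborel {x. t *\<^sub>R x \<in> X}"
proof -
  have "emeasure lborel X = emeasure (density (distr lborel borel (\<lambda>x. 0 + t *\<^sub>R x)) (\<lambda>_. \<bar>t\<bar> ^ DIM('a))) X"
    using assms by (subst lborel_affine[of t 0]) auto
  also have "\<dots> = ennreal (t ^ DIM('a)) * emeasure lborel {x. t *\<^sub>R x \<in> X}"
    using assms by (subst emeasure_density_const) (auto simp: emeasure_distr vimage_def)
  finally show ?thesis .
qed

text \<open>Normalisation ignores positive factors, so the part of the cone within radius t is the
  image of the whole cone under scaling by t.\<close>

lemma emeasure_unit_cone_cball:
  fixes A :: "(complex ^ 'n::finite) set"
  assumes A: "A \<in> sets (restrict_space borel (sphere 0 1))" and t: "0 < t" "t \<le> 1"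
  shows "emeasure lborel (unit_cone A \<inter> cball 0 t) =
    ennreal (t ^ DIM(complex ^ 'n)) * emeasure lborel (unit_cone A)"
proof -
  have "(t *\<^sub>R x) /\<^sub>R norm (t *\<^sub>R x) = x /\<^sub>R norm x" for x :: "complex ^ 'n"
    using t by simp
  then have "{x. t *\<^sub>R x \<in> unit_cone A \<inter> cball 0 t} = unit_cone A"
    unfolding unit_cone_def using t by (auto simp: mult_le_one simp del: scaleR_scaleR)
  then show ?thesis
    using sets_unit_cone[OF A] t by (subst emeasure_lborel_scaleR_vimage[of _ t]) auto
qed

lemma emeasure_unit_cone_finite:
  fixes A :: "(complex ^ 'n::finite) set"
  shows "emeasure lborel (unit_cone A) < \<infinity>"
proof -
  have "emeasure lborel (unit_cone A) \<le> emeasure lborel (cball (0 :: complex ^ 'n) 1)"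
    by (rule emeasure_mono) (auto simp: unit_cone_def)
  also have "\<dots> < \<infinity>" by (rule emeasure_lborel_cball_finite)
  finally show ?thesis .
qed

text \<open>Up to the factor \<open>emeasure lborel (unit_cone A)\<close> the distribution of the norm on \<open>unit_cone A\<close>
  does not depend on \<open>A\<close>.\<close>

lemma nn_integral_unit_cone_radial:
  fixes A B :: "(complex ^ 'n::finite) set"
  assumes A: "A \<in> sets (restrict_space borel (sphere 0 1))"
    and B: "B \<in> sets (restrict_space borel (sphere 0 1))"
    and f: "f \<in> borel_measurable borel"
  shows "emeasure lborel (unit_cone B) * (\<integral>\<^sup>+x. f (norm x) * indicator (unit_cone A) x \<partial>lborel) =
    emeasure lborel (unit_cone A) * (\<integral>\<^sup>+x. f (norm x) * indicator (unit_cone B) x \<partial>lborel)"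
proof -
  define K where "K A = distr (restrict_space lborel (unit_cone A)) borel (norm :: complex ^ 'n \<Rightarrow> real)" for A
  have [measurable]: "(norm :: complex ^ 'n \<Rightarrow> real) \<in> measurable (restrict_space lborel (unit_cone A)) borel" for A
    by (intro measurable_restrict_space1) auto
  have K: "emeasure (K A) {s<..} = emeasure lborel (unit_cone A) *
      (if s \<le> 0 then 1 else if s \<ge> 1 then 0 else 1 - ennreal (s ^ DIM(complex ^ 'n)))"
    if A: "A \<in> sets (restrict_space borel (sphere 0 1))" for A and s
  proof -
    have "emeasure (K A) {s<..} = emeasure (restrict_space lborel (unit_cone A)) {x \<in> unit_cone A. s < norm x}"
      unfolding K_def by (subst emeasure_distr) (auto simp: space_restrict_space vimage_def Collect_conj_eq Int_commute)
    also have "\<dots> = emeasure lborel {x \<in> unit_cone A. s < norm x}"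
      by (rule emeasure_restrict_space) (use sets_unit_cone[OF A] in auto)
    also have "\<dots> = emeasure lborel (unit_cone A) *
      (if s \<le> 0 then 1 else if s \<ge> 1 then 0 else 1 - ennreal (s ^ DIM(complex ^ 'n)))"
    proof -
      consider "s \<le> 0" | "0 < s" "s < 1" | "s \<ge> 1" by linarith
      then show ?thesis
      proof cases
        case 1
        then have "{x \<in> unit_cone A. s < norm x} = unit_cone A"
          by (auto simp: unit_cone_def intro: le_less_trans)
        then show ?thesis using 1 by simp
      next
        case 2
        have fin: "emeasure lborel (unit_cone A \<inter> cball 0 s) \<noteq> \<infinity>"
          unfolding emeasure_unit_cone_cball[OF A 2(1) less_imp_le[OF 2(2)]]
          using emeasure_unit_cone_finite[of A] by (simp add: ennreal_mult_eq_top_iff less_top del: DIM_cart)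
        have "{x \<in> unit_cone A. s < norm x} = unit_cone A - unit_cone A \<inter> cball 0 s" by auto
        then have "emeasure lborel {x \<in> unit_cone A. s < norm x} =
            emeasure lborel (unit_cone A) - emeasure lborel (unit_cone A \<inter> cball 0 s)"
          using sets_unit_cone[OF A] fin by (simp only:) (subst emeasure_Diff, auto)
        also have "\<dots> = emeasure lborel (unit_cone A) * 1 - emeasure lborel (unit_cone A) * ennreal (s ^ DIM(complex ^ 'n))"
          using 2 by (simp add: emeasure_unit_cone_cball[OF A] mult.commute del: DIM_cart)
        also have "\<dots> = emeasure lborel (unit_cone A) * (1 - ennreal (s ^ DIM(complex ^ 'n)))"
          using emeasure_unit_cone_finite[of A] by (subst ennreal_right_diff_distrib) (auto simp: less_top)
        finally show ?thesis using 2 by simp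
      next
        case 3
        then have "{x \<in> unit_cone A. s < norm x} = {}" by (auto simp: unit_cone_def)
        then show ?thesis using 3 by (simp del: Collect_empty_eq empty_Collect_eq)
      qed
    qed
    finally show ?thesis .
  qed
  \<comment> \<open>Both sides agree on all half-lines and are finite there. Cross-multiplying by
    the two cone volumes avoids division by a volume that may be 0.\<close>
  have "scale_measure (emeasure lborel (unit_cone B)) (K A) = scale_measure (emeasure lborel (unit_cone A)) (K B)"
  proof (rule measure_eqI_lessThan)
    fix x :: real
    show "emeasure (scale_measure (emeasure lborel (unit_cone B)) (K A)) {x<..} < \<infinity>"
      using emeasure_unit_cone_finite[of A] emeasure_unit_cone_finite[of B]
        le_less_trans[OF diff_le_self_ennreal[of 1] ennreal_one_less_top]
      by (auto simp: K[OF A] ennreal_mult_less_top less_top)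
    show "emeasure (scale_measure (emeasure lborel (unit_cone B)) (K A)) {x<..} =
        emeasure (scale_measure (emeasure lborel (unit_cone A)) (K B)) {x<..}"
      by (simp add: K[OF A] K[OF B] mult.left_commute)
  qed (auto simp: K_def)
  then have "integral\<^sup>N (scale_measure (emeasure lborel (unit_cone B)) (K A)) f =
      integral\<^sup>N (scale_measure (emeasure lborel (unit_cone A)) (K B)) f" by simp
  moreover have "integral\<^sup>N (K A) f = (\<integral>\<^sup>+x. f (norm x) * indicator (unit_cone A) x \<partial>lborel)"
    if "A \<in> sets (restrict_space borel (sphere 0 1))" for A
    unfolding K_def using f sets_unit_cone[OF that]
    by (subst nn_integral_distr) (auto simp: nn_integral_restrict_space)
  ultimately show ?thesis
    using A B f by (simp add: nn_integral_scale_measure K_def)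
qed

lemma sphere_in_sets: "sphere 0 1 \<in> sets (restrict_space borel (sphere 0 (1::real) :: 'a::real_normed_vector set))"
  using sets.top[of "restrict_space borel (sphere 0 1 :: 'a set)"] by (simp add: space_restrict_space)

lemma emeasure_lborel_open_pos:
  fixes U :: "'a::euclidean_space set"
  assumes "open U" "U \<noteq> {}"
  shows "emeasure lborel U > 0"
proof (rule ccontr)
  assume "\<not> emeasure lborel U > 0"
  then have "U \<in> null_sets lborel" using assms by (auto simp: null_sets_def)
  then have "negligible U" by (simp add: negligible_iff_null_sets null_sets_completionI)
  with open_not_negligible[OF assms] show False ..
qed

lemma emeasure_unit_ball_pos: "emeasure lborel (ball 0 1 - {0 :: complex ^ 'n::finite}) > 0"
proof (rule emeasure_lborel_open_pos)
  have "norm (axis undefined 1 :: complex ^ 'n) = 1"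
    by (rule norm_Basis) (simp add: axis_in_Basis_iff Basis_complex_def)
  then have "(1/2) *\<^sub>R axis undefined 1 \<in> ball 0 1 - {0 :: complex ^ 'n}" by auto
  then show "ball 0 1 - {0 :: complex ^ 'n} \<noteq> {}" by blast
qed auto

lemma emeasure_unit_cone_sphere_pos: "emeasure lborel (unit_cone (sphere 0 1 :: (complex ^ 'n::finite) set)) > 0"
proof -
  have "emeasure lborel (ball 0 1 - {0 :: complex ^ 'n}) \<le> emeasure lborel (unit_cone (sphere 0 1 :: (complex ^ 'n) set))"
    using sets_unit_cone[OF sphere_in_sets] by (intro emeasure_mono) (auto simp: unit_cone_def)
  with emeasure_unit_ball_pos show ?thesis by (rule less_le_trans)
qed

lemma finite_measure_sphere_measure: "finite_measure (sphere_measure :: (complex ^ 'n::finite) measure)"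
proof (rule finite_measureI)
  have "emeasure (sphere_measure :: (complex ^ 'n) measure) (sphere 0 1) =
      ennreal (real DIM(complex ^ 'n)) * emeasure lborel (unit_cone (sphere 0 1 :: (complex ^ 'n) set))"
    unfolding unit_cone_def by (rule emeasure_sphere_measure) (simp add: sphere_in_sets)
  also have "\<dots> < \<infinity>"
    using emeasure_unit_cone_finite[of "sphere 0 1 :: (complex ^ 'n) set"]
    by (simp add: ennreal_mult_less_top del: DIM_cart)
  finally show "emeasure (sphere_measure :: (complex ^ 'n) measure) (space sphere_measure) \<noteq> \<infinity>"
    by simp
qed

interpretation sphere_measure: finite_measure "sphere_measure :: (complex ^ 'n::finite) measure"
  by (rule finite_measure_sphere_measure)

text \<open>By \<open>nn_integral_unit_cone_radial\<close> the weighted volume of a cone is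
  proportional to its plain volume, hence to the surface measure of its base. Positivity of w inside
  the ball makes the factor positive, and w \<le> 1 makes it finite.\<close>

lemma sphere_measure_eq_density:
  fixes w :: "real \<Rightarrow> real"
  assumes w: "w \<in> borel_measurable borel" "\<And>s. 0 < s \<Longrightarrow> s < 1 \<Longrightarrow> w s > 0" "\<And>s. 0 \<le> w s" "\<And>s. w s \<le> 1"
  obtains C :: real where "C > 0"
    "distr (density (restrict_space lborel (cball 0 1 - {0})) (\<lambda>x. w (norm x)))
      (restrict_space borel (sphere 0 1)) (\<lambda>x. x /\<^sub>R norm x) =
     density (sphere_measure :: (complex ^ 'n::finite) measure) (\<lambda>_. ennreal C)"
proof -
  let ?S = "sphere 0 1 :: (complex ^ 'n) set" and ?C = "cball 0 1 - {0} :: (complex ^ 'n) set"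
  have S: "?S \<in> sets (restrict_space borel ?S)" by (rule sphere_in_sets)
  define V where "V A = emeasure lborel (unit_cone A)" for A :: "(complex ^ 'n) set"
  define W where "W A = (\<integral>\<^sup>+x. ennreal (w (norm x)) * indicator (unit_cone A) x \<partial>lborel)" for A :: "(complex ^ 'n) set"
  have [measurable]: "w \<in> borel_measurable borel" by fact
  have [measurable]: "unit_cone ?S \<in> sets borel" using sets_unit_cone[OF S] by simp
  have VW: "V ?S * W A = V A * W ?S" if "A \<in> sets (restrict_space borel ?S)" for A
    unfolding V_def W_def by (rule nn_integral_unit_cone_radial[OF that S]) auto
  have V_fin: "V ?S < \<infinity>" unfolding V_def by (rule emeasure_unit_cone_finite)
  have V_pos: "V ?S > 0" unfolding V_def by (rule emeasure_unit_cone_sphere_pos)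
  have "W ?S \<le> (\<integral>\<^sup>+x. indicator (unit_cone ?S) x \<partial>lborel)"
    unfolding W_def by (rule nn_integral_mono) (use w in \<open>auto simp: indicator_def\<close>)
  also have "\<dots> = V ?S" by (simp add: V_def)
  finally have W_fin: "W ?S < \<infinity>" using V_fin by (rule le_less_trans)
  have W_pos: "W ?S > 0"
  proof (rule ccontr)
    assume "\<not> W ?S > 0"
    then have "W ?S = 0" by simp
    then have "AE x in lborel. ennreal (w (norm x)) * indicator (unit_cone ?S) x = 0"
      unfolding W_def by (subst (asm) nn_integral_0_iff_AE) auto
    then have "AE x in lborel. x \<notin> ball 0 1 - {0 :: complex ^ 'n}"
    proof eventually_elim
      case (elim x)
      show ?case
      proof
        assume x: "x \<in> ball 0 1 - {0}"
        then have "x \<in> unit_cone ?S" "w (norm x) > 0"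
          using w(2)[of "norm x"] by (auto simp: unit_cone_def)
        with elim show False by (simp add: ennreal_eq_0_iff)
      qed
    qed
    then have "emeasure lborel (ball 0 1 - {0 :: complex ^ 'n}) = 0"
      by (subst AE_iff_measurable[symmetric, where P="\<lambda>x. x \<notin> ball 0 1 - {0 :: complex ^ 'n}" and M=lborel]) auto
    with emeasure_unit_ball_pos[where 'n='n] show False by simp
  qed
  let ?d = "ennreal (real DIM(complex ^ 'n))"
  \<comment> \<open>Surface measure is the dimension times the cone volume, so the quotient of
    weighted volume by surface measure, read off on the whole sphere, is the required
    factor.\<close>
  define c where "c = W ?S / (?d * V ?S)"
  have d: "?d \<noteq> 0" "?d \<noteq> \<infinity>" by (simp_all add: ennreal_eq_0_iff)
  have c: "c \<noteq> 0" "c \<noteq> \<infinity>"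
    using W_fin V_fin W_pos V_pos d by (auto simp: c_def ennreal_divide_eq_0_iff ennreal_divide_eq_top_iff ennreal_mult_eq_top_iff)
  then obtain C where C: "c = ennreal C" "C \<ge> 0" by (cases c) auto
  with c have "C > 0" by (cases "C = 0") auto
  let ?M = "density (restrict_space lborel ?C) (\<lambda>x. w (norm x))"
  have "distr ?M (restrict_space borel ?S) (\<lambda>x. x /\<^sub>R norm x) = density sphere_measure (\<lambda>_. ennreal C)"
  proof (rule measure_eqI)
    fix A assume "A \<in> sets (distr ?M (restrict_space borel ?S) (\<lambda>x. x /\<^sub>R norm x))"
    then have A: "A \<in> sets (restrict_space borel ?S)" by simp
    have cA: "unit_cone A \<in> sets (restrict_space lborel ?C)"
      using sets_unit_cone[OF A] by (auto simp: sets_restrict_space unit_cone_def intro!: image_eqI[of _ _ "unit_cone A"])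
    have wm: "(\<lambda>x. ennreal (w (norm x))) \<in> borel_measurable (restrict_space lborel ?C)"
      by (intro measurable_restrict_space1) measurable
    have "emeasure (distr ?M (restrict_space borel ?S) (\<lambda>x. x /\<^sub>R norm x)) A = emeasure ?M (unit_cone A)"
      using A measurable_normalize
      by (subst emeasure_distr) (auto simp: unit_cone_def space_restrict_space intro!: arg_cong[where f="emeasure _"])
    also have "\<dots> = (\<integral>\<^sup>+x. ennreal (w (norm x)) * indicator (unit_cone A) x \<partial>restrict_space lborel ?C)"
      using cA wm by (rule emeasure_density[rotated])
    also have "\<dots> = W A"
      unfolding W_def
      by (subst nn_integral_restrict_space) (auto intro!: nn_integral_cong simp: indicator_def unit_cone_def)
    also have "W A = ennreal C * emeasure sphere_measure A"
    proof -
      have "W A * V ?S = V A * W ?S" using VW[OF A] by (simp add: mult.commute)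
      define D where "D = ?d * V ?S"
      have D: "D \<noteq> 0" "D < top"
        using d V_pos V_fin unfolding D_def
        by (auto simp: ennreal_mult_less_top less_top ennreal_mult_eq_top_iff simp del: DIM_cart)
      have "D * W A = ?d * (V A * W ?S)"
        unfolding D_def \<open>W A * V ?S = V A * W ?S\<close>[symmetric] by (simp only: mult_ac)
      also have "W ?S = c * D"
        unfolding c_def D_def[symmetric] ennreal_divide_times using D by (simp add: ennreal_divide_self)
      also have "?d * (V A * (c * D)) = D * (c * (?d * V A))" by (simp only: mult_ac)
      finally have "W A = c * (?d * V A)"
        using D by (simp only: ennreal_mult_cancel_left) auto
      moreover have "emeasure sphere_measure A = ?d * V A"
        unfolding V_def unit_cone_def using A by (intro emeasure_sphere_measure) simp
      ultimately show ?thesis by (simp only: C(1))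
    qed
    finally show "emeasure (distr ?M (restrict_space borel ?S) (\<lambda>x. x /\<^sub>R norm x)) A =
        emeasure (density sphere_measure (\<lambda>_. ennreal C)) A"
      using A by (simp add: emeasure_density_const)
  qed simp
  with \<open>C > 0\<close> show ?thesis by (rule that)
qed

lemma ball_integral_eq_sphere_integral:
  assumes "m > 0"
  obtains C :: real where "C > 0"
    "\<And>F :: 'n::finite bifun. polynomial2 F \<Longrightarrow>
      (\<And>t x. t > 0 \<Longrightarrow> F (t *\<^sub>R x) (vcnj (t *\<^sub>R x)) = of_real (t ^ d) * F x (vcnj x)) \<Longrightarrow>
      ball_integral m F = of_real C * (\<integral>x. F x (vcnj x) \<partial>sphere_measure)"
proof -
  let ?S = "sphere 0 1 :: (complex ^ 'n) set" and ?C = "cball 0 1 - {0} :: (complex ^ 'n) set"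
  \<comment> \<open>The factor s^d accounts for the growth of a function homogeneous of degree d
    along rays. Thus the constant depends on m and d but not on the function.\<close>
  define w where "w s = (if 0 \<le> s \<and> s \<le> 1 then s ^ d * (1 - s\<^sup>2) ^ m else 0)" for s :: real
  have w: "w \<in> borel_measurable borel" unfolding w_def by measurable
  have w_pos: "w s > 0" if "0 < s" "s < 1" for s
    using that by (simp add: w_def power_less_one_iff)
  have w_nn: "w s \<ge> 0" for s by (simp add: w_def power_le_one_iff)
  have w_le: "w s \<le> 1" for s
    by (auto simp: w_def power_le_one_iff intro!: mult_le_one power_le_one)
  obtain C where C: "C > 0" and eq: "distr (density (restrict_space lborel ?C) (\<lambda>x. w (norm x)))
      (restrict_space borel ?S) (\<lambda>x. x /\<^sub>R norm x) = density sphere_measure (\<lambda>_. ennreal C)"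
    using sphere_measure_eq_density[OF w w_pos w_nn w_le, where 'n='n] by blast
  show ?thesis
  proof (rule that[OF C])
    fix F :: "'n bifun"
    assume F: "polynomial2 F" and hom: "\<And>t x. t > 0 \<Longrightarrow> F (t *\<^sub>R x) (vcnj (t *\<^sub>R x)) = of_real (t ^ d) * F x (vcnj x)"
    let ?f = "\<lambda>x. F x (vcnj x)"
    have f: "?f \<in> borel_measurable (restrict_space borel ?S)"
      by (intro measurable_restrict_space1 borel_measurable_continuous_onI continuous_on_polynomial2 F)
    have wm: "(\<lambda>x :: complex ^ 'n. w (norm x)) \<in> borel_measurable (restrict_space lborel ?C)"
      by (intro measurable_restrict_space1) (use w in measurable)
    have fm: "(\<lambda>x. ?f (x /\<^sub>R norm x)) \<in> borel_measurable (restrict_space lborel ?C)"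
      using measurable_compose[OF measurable_normalize f] by simp
    have "of_real C * (\<integral>x. ?f x \<partial>sphere_measure) = (\<integral>x. ?f x \<partial>density sphere_measure (\<lambda>_. ennreal C))"
      using f C by (subst integral_density) (auto simp: scaleR_conv_of_real)
    also have "\<dots> = (\<integral>x. ?f (x /\<^sub>R norm x) \<partial>density (restrict_space lborel ?C) (\<lambda>x. w (norm x)))"
      unfolding eq[symmetric] using measurable_normalize f by (subst integral_distr) auto
    also have "\<dots> = (\<integral>x. w (norm x) *\<^sub>R ?f (x /\<^sub>R norm x) \<partial>restrict_space lborel ?C)"
      by (rule integral_density[OF fm wm]) (simp add: w_nn)
    also have "\<dots> = (\<integral>x. indicator ?C x *\<^sub>R (w (norm x) *\<^sub>R ?f (x /\<^sub>R norm x)) \<partial>lborel)"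
      by (rule integral_restrict_space) auto
    also have "\<dots> = (\<integral>x. indicator (- {0}) x *\<^sub>R (?f x * of_real ((max 0 (1 - (norm x)\<^sup>2)) ^ m)) \<partial>lborel)"
    proof (rule Bochner_Integration.integral_cong[OF refl])
      fix x :: "complex ^ 'n"
      have "?f x = of_real (norm x ^ d) * ?f (x /\<^sub>R norm x)" if "x \<noteq> 0"
        using hom[of "norm x" "x /\<^sub>R norm x"] that by simp
      moreover have "(max 0 (1 - (norm x)\<^sup>2)) ^ m = (0::real)" if "norm x > 1"
      proof -
        have "1 - (norm x)\<^sup>2 \<le> 0" using one_le_power[of "norm x" 2] that by linarith
        then show ?thesis using assms by (simp only: max_absorb1 zero_power)
      qed
      moreover have "max 0 (1 - (norm x)\<^sup>2) = 1 - (norm x)\<^sup>2" if "norm x \<le> 1"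
        using power_mono[of "norm x" 1 2] that by (simp add: max_def)
      ultimately show "indicator ?C x *\<^sub>R (w (norm x) *\<^sub>R ?f (x /\<^sub>R norm x)) =
          indicator (- {0}) x *\<^sub>R (?f x * of_real ((max 0 (1 - (norm x)\<^sup>2)) ^ m))"
        by (cases "x = 0"; cases "norm x \<le> 1")
           (auto simp: w_def scaleR_conv_of_real mult_ac simp del: of_real_power)
    qed
    also have "\<dots> = ball_integral m F"
    proof -
      have "(\<lambda>x. ?f x * of_real ((max 0 (1 - (norm x)\<^sup>2)) ^ m)) \<in> borel_measurable borel"
        by (intro borel_measurable_continuous_onI continuous_intros continuous_on_polynomial2 F)
      then show ?thesis
        unfolding ball_integral_def using AE_lborel_singleton[of 0]
        by (intro integral_cong_AE) (auto elim!: eventually_mono)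
    qed
    finally show "ball_integral m F = of_real C * (\<integral>x. ?f x \<partial>sphere_measure)" ..
  qed
qed

section \<open>Completeness, and totality of the polynomials\<close>

lemma L2_eq_refl_iff: "L2_eq u u \<longleftrightarrow> square_integrable u"
  by (auto simp: L2_eq_def)

lemma sphere_L2_cases:
  obtains u where "square_integrable u" "f = abs_sphere_L2 u"
proof -
  have "\<exists>u. square_integrable u \<and> f = abs_sphere_L2 u"
    by (induction f rule: sphere_L2.abs_induct) (auto simp: L2_eq_def)
  then show ?thesis using that by blast
qed

lemma cinner_abs:
  assumes "square_integrable u" "square_integrable v"
  shows "cinner (abs_sphere_L2 u) (abs_sphere_L2 v) = (\<integral>x. u x * cnj (v x) \<partial>sphere_measure)"
  using assms by (simp add: cinner.abs_eq L2_eq_refl_iff)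

lemma norm_abs_sphere_L2:
  assumes "square_integrable u"
  shows "(norm (abs_sphere_L2 u))\<^sup>2 = (\<integral>x. (norm (u x))\<^sup>2 \<partial>sphere_measure)"
proof -
  have "(norm (abs_sphere_L2 u))\<^sup>2 = Re (\<integral>x. u x * cnj (u x) \<partial>sphere_measure)"
    using assms by (simp add: power2_norm_eq_inner inner_eq_Re_cinner cinner_abs)
  then show ?thesis
    by (simp only: complex_norm_square[symmetric] integral_complex_of_real Re_complex_of_real)
qed

lemma abs_sphere_L2_add:
  assumes "square_integrable u" "square_integrable v"
  shows "abs_sphere_L2 (\<lambda>x. u x + v x) = abs_sphere_L2 u + abs_sphere_L2 v"
  using assms by (simp add: plus_sphere_L2.abs_eq L2_eq_refl_iff)

lemma abs_sphere_L2_cmult: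
  assumes "square_integrable u"
  shows "abs_sphere_L2 (\<lambda>x. c * u x) = scaleC c (abs_sphere_L2 u)"
  using assms by (simp add: scaleC.abs_eq L2_eq_refl_iff)

lemma square_integrable_diff:
  assumes "square_integrable u" "square_integrable v"
  shows "square_integrable (\<lambda>x. u x - v x)"
  using square_integrable_add[OF assms(1) square_integrable_cmult[OF assms(2), of "-1"]] by simp

lemma abs_sphere_L2_diff:
  assumes "square_integrable u" "square_integrable v"
  shows "abs_sphere_L2 (\<lambda>x. u x - v x) = abs_sphere_L2 u - abs_sphere_L2 v"
  using assms square_integrable_cmult[OF assms(2), of "-1"]
  by (simp add: minus_sphere_L2_def plus_sphere_L2.abs_eq uminus_sphere_L2.abs_eq L2_eq_refl_iff)

lemma abs_sphere_L2_eq_0_iff: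
  assumes "square_integrable u"
  shows "abs_sphere_L2 u = 0 \<longleftrightarrow> (AE x in sphere_measure. u x = 0)"
proof -
  have "abs_sphere_L2 u = 0 \<longleftrightarrow> (norm (abs_sphere_L2 u))\<^sup>2 = 0" by simp
  also have "\<dots> \<longleftrightarrow> (AE x in sphere_measure. u x = 0)"
    unfolding norm_abs_sphere_L2[OF assms] using assms
    by (subst integral_nonneg_eq_0_iff_AE) (auto simp: square_integrable_def)
  finally show ?thesis .
qed

text \<open>The Riesz-Fischer argument: a fast subsequence has summable L1 increments, so it
  converges almost everywhere; Fatou's lemma then identifies the limit in L2.\<close>

lemma Cauchy_sphere_L2_convergent:
  fixes X :: "nat \<Rightarrow> 'n::finite sphere_L2"
  assumes X: "Cauchy X"
  shows "convergent X"
proof -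
  let ?M = "sphere_measure :: (complex ^ 'n) measure"
  have "\<exists>N. \<forall>m\<ge>N. \<forall>n\<ge>N. dist (X m) (X n) < (1/2) ^ k" for k
    using X by (simp add: Cauchy_def)
  then obtain N where N: "\<And>k m n. N k \<le> m \<Longrightarrow> N k \<le> n \<Longrightarrow> dist (X m) (X n) < (1/2) ^ k"
    by metis
  \<comment> \<open>Summing the thresholds gives an index beyond N i for every i \<le> k.\<close>
  define s where "s k = (\<Sum>i\<le>k. N i)" for k
  have s: "N k \<le> s j" if "k \<le> j" for k j
    unfolding s_def using that by (intro member_le_sum) auto
  have "\<exists>u. \<forall>k. square_integrable (u k) \<and> X (s k) = abs_sphere_L2 (u k)"
    by (intro choice allI) (metis sphere_L2_cases)
  then obtain u where u: "\<And>k. square_integrable (u k)" and Xu: "\<And>k. X (s k) = abs_sphere_L2 (u k)"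
    by blast
  have [measurable]: "u k \<in> borel_measurable ?M" for k
    using u by (auto simp: square_integrable_def)
  have int_diff: "integrable ?M (\<lambda>x. (norm (u j x - u k x))\<^sup>2)" for j k
    using square_integrable_diff[OF u u] by (simp add: square_integrable_def)
  have quarter: "((1/2 :: real) ^ k)\<^sup>2 = (1/4) ^ k" for k
    by (simp add: power2_eq_square flip: power_mult_distrib)
  have diff: "(\<integral>x. (norm (u j x - u k x))\<^sup>2 \<partial>?M) \<le> (1/4) ^ k" if "k \<le> j" for j k
  proof -
    have "(\<integral>x. (norm (u j x - u k x))\<^sup>2 \<partial>?M) = (dist (X (s j)) (X (s k)))\<^sup>2"
      by (simp add: norm_abs_sphere_L2[symmetric] square_integrable_diff u abs_sphere_L2_diff dist_norm Xu)
    also have "\<dots> \<le> ((1/2) ^ k)\<^sup>2"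
      using N[OF s s, of k j k] that by (intro power_mono) auto
    finally show ?thesis by (simp only: quarter)
  qed
  have nn_diff: "(\<integral>\<^sup>+x. ennreal ((norm (u j x - u k x))\<^sup>2) \<partial>?M) \<le> ennreal ((1/4) ^ k)" if "k \<le> j" for j k
    by (subst nn_integral_eq_integral[OF int_diff]) (auto intro: ennreal_leI diff that)
  \<comment> \<open>Integrating the bound \<open>amgm\<close> gives (2^k (1/4)^k + mass (1/2)^k) / 2
    = c (1/2)^k, where mass is the total surface measure.\<close>
  define c where "c = (1 + measure ?M (space ?M)) / 2"
  have L1: "(\<integral>\<^sup>+x. ennreal (norm (u (Suc k) x - u k x)) \<partial>?M) \<le> ennreal (c * (1/2) ^ k)" for k
  proof -
    \<comment> \<open>A weighted inequality of arithmetic and geometric means, with weight 2^k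
      matched to the decay (1/4)^k of the squared increments. It passes from L2 to L1 on the finite
      measure space.\<close>
    have amgm: "a \<le> (2 ^ k * a\<^sup>2 + (1/2) ^ k) / 2" for a :: real
    proof -
      have "0 \<le> (1/2) ^ k * (2 ^ k * a - 1)\<^sup>2" by simp
      also have "\<dots> = 2 ^ k * a\<^sup>2 - 2 * a + (1/2) ^ k"
        by (simp add: power2_eq_square algebra_simps power_one_over)
      finally show ?thesis by simp
    qed
    let ?g = "\<lambda>x. (2 ^ k * (norm (u (Suc k) x - u k x))\<^sup>2 + (1/2) ^ k) / 2"
    have int: "integrable ?M ?g"
      by (intro integrable_divide Bochner_Integration.integrable_add integrable_mult_right int_diff) auto
    have "(\<integral>\<^sup>+x. ennreal (norm (u (Suc k) x - u k x)) \<partial>?M) \<le> (\<integral>\<^sup>+x. ennreal (?g x) \<partial>?M)"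
      by (intro nn_integral_mono ennreal_leI amgm)
    also have "\<dots> = ennreal (\<integral>x. ?g x \<partial>?M)"
      by (rule nn_integral_eq_integral[OF int]) auto
    also have "(\<integral>x. ?g x \<partial>?M) = (2 ^ k * (\<integral>x. (norm (u (Suc k) x - u k x))\<^sup>2 \<partial>?M) + measure ?M (space ?M) * (1/2) ^ k) / 2"
      using int_diff[of "Suc k" k]
      by (simp add: integral_divide_zero)
    also have "\<dots> \<le> (2 ^ k * (1/4) ^ k + measure ?M (space ?M) * (1/2) ^ k) / 2"
      using diff[of k "Suc k"] by (intro divide_right_mono add_right_mono mult_left_mono) auto
    also have "\<dots> = c * (1/2) ^ k"
      by (simp add: c_def power_mult_distrib[symmetric] field_simps del: space_sphere_measure)
    finally show ?thesis by (simp add: ennreal_leI)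
  qed
  have c0: "c \<ge> 0" by (simp add: c_def)
  have "(\<integral>\<^sup>+x. (\<Sum>k. ennreal (norm (u (Suc k) x - u k x))) \<partial>?M) = (\<Sum>k. \<integral>\<^sup>+x. ennreal (norm (u (Suc k) x - u k x)) \<partial>?M)"
    by (rule nn_integral_suminf) measurable
  also have "\<dots> \<le> (\<Sum>k. ennreal (c * (1/2) ^ k))"
    by (intro suminf_le L1) auto
  also have "\<dots> = ennreal (\<Sum>k. c * (1/2) ^ k)"
    using c0 by (intro suminf_ennreal2) (auto intro!: summable_mult summable_geometric)
  also have "\<dots> < \<infinity>" by simp
  finally have "AE x in ?M. (\<Sum>k. ennreal (norm (u (Suc k) x - u k x))) \<noteq> \<infinity>"
    by (intro nn_integral_PInf_AE) auto
  then have conv: "AE x in ?M. convergent (\<lambda>k. u k x)"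
  proof eventually_elim
    case (elim x)
    then have "summable (\<lambda>k. norm (u (Suc k) x - u k x))"
      by (intro summable_suminf_not_top) auto
    then have "summable (\<lambda>k. u (Suc k) x - u k x)" by (rule summable_norm_cancel)
    then have "convergent (\<lambda>n. \<Sum>k<n. u (Suc k) x - u k x)" by (simp add: summable_iff_convergent)
    then have "convergent (\<lambda>n. u n x - u 0 x)" by (simp add: sum_lessThan_telescope[of "\<lambda>k. u k x"])
    then have "convergent (\<lambda>n. (u n x - u 0 x) + u 0 x)" by (intro convergent_add convergent_const)
    then show ?case by simp
  qed
  define v where "v x = lim (\<lambda>k. u k x)" for x
  have [measurable]: "v \<in> borel_measurable ?M" unfolding v_def by measurable
  \<comment> \<open>Fatou's lemma in j, with k fixed, transfers the uniform bound for u j - u k to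
    the almost everywhere limit v - u k.\<close>
  have vk: "(\<integral>\<^sup>+x. ennreal ((norm (v x - u k x))\<^sup>2) \<partial>?M) \<le> ennreal ((1/4) ^ k)" for k
  proof -
    have "(\<integral>\<^sup>+x. ennreal ((norm (v x - u k x))\<^sup>2) \<partial>?M) =
        (\<integral>\<^sup>+x. liminf (\<lambda>j. ennreal ((norm (u j x - u k x))\<^sup>2)) \<partial>?M)"
    proof (rule nn_integral_cong_AE, use conv in eventually_elim)
      case (elim x)
      then have "(\<lambda>j. u j x) \<longlonglongrightarrow> v x" by (simp add: v_def convergent_LIMSEQ_iff)
      then have "(\<lambda>j. ennreal ((norm (u j x - u k x))\<^sup>2)) \<longlonglongrightarrow> ennreal ((norm (v x - u k x))\<^sup>2)"
        by (intro tendsto_intros)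
      then show ?case by (rule lim_imp_Liminf[OF trivial_limit_sequentially, symmetric])
    qed
    also have "\<dots> \<le> liminf (\<lambda>j. \<integral>\<^sup>+x. ennreal ((norm (u j x - u k x))\<^sup>2) \<partial>?M)"
      by (rule nn_integral_liminf) measurable
    also have "\<dots> \<le> liminf (\<lambda>j. ennreal ((1/4) ^ k))"
      by (intro Liminf_mono) (auto simp: eventually_sequentially intro!: exI[of _ k] nn_diff)
    also have "\<dots> = ennreal ((1/4) ^ k)" by (simp add: Liminf_const)
    finally show ?thesis .
  qed
  have vuk: "square_integrable (\<lambda>x. v x - u k x)" for k
    unfolding square_integrable_def
  proof
    show "integrable ?M (\<lambda>x. (norm (v x - u k x))\<^sup>2)"
      using le_less_trans[OF vk[of k] ennreal_less_top] by (intro integrableI_nonneg) auto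
  qed measurable
  from square_integrable_add[OF vuk[of 0] u[of 0]] have v: "square_integrable v" by simp
  have lim: "dist (X (s k)) (abs_sphere_L2 v) \<le> (1/2) ^ k" for k
  proof -
    have "ennreal ((norm (abs_sphere_L2 v - X (s k)))\<^sup>2) = ennreal (\<integral>x. (norm (v x - u k x))\<^sup>2 \<partial>?M)"
      by (simp add: Xu abs_sphere_L2_diff[symmetric] v u norm_abs_sphere_L2 vuk)
    also have "\<dots> \<le> ennreal ((1/4) ^ k)"
      using vk[of k] vuk[of k] by (subst (asm) nn_integral_eq_integral) (auto simp: square_integrable_def)
    finally have "(norm (abs_sphere_L2 v - X (s k)))\<^sup>2 \<le> ((1/2) ^ k)\<^sup>2"
      by (simp add: quarter)
    then have "norm (abs_sphere_L2 v - X (s k)) \<le> (1/2) ^ k"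
      by (rule power2_le_imp_le) simp
    then show ?thesis by (simp add: dist_norm norm_minus_commute)
  qed
  have "X \<longlonglongrightarrow> abs_sphere_L2 v"
  proof (rule metric_LIMSEQ_I)
    fix e :: real assume "e > 0"
    then obtain k where k: "(1/2) ^ k < e / 2"
      using real_arch_pow_inv[of "e/2" "1/2"] by auto
    have "dist (X n) (abs_sphere_L2 v) < e" if "n \<ge> N k" for n
    proof -
      have "dist (X n) (abs_sphere_L2 v) \<le> dist (X n) (X (s k)) + dist (X (s k)) (abs_sphere_L2 v)"
        by (rule dist_triangle)
      also have "\<dots> < (1/2) ^ k + (1/2) ^ k"
        using N[OF that s[of k k]] lim[of k] by simp
      finally show ?thesis using k by simp
    qed
    then show "\<exists>n0. \<forall>n\<ge>n0. dist (X n) (abs_sphere_L2 v) < e" by blast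
  qed
  then show ?thesis by (auto simp: convergent_def)
qed

instance sphere_L2 :: (finite) banach
  by standard (rule Cauchy_sphere_L2_convergent)

section \<open>Functions orthogonal to all polynomials vanish\<close>

lemma closed_integral_eq_0:
  fixes f :: "complex ^ 'n::finite \<Rightarrow> real"
  assumes f: "integrable sphere_measure f"
    and poly: "\<And>p. real_polynomial_function p \<Longrightarrow> (\<integral>x. p x * f x \<partial>sphere_measure) = 0"
    and C: "closed C"
  shows "(\<integral>x. indicator C x * f x \<partial>sphere_measure) = 0"
proof (cases "C = {}")
  case False
  let ?M = "sphere_measure :: (complex ^ 'n) measure"
  have [measurable]: "f \<in> borel_measurable ?M" using f by auto
  have cm: "g \<in> borel_measurable ?M" if "continuous_on UNIV g" for g :: "complex ^ 'n \<Rightarrow> real"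
    using measurable_restrict_space1[OF borel_measurable_continuous_onI[OF that]] by simp
  \<comment> \<open>On the compact sphere g is a uniform limit of polynomials, and integrability of
    f turns the uniform error into a small integral.\<close>
  have cont: "(\<integral>x. g x * f x \<partial>?M) = 0" if g: "continuous_on UNIV g" for g :: "complex ^ 'n \<Rightarrow> real"
  proof -
    have [measurable]: "g \<in> borel_measurable ?M" by (rule cm[OF g])
    have "bounded (g ` sphere 0 1)"
      by (intro compact_imp_bounded compact_continuous_image continuous_on_subset[OF g]) auto
    then obtain B where "\<forall>y\<in>g ` sphere 0 1. norm y \<le> B" unfolding bounded_iff by blast
    then have B: "\<bar>g x\<bar> \<le> B" if "x \<in> sphere 0 1" for x using that by auto
    have int_bd: "integrable ?M (\<lambda>x. h x * f x)" if [measurable]: "h \<in> borel_measurable ?M" and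
      "\<And>x. x \<in> sphere 0 1 \<Longrightarrow> \<bar>h x\<bar> \<le> B" for h B
      by (rule Bochner_Integration.integrable_bound[where f="\<lambda>x. B * f x"])
         (use f that in \<open>auto intro!: AE_I2 mult_right_mono simp: abs_mult intro: order_trans[OF _ abs_ge_self]\<close>)
    define I where "I = (\<integral>x. \<bar>f x\<bar> \<partial>?M)"
    have I: "I \<ge> 0" unfolding I_def by simp
    have "\<bar>\<integral>x. g x * f x \<partial>?M\<bar> \<le> 0"
    proof (rule field_le_epsilon)
      fix e' :: real assume e': "e' > 0"
      \<comment> \<open>Adding 1 keeps the denominator positive when f vanishes almost everywhere,
        and still gives e I \<le> e'.\<close>
      define e where "e = e' / (I + 1)"
      have "e > 0" using e' I by (simp add: e_def)
      obtain p where p: "real_polynomial_function p" and pg: "\<And>x. x \<in> sphere 0 1 \<Longrightarrow> \<bar>g x - p x\<bar> < e"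
        using Stone_Weierstrass_real_polynomial_function[of "sphere 0 1" g e] g \<open>e > 0\<close>
        by (auto intro: continuous_on_subset)
      have cp: "continuous_on UNIV p"
        using p by (intro continuous_at_imp_continuous_on ballI continuous_real_polymonial_function)
      have [measurable]: "p \<in> borel_measurable ?M" by (rule cm[OF cp])
      have gp: "integrable ?M (\<lambda>x. (g x - p x) * f x)"
        by (rule int_bd[where B=e]) (use pg in \<open>auto intro: less_imp_le\<close>)
      have ig: "integrable ?M (\<lambda>x. g x * f x)" by (rule int_bd[where B=B]) (use B in auto)
      have ip: "integrable ?M (\<lambda>x. p x * f x)"
        using Bochner_Integration.integrable_diff[OF ig gp] by (simp add: algebra_simps)
      have "(\<integral>x. g x * f x \<partial>?M) = (\<integral>x. (g x - p x) * f x \<partial>?M) + (\<integral>x. p x * f x \<partial>?M)"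
        by (subst Bochner_Integration.integral_add[OF gp ip, symmetric]) (simp add: algebra_simps)
      also have "(\<integral>x. p x * f x \<partial>?M) = 0" by (rule poly[OF p])
      finally have "\<bar>\<integral>x. g x * f x \<partial>?M\<bar> \<le> (\<integral>x. \<bar>(g x - p x) * f x\<bar> \<partial>?M)"
        using integral_abs_bound by simp
      also have "\<dots> \<le> (\<integral>x. e * \<bar>f x\<bar> \<partial>?M)"
      proof (rule integral_mono)
        fix x assume "x \<in> space ?M"
        then show "\<bar>(g x - p x) * f x\<bar> \<le> e * \<bar>f x\<bar>"
          unfolding abs_mult using pg[of x] by (intro mult_right_mono) auto
      qed (use integrable_abs[OF gp] f in auto)
      also have "\<dots> = e * I" by (simp add: I_def)
      also have "\<dots> \<le> 0 + e'" using e' I by (simp add: e_def field_simps)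
      finally show "\<bar>\<integral>x. g x * f x \<partial>?M\<bar> \<le> 0 + e'" .
    qed
    then show ?thesis by simp
  qed
  \<comment> \<open>These continuous functions are 1 on C, are bounded by 1, and at each point off C
    are eventually 0. The empty set was split off because its \<open>infdist\<close> is 0
    everywhere.\<close>
  define g where "g k x = max 0 (1 - real k * infdist x C)" for k and x :: "complex ^ 'n"
  have g: "continuous_on UNIV (g k)" for k unfolding g_def by (intro continuous_intros)
  have [measurable]: "g k \<in> borel_measurable ?M" for k by (rule cm[OF g])
  have [measurable]: "(indicator C :: _ \<Rightarrow> real) \<in> borel_measurable ?M"
    using C by (subst measurable_cong_sets[OF sets_sphere_measure refl]) (intro measurable_restrict_space1, auto)
  have "(\<lambda>k. \<integral>x. g k x * f x \<partial>?M) \<longlonglongrightarrow> (\<integral>x. indicator C x * f x \<partial>?M)"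
  proof (rule integral_dominated_convergence[where w="\<lambda>x. \<bar>f x\<bar>"])
    have "(\<lambda>k. g k x) \<longlonglongrightarrow> indicator C x" for x
    proof (cases "x \<in> C")
      case True
      then show ?thesis by (simp add: g_def)
    next
      case False
      then have "infdist x C > 0"
        using C \<open>C \<noteq> {}\<close> infdist_pos_not_in_closed by blast
      then obtain K where K: "1 < real K * infdist x C" using ex_less_of_nat_mult by blast
      have "g k x = 0" if "k \<ge> K" for k
      proof -
        have "real K * infdist x C \<le> real k * infdist x C" using that by (intro mult_right_mono) (auto simp: infdist_nonneg)
        then show ?thesis using K by (simp add: g_def)
      qed
      then have "\<forall>\<^sub>F k in sequentially. g k x = 0" by (auto simp: eventually_sequentially)
      then show ?thesis using False by (simp add: tendsto_eventually)
    qed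
    then show "AE x in ?M. (\<lambda>k. g k x * f x) \<longlonglongrightarrow> indicator C x * f x"
      by (intro AE_I2 tendsto_mult_right)
    have "\<bar>g k x\<bar> \<le> 1" for k x by (simp add: g_def infdist_nonneg)
    then show "AE x in ?M. norm (g k x * f x) \<le> \<bar>f x\<bar>" for k
      by (intro AE_I2) (simp add: abs_mult mult_left_le_one_le)
  qed (use f in auto)
  moreover have "(\<integral>x. g k x * f x \<partial>?M) = 0" for k by (rule cont[OF g])
  ultimately show ?thesis by (simp add: LIMSEQ_const_iff)
qed simp

text \<open>The Borel sets over which f integrates to 0 form a Dynkin system containing the closed
  sets, which are stable under intersection; hence they are all Borel sets.\<close>

lemma polynomials_total_real:
  fixes f :: "complex ^ 'n::finite \<Rightarrow> real"
  assumes f: "integrable sphere_measure f"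
    and poly: "\<And>p. real_polynomial_function p \<Longrightarrow> (\<integral>x. p x * f x \<partial>sphere_measure) = 0"
  shows "AE x in sphere_measure. f x = 0"
proof -
  let ?M = "sphere_measure :: (complex ^ 'n) measure"
  have [measurable]: "f \<in> borel_measurable ?M" using f by auto
  have ind [measurable]: "(indicator A :: _ \<Rightarrow> real) \<in> borel_measurable ?M" if "A \<in> sets borel" for A :: "(complex ^ 'n) set"
    using that by (subst measurable_cong_sets[OF sets_sphere_measure refl]) (intro measurable_restrict_space1, auto)
  have int: "integrable ?M (\<lambda>x. indicator A x * f x)" if "A \<in> sets borel" for A
    by (rule Bochner_Integration.integrable_bound[OF f]) (use ind[OF that] in \<open>auto intro!: AE_I2 simp: abs_mult mult_left_le_one_le\<close>)
  have borel: "(\<integral>x. indicator A x * f x \<partial>?M) = 0" if "A \<in> sets borel" for A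
  proof -
    have "sigma_sets UNIV (Collect closed) = sets (borel :: (complex ^ 'n) measure)"
      unfolding borel_eq_closed by simp
    with that have A: "A \<in> sigma_sets UNIV (Collect closed)" by simp
    have "Int_stable (Collect closed :: (complex ^ 'n) set set)" "Collect closed \<subseteq> Pow (UNIV :: (complex ^ 'n) set)"
      by (auto simp: Int_stable_def)
    then show ?thesis using A
    proof (induction rule: sigma_sets_induct_disjoint)
      case (basic A)
      then show ?case using closed_integral_eq_0[OF f poly] by simp
    next
      case (compl A)
      then have A: "A \<in> sets borel" unfolding borel_eq_closed by simp
      have "(\<integral>x. indicator (UNIV - A) x * f x \<partial>?M) = (\<integral>x. indicator UNIV x * f x - indicator A x * f x \<partial>?M)"
        by (rule Bochner_Integration.integral_cong) (auto simp: indicator_def)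
      also have "\<dots> = (\<integral>x. indicator UNIV x * f x \<partial>?M) - (\<integral>x. indicator A x * f x \<partial>?M)"
        by (rule Bochner_Integration.integral_diff) (use f int A in auto)
      also have "\<dots> = 0" using compl closed_integral_eq_0[OF f poly, of UNIV] by simp
      finally show ?case .
    next
      case (union A)
      then have A: "A i \<in> sets borel" for i unfolding borel_eq_closed by auto
      have "(\<lambda>k. \<integral>x. indicator (\<Union>i<k. A i) x * f x \<partial>?M) \<longlonglongrightarrow> (\<integral>x. indicator (\<Union>i. A i) x * f x \<partial>?M)"
      proof (rule integral_dominated_convergence[where w="\<lambda>x. \<bar>f x\<bar>"])
        have "(\<lambda>k. indicator (\<Union>i<k. A i) x :: real) \<longlonglongrightarrow> indicator (\<Union>i. A i) x" for x
          by (rule LIMSEQ_indicator_UN)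
        then show "AE x in ?M. (\<lambda>k. indicator (\<Union>i<k. A i) x * f x) \<longlonglongrightarrow> indicator (\<Union>i. A i) x * f x"
          by (intro AE_I2 tendsto_mult_right)
        show "AE x in ?M. norm (indicator (\<Union>i<k. A i) x * f x) \<le> \<bar>f x\<bar>" for k
          by (intro AE_I2) (simp add: indicator_def)
        have "(\<Union>i. A i) \<in> sets borel" "\<And>k. (\<Union>i<k. A i) \<in> sets borel" using A by auto
        then show "(\<lambda>x. indicator (\<Union>i. A i) x * f x) \<in> borel_measurable ?M"
          "\<And>k. (\<lambda>x. indicator (\<Union>i<k. A i) x * f x) \<in> borel_measurable ?M"
          using int by blast+
      qed (use f in auto)
      moreover have "(\<integral>x. indicator (\<Union>i<k. A i) x * f x \<partial>?M) = 0" for k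
      proof -
        have "(\<integral>x. indicator (\<Union>i<k. A i) x * f x \<partial>?M) = (\<integral>x. (\<Sum>i<k. indicator (A i) x * f x) \<partial>?M)"
          using union(1)
          by (intro Bochner_Integration.integral_cong refl)
             (auto simp: indicator_UN_disjoint disjoint_family_on_def sum_distrib_right)
        also have "\<dots> = (\<Sum>i<k. \<integral>x. indicator (A i) x * f x \<partial>?M)"
          by (rule Bochner_Integration.integral_sum) (use int A in auto)
        finally show ?thesis using union by simp
      qed
      ultimately show ?case by (simp add: LIMSEQ_const_iff)
    qed simp
  qed
  show ?thesis
  proof (rule sphere_measure.density_zero[OF f])
    fix A assume "A \<in> sets ?M"
    then obtain B where B: "B \<in> sets borel" "A = sphere 0 1 \<inter> B"
      unfolding sets_sphere_measure sets_restrict_space by (elim imageE)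
    have "set_lebesgue_integral ?M A f = (\<integral>x. indicator B x * f x \<partial>?M)"
      unfolding set_lebesgue_integral_def
      by (rule Bochner_Integration.integral_cong) (auto simp: B(2) indicator_def)
    then show "set_lebesgue_integral ?M A f = 0" using borel[OF B(1)] by simp
  qed
qed

lemma real_polynomial_function_polynomial2:
  fixes p :: "complex ^ 'n::finite \<Rightarrow> real"
  assumes "real_polynomial_function p"
  shows "\<exists>P. polynomial2 P \<and> (\<forall>z. P z (vcnj z) = of_real (p z))"
  using assms
proof (induction p rule: real_polynomial_function.induct)
  case (linear f)
  \<comment> \<open>A linear f is determined on the real basis; the real and imaginary parts of z_i
    become (z_i + w_i) / 2 and -\<i> (z_i - w_i) / 2 when w = \<open>vcnj\<close> z.\<close>
  define P where "P z w = (\<Sum>i\<in>UNIV. of_real (f (axis i 1)) * (1/2) * (z $ i + w $ i) +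
      of_real (f (axis i \<i>)) * (- \<i> / 2) * (z $ i + (-1) * w $ i))" for z w :: "complex ^ 'n"
  have "polynomial2 P"
    unfolding P_def[abs_def]
    by (intro polynomial2_sum polynomial2_add polynomial2_mult polynomial2_const polynomial2_fst polynomial2_snd)
  moreover have "P z (vcnj z) = of_real (f z)" for z
  proof -
    have "f z = f (\<Sum>b\<in>Basis. (z \<bullet> b) *\<^sub>R b)" by (simp add: euclidean_representation)
    also have "\<dots> = (\<Sum>b\<in>Basis. (z \<bullet> b) * f b)"
      using linear by (simp add: bounded_linear.linear linear_sum linear_scale)
    also have "\<dots> = (\<Sum>i\<in>UNIV. Re (z $ i) * f (axis i 1) + Im (z $ i) * f (axis i \<i>))"
      by (simp add: sum_Basis_complex_vec inner_axis_one inner_axis_ii)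
    finally show ?thesis
      by (simp add: P_def complex_eq_iff mult.commute)
  qed
  ultimately show ?case by blast
next
  case (const c)
  show ?case by (rule exI[of _ "\<lambda>z w. of_real c"]) auto
next
  case (add f g)
  then obtain P Q where "polynomial2 P" "polynomial2 Q"
    "\<And>z. P z (vcnj z) = of_real (f z)" "\<And>z. Q z (vcnj z) = of_real (g z)" by blast
  then show ?case by (intro exI[of _ "\<lambda>z w. P z w + Q z w"]) auto
next
  case (mult f g)
  then obtain P Q where "polynomial2 P" "polynomial2 Q"
    "\<And>z. P z (vcnj z) = of_real (f z)" "\<And>z. Q z (vcnj z) = of_real (g z)" by blast
  then show ?case by (intro exI[of _ "\<lambda>z w. P z w * Q z w"]) auto
qed

lemma continuous_imp_square_integrable:
  fixes f :: "complex ^ 'n::finite \<Rightarrow> complex"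
  assumes "continuous_on UNIV f"
  shows "square_integrable f"
proof -
  have [measurable]: "f \<in> borel_measurable sphere_measure"
    using measurable_restrict_space1[OF borel_measurable_continuous_onI[OF assms]] by simp
  have "bounded (f ` sphere 0 1)"
    by (intro compact_imp_bounded compact_continuous_image continuous_on_subset[OF assms]) auto
  then obtain B where B: "\<forall>y\<in>f ` sphere 0 1. norm y \<le> B" unfolding bounded_iff by blast
  have "integrable sphere_measure (\<lambda>x. (norm (f x))\<^sup>2)"
    by (rule sphere_measure.integrable_const_bound[where B="B\<^sup>2"])
       (use B in \<open>auto intro!: AE_I2 power_mono\<close>)
  then show ?thesis by (simp add: square_integrable_def)
qed

lemma square_integrable_polynomial2:
  "polynomial2 F \<Longrightarrow> square_integrable (\<lambda>z. F z (vcnj z))"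
  by (intro continuous_imp_square_integrable continuous_on_polynomial2)

lemma polynomials_total:
  fixes f :: "'n::finite sphere_L2"
  assumes "\<And>F. polynomial2 F \<Longrightarrow> cinner (abs_sphere_L2 (\<lambda>z. F z (vcnj z))) f = 0"
  shows "f = 0"
proof -
  obtain u where u: "square_integrable u" and f: "f = abs_sphere_L2 u" by (rule sphere_L2_cases)
  have sq1: "square_integrable (\<lambda>x. 1)" by (intro continuous_imp_square_integrable continuous_intros)
  have int: "integrable sphere_measure u"
    using integrable_mult_cnj[OF u sq1] by simp
  have *: "(\<integral>x. p x * Re (u x) \<partial>sphere_measure) = 0 \<and> (\<integral>x. p x * Im (u x) \<partial>sphere_measure) = 0"
    if p: "real_polynomial_function p" for p
  proof -
    obtain P where P: "polynomial2 P" and Pp: "\<And>z. P z (vcnj z) = of_real (p z)"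
      using real_polynomial_function_polynomial2[OF p] by blast
    have i: "integrable sphere_measure (\<lambda>x. of_real (p x) * cnj (u x))"
      using integrable_mult_cnj[OF square_integrable_polynomial2[OF P] u] by (simp add: Pp)
    have "(\<integral>x. of_real (p x) * cnj (u x) \<partial>sphere_measure) = 0"
      using assms[OF P] cinner_abs[OF square_integrable_polynomial2[OF P] u] unfolding f Pp by simp
    moreover have "Re (\<integral>x. of_real (p x) * cnj (u x) \<partial>sphere_measure) = (\<integral>x. p x * Re (u x) \<partial>sphere_measure)"
      by (subst integral_Re[OF i, symmetric]) simp
    moreover have "Im (\<integral>x. of_real (p x) * cnj (u x) \<partial>sphere_measure) = - (\<integral>x. p x * Im (u x) \<partial>sphere_measure)"
      by (subst integral_Im[OF i, symmetric]) simp
    ultimately show ?thesis by simp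
  qed
  have "AE x in sphere_measure. Re (u x) = 0"
    by (rule polynomials_total_real) (use * int in auto)
  moreover have "AE x in sphere_measure. Im (u x) = 0"
    by (rule polynomials_total_real) (use * int in auto)
  ultimately have "AE x in sphere_measure. u x = 0"
    by eventually_elim (simp add: complex_eq_iff)
  then show ?thesis using u by (simp add: f abs_sphere_L2_eq_0_iff)
qed

section \<open>Orthogonality and totality of the harmonics\<close>

lemma cinner_add_left: "cinner (f + g) h = cinner f h + cinner g h"
  by transfer (simp add: L2_eq_def distrib_right integrable_mult_cnj)

lemma cinner_scaleC_left: "cinner (scaleC c f) g = c * cinner f g"
  by transfer (simp add: mult.assoc)

lemma cinner_commute: "cinner g f = cnj (cinner f g)"
proof transfer
  fix f g :: "complex ^ 'a \<Rightarrow> complex"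
  show "(\<integral>x. g x * cnj (f x) \<partial>sphere_measure) = cnj (\<integral>x. f x * cnj (g x) \<partial>sphere_measure)"
    by (subst Bochner_Integration.integral_cnj[symmetric]) (simp add: mult.commute)
qed

lemma cinner_add_right: "cinner h (f + g) = cinner h f + cinner h g"
  by (metis cinner_add_left cinner_commute complex_cnj_add)

lemma cinner_scaleC_right: "cinner f (scaleC c g) = cnj c * cinner f g"
  by (metis cinner_commute cinner_scaleC_left complex_cnj_mult)

lemma cinner_zero_left [simp]: "cinner 0 g = 0"
  using cinner_scaleC_left[of 0 0 g] by simp

lemma cinner_zero_right [simp]: "cinner g 0 = 0"
  by (metis cinner_commute cinner_zero_left complex_cnj_zero)

lemma cinner_diff_left: "cinner (f - g) h = cinner f h - cinner g h"
  using cinner_add_left[of "f - g" g h] by simp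

lemma cinner_diff_right: "cinner h (f - g) = cinner h f - cinner h g"
  using cinner_add_right[of h "f - g" g] by simp

lemma cinner_sum_left: "cinner (\<Sum>i\<in>I. f i) g = (\<Sum>i\<in>I. cinner (f i) g)"
  by (induction I rule: infinite_finite_induct) (auto simp: cinner_add_left)

lemma cinner_sum_right: "cinner g (\<Sum>i\<in>I. f i) = (\<Sum>i\<in>I. cinner g (f i))"
  by (induction I rule: infinite_finite_induct) (auto simp: cinner_add_right)

lemma cinner_self: "cinner f f = of_real ((norm f)\<^sup>2)"
proof -
  have "Im (cinner f f) = 0"
    using cinner_commute[of f f] by (simp add: complex_eq_iff)
  moreover have "Re (cinner f f) = (norm f)\<^sup>2"
    by (simp add: power2_norm_eq_inner inner_eq_Re_cinner)
  ultimately show ?thesis by (simp add: complex_eq_iff)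
qed

lemma Re_cinner_ii: "Re (cinner f (scaleC \<i> g)) = Im (cinner f g)"
  by (simp add: cinner_scaleC_right)

text \<open>Infinite sums are passed through the real inner product; testing with both g and \<i> g
  then recovers the complex one.\<close>

lemma cinner_eq_Complex: "cinner f g = Complex (inner f g) (inner f (scaleC \<i> g))"
  by (simp add: complex_eq_iff inner_eq_Re_cinner Re_cinner_ii)

definition poly_class :: "('n::finite bifun) \<Rightarrow> 'n sphere_L2" where
  "poly_class F = abs_sphere_L2 (\<lambda>z. F z (vcnj z))"

lemma poly_class_add:
  "polynomial2 F \<Longrightarrow> polynomial2 G \<Longrightarrow> poly_class (\<lambda>z w. F z w + G z w) = poly_class F + poly_class G"
  by (simp add: poly_class_def abs_sphere_L2_add square_integrable_polynomial2)

lemma poly_class_cmult: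
  "polynomial2 F \<Longrightarrow> poly_class (\<lambda>z w. c * F z w) = scaleC c (poly_class F)"
  by (simp add: poly_class_def abs_sphere_L2_cmult square_integrable_polynomial2)

lemma poly_class_zero: "poly_class (\<lambda>z w. 0) = 0"
  by (simp add: poly_class_def zero_sphere_L2_def)

lemma poly_class_sum:
  assumes "\<And>s. s \<in> S \<Longrightarrow> polynomial2 (F s)"
  shows "poly_class (\<lambda>z w. \<Sum>s\<in>S. F s z w) = (\<Sum>s\<in>S. poly_class (F s))"
  using assms by (induction S rule: infinite_finite_induct)
    (auto simp: poly_class_zero poly_class_add polynomial2_sum)

lemma poly_class_cong:
  assumes "polynomial2 F" "polynomial2 G" "\<And>z. norm z = 1 \<Longrightarrow> F z (vcnj z) = G z (vcnj z)"
  shows "poly_class F = poly_class G"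
proof -
  let ?f = "\<lambda>z. F z (vcnj z)" and ?g = "\<lambda>z. G z (vcnj z)"
  have sq: "square_integrable ?f" "square_integrable ?g"
    using assms by (auto intro: square_integrable_polynomial2)
  have "abs_sphere_L2 ?f - abs_sphere_L2 ?g = 0"
    unfolding abs_sphere_L2_diff[OF sq, symmetric] abs_sphere_L2_eq_0_iff[OF square_integrable_diff[OF sq]]
    using assms(3) by (intro AE_I2) auto
  then show ?thesis by (simp add: poly_class_def)
qed

lemma bidegree_harmonics_eq:
  "bidegree_harmonics p q = {poly_class F | F. polynomial2 F \<and> bihomogeneous p q F \<and> (\<forall>z. lap2 F z (vcnj z) = 0)}"
proof -
  have "(\<forall>z. laplacian (\<lambda>z. F z (vcnj z)) z = 0) \<longleftrightarrow> (\<forall>z. lap2 F z (vcnj z) = 0)"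
    if "polynomial2 F" for F :: "'a bifun"
    by (simp add: laplacian_polynomial2[OF that])
  then show ?thesis unfolding bidegree_harmonics_def poly_class_def by blast
qed

lemma subspace_bidegree_harmonics: "complex_L2.subspace (bidegree_harmonics p q)"
proof (rule complex_L2.subspaceI)
  show "0 \<in> bidegree_harmonics p q"
    unfolding bidegree_harmonics_eq
    by (rule CollectI, rule exI[of _ "\<lambda>z w. 0"]) (auto simp: poly_class_zero bihomogeneous_def lap2_def)
next
  fix f g :: "'a sphere_L2" assume "f \<in> bidegree_harmonics p q" "g \<in> bidegree_harmonics p q"
  then obtain F G where "f = poly_class F" "polynomial2 F" "bihomogeneous p q F" "\<And>z. lap2 F z (vcnj z) = 0"
    "g = poly_class G" "polynomial2 G" "bihomogeneous p q G" "\<And>z. lap2 G z (vcnj z) = 0"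
    by (auto simp: bidegree_harmonics_eq)
  then show "f + g \<in> bidegree_harmonics p q"
    unfolding bidegree_harmonics_eq
    by (intro CollectI exI[of _ "\<lambda>z w. F z w + G z w"])
       (auto simp: poly_class_add lap2_add bihomogeneous_def algebra_simps)
next
  fix c and f :: "'a sphere_L2" assume "f \<in> bidegree_harmonics p q"
  then obtain F where "f = poly_class F" "polynomial2 F" "bihomogeneous p q F" "\<And>z. lap2 F z (vcnj z) = 0"
    by (auto simp: bidegree_harmonics_eq)
  then show "scaleC c f \<in> bidegree_harmonics p q"
    unfolding bidegree_harmonics_eq
    by (intro CollectI exI[of _ "\<lambda>z w. c * F z w"])
       (auto simp: poly_class_cmult lap2_cmult bihomogeneous_def)
qed

lemma cinner_poly_class:
  assumes "polynomial2 F" "polynomial2 G"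
  shows "cinner (poly_class F) (poly_class G) = (\<integral>z. F z (vcnj z) * pcnj G z (vcnj z) \<partial>sphere_measure)"
  unfolding poly_class_def using assms
  by (subst cinner_abs) (auto simp: square_integrable_polynomial2 pcnj_def)

lemma bihomogeneous_real_scale:
  assumes "bihomogeneous p q F"
  shows "F (t *\<^sub>R x) (vcnj (t *\<^sub>R x)) = of_real (t ^ (p + q)) * F x (vcnj x)"
proof -
  have "t *\<^sub>R x = of_real t *s x" "vcnj (t *\<^sub>R x) = of_real t *s vcnj x"
    by (simp add: vec_eq_iff, simp add: scaleR_conv_of_real)+
  then show ?thesis using assms by (simp add: bihomogeneous_def power_add)
qed

lemma ball_integral_eq_cinner:
  assumes F: "polynomial2 F" "bihomogeneous p q F" and G: "polynomial2 G" "bihomogeneous p' q' G" and m: "m > 0"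
  obtains C :: real where "C > 0"
    "ball_integral m (\<lambda>z w. F z w * pcnj G z w) = of_real C * cinner (poly_class F) (poly_class G)"
proof -
  obtain C :: real where C: "C > 0" and eq: "\<And>F :: 'a bifun. polynomial2 F \<Longrightarrow>
      (\<And>t x. t > 0 \<Longrightarrow> F (t *\<^sub>R x) (vcnj (t *\<^sub>R x)) = of_real (t ^ (p + q + (p' + q'))) * F x (vcnj x)) \<Longrightarrow>
      ball_integral m F = of_real C * (\<integral>x. F x (vcnj x) \<partial>sphere_measure)"
    using ball_integral_eq_sphere_integral[OF m, where d = "p + q + (p' + q')"] by blast
  have "ball_integral m (\<lambda>z w. F z w * pcnj G z w) =
      of_real C * (\<integral>z. F z (vcnj z) * pcnj G z (vcnj z) \<partial>sphere_measure)"
  proof (rule eq)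
    show "polynomial2 (\<lambda>z w. F z w * pcnj G z w)" using F G by auto
    show "F (t *\<^sub>R x) (vcnj (t *\<^sub>R x)) * pcnj G (t *\<^sub>R x) (vcnj (t *\<^sub>R x)) =
      of_real (t ^ (p + q + (p' + q'))) * (F x (vcnj x) * pcnj G x (vcnj x))" for t x
      unfolding pcnj_def bihomogeneous_real_scale[OF F(2)] vcnj_vcnj bihomogeneous_real_scale[OF G(2)]
      by (simp add: power_add)
  qed
  with C show ?thesis by (intro that[of C]) (simp_all add: cinner_poly_class F G)
qed

lemma cinner_poly_class_eq_0:
  assumes F: "polynomial2 F" "bihomogeneous p q F" and G: "polynomial2 G" "bihomogeneous p' q' G"
    and m: "m > 0" and 0: "ball_integral m (\<lambda>z w. F z w * pcnj G z w) = 0"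
  shows "cinner (poly_class F) (poly_class G) = 0"
  using ball_integral_eq_cinner[OF F G m] 0 by (metis mult_eq_0_iff of_real_eq_0_iff less_irrefl)

lemma bihomogeneous_euler_z:
  assumes "polynomial2 F" "bihomogeneous p q F"
  shows "(\<Sum>i\<in>UNIV. z $ i * pdz i F z (vcnj z)) = of_nat p * F z (vcnj z)"
proof (rule euler_z[OF assms(1)])
  fix a
  have "F (a *s z) (1 *s vcnj z) = a ^ p * 1 ^ q * F z (vcnj z)"
    using assms(2) unfolding bihomogeneous_def by blast
  then show "F (a *s z) (vcnj z) = a ^ p * F z (vcnj z)" by simp
qed

lemma bihomogeneous_euler_w:
  assumes "polynomial2 F" "bihomogeneous p q F"
  shows "(\<Sum>i\<in>UNIV. vcnj z $ i * pdw i F z (vcnj z)) = of_nat q * F z (vcnj z)"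
proof (rule euler_w[OF assms(1)])
  fix a
  have "F (1 *s z) (a *s vcnj z) = 1 ^ p * a ^ q * F z (vcnj z)"
    using assms(2) unfolding bihomogeneous_def by blast
  then show "F z (a *s vcnj z) = a ^ q * F z (vcnj z)" by simp
qed

text \<open>Conjugation turns bidegree (p', q') into (q', p'). Green's identity for F and
  \<open>pcnj G\<close> gives (p - p') times the pairing equal to 0; with the roles exchanged it
  gives (q' - q) times the pairing equal to 0. One factor is nonzero.\<close>

lemma bidegree_harmonics_orthogonal:
  assumes f: "f \<in> bidegree_harmonics p q" and g: "g \<in> bidegree_harmonics p' q'" and ne: "(p, q) \<noteq> (p', q')"
  shows "cinner f g = 0"
proof -
  from f obtain F where F: "f = poly_class F" "polynomial2 F" "bihomogeneous p q F" "\<And>z. lap2 F z (vcnj z) = 0"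
    by (auto simp: bidegree_harmonics_eq)
  from g obtain G where G: "g = poly_class G" "polynomial2 G" "bihomogeneous p' q' G" "\<And>z. lap2 G z (vcnj z) = 0"
    by (auto simp: bidegree_harmonics_eq)
  let ?G = "pcnj G"
  have G': "polynomial2 ?G" "\<And>z. lap2 ?G z (vcnj z) = 0"
    using G by (auto simp: lap2_pcnj) (simp add: pcnj_def)
  have ew: "(\<Sum>i\<in>UNIV. vcnj z $ i * pdw i ?G z (vcnj z)) = of_nat p' * ?G z (vcnj z)" for z
    using arg_cong[OF bihomogeneous_euler_z[OF G(2,3), of z], of cnj]
    by (simp add: pdw_pcnj G) (simp add: pcnj_def)
  have ez: "(\<Sum>i\<in>UNIV. z $ i * pdz i ?G z (vcnj z)) = of_nat q' * ?G z (vcnj z)" for z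
    using arg_cong[OF bihomogeneous_euler_w[OF G(2,3), of z], of cnj]
    by (simp add: pdz_pcnj G) (simp add: pcnj_def)
  have "of_nat p * ball_integral 1 (\<lambda>z w. F z w * ?G z w) = of_nat p' * ball_integral 1 (\<lambda>z w. F z w * ?G z w)"
    by (rule green) (use F G' ew bihomogeneous_euler_z[OF F(2,3)] in auto)
  moreover have "of_nat q' * ball_integral 1 (\<lambda>z w. ?G z w * F z w) = of_nat q * ball_integral 1 (\<lambda>z w. ?G z w * F z w)"
    by (rule green) (use F G' ez bihomogeneous_euler_w[OF F(2,3)] in auto)
  ultimately have "ball_integral 1 (\<lambda>z w. F z w * ?G z w) = 0"
    using ne by (auto simp: mult.commute[of "pcnj G _ _"])
  then show ?thesis
    unfolding F(1) G(1) by (intro cinner_poly_class_eq_0[OF F(2,3) G(2,3)]) auto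
qed

definition harmonics :: "nat \<times> nat \<Rightarrow> 'n::finite sphere_L2 set" where
  "harmonics s = bidegree_harmonics (fst s) (snd s)"

lemma subspace_harmonics: "complex_L2.subspace (harmonics s)"
  by (simp add: harmonics_def subspace_bidegree_harmonics)

lemma harmonics_orthogonal: "f \<in> harmonics s \<Longrightarrow> g \<in> harmonics t \<Longrightarrow> s \<noteq> t \<Longrightarrow> cinner f g = 0"
  unfolding harmonics_def by (erule bidegree_harmonics_orthogonal) (auto simp: prod_eq_iff)

definition mono2 :: "('n \<Rightarrow> nat) \<Rightarrow> ('n \<Rightarrow> nat) \<Rightarrow> 'n::finite bifun" where
  "mono2 \<alpha> \<beta> z w = (\<Prod>i\<in>UNIV. (z $ i) ^ \<alpha> i) * (\<Prod>i\<in>UNIV. (w $ i) ^ \<beta> i)"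

lemma polynomial2_mono2 [intro]: "polynomial2 (mono2 \<alpha> \<beta>)"
  using polynomial2_monomial[of 1 \<alpha> \<beta>] by (simp add: mono2_def[abs_def])

lemma mono2_scale: "mono2 \<alpha> \<beta> (a *s z) (b *s w) = a ^ (\<Sum>i\<in>UNIV. \<alpha> i) * b ^ (\<Sum>i\<in>UNIV. \<beta> i) * mono2 \<alpha> \<beta> z w"
  by (simp add: mono2_def power_mult_distrib prod.distrib power_sum)

lemma bihom_mono2: "bihom (\<Sum>i\<in>UNIV. \<alpha> i) (\<Sum>i\<in>UNIV. \<beta> i) (mono2 \<alpha> \<beta>)"
  by (auto simp: bihom_def mono2_scale)

lemma polynomial2_mono2_expansion:
  fixes F :: "'n::finite bifun"
  assumes "polynomial2 F"
  obtains I c where "finite I" "F = (\<lambda>z w. \<Sum>s\<in>I. c s * mono2 (fst s) (snd s) z w)"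
proof -
  obtain I c where "finite I" "\<And>z w. F z w =
      (\<Sum>(\<alpha>, \<beta>)\<in>I. c (\<alpha>, \<beta>) * (\<Prod>i\<in>UNIV. (z $ i) ^ \<alpha> i) * (\<Prod>i\<in>UNIV. (w $ i) ^ \<beta> i))"
    using assms unfolding polynomial2_def by blast
  then show ?thesis
    by (intro that[of I c]) (auto simp: fun_eq_iff mono2_def case_prod_unfold mult.assoc)
qed

text \<open>On the sphere \<open>rad2\<close> is 1, so the decomposition H + \<open>rad2\<close> G
  becomes H + G. Since G has lower degree, induction makes every monomial a sum of
  harmonics.\<close>

lemma poly_class_in_span_harmonics:
  fixes F :: "'n::finite bifun"
  assumes "polynomial2 F"
  shows "poly_class F \<in> complex_L2.span (\<Union>s. harmonics s)"
proof -
  have mono: "poly_class F \<in> complex_L2.span (\<Union>s. harmonics s)" if "bihom p q F"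
    for p q and F :: "'n bifun"
    using that
  proof (induction rule: harmonic_decomposition_induct)
    case (harmonic p q H)
    have "poly_class H \<in> harmonics (p, q)"
      unfolding harmonics_def bidegree_harmonics_eq
      using harmonic bihom_imp_polynomial2[of p q H] bihom_imp_bihomogeneous[of p q H]
      by (intro CollectI exI[of _ H]) auto
    then show ?case by (intro complex_L2.span_base) blast
  next
    case (add H G)
    have "poly_class (\<lambda>z w. H z w + rad2 z w * G z w) = poly_class (\<lambda>z w. H z w + G z w)"
    proof (rule poly_class_cong)
      show "polynomial2 (\<lambda>z w. H z w + rad2 z w * G z w)"
        unfolding rad2_def using add
        by (intro polynomial2_add polynomial2_mult polynomial2_sum polynomial2_fst polynomial2_snd)
    qed (use add in \<open>auto simp: rad2_vcnj\<close>)
    with add show ?case by (simp add: poly_class_add complex_L2.span_add)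
  qed
  obtain I c where "finite I" "F = (\<lambda>z w. \<Sum>s\<in>I. c s * mono2 (fst s) (snd s) z w)"
    using polynomial2_mono2_expansion[OF assms] .
  then have "poly_class F = (\<Sum>s\<in>I. scaleC (c s) (poly_class (mono2 (fst s) (snd s))))"
    by (simp add: poly_class_sum poly_class_cmult polynomial2_mono2 polynomial2_mult polynomial2_const)
  also have "\<dots> \<in> complex_L2.span (\<Union>s. harmonics s)"
    by (intro complex_L2.span_sum complex_L2.span_scale mono[OF bihom_mono2])
  finally show ?thesis .
qed

lemma harmonics_total:
  assumes "\<And>s g. g \<in> harmonics s \<Longrightarrow> cinner g f = 0"
  shows "f = 0"
proof (rule polynomials_total)
  fix F :: "'a bifun" assume "polynomial2 F"
  then have "poly_class F \<in> complex_L2.span (\<Union>s. harmonics s)" by (rule poly_class_in_span_harmonics)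
  then have "cinner (poly_class F) f = 0"
    by (induction rule: complex_L2.span_induct_alt) (auto simp: cinner_add_left cinner_scaleC_left assms)
  then show "cinner (abs_sphere_L2 (\<lambda>z. F z (vcnj z))) f = 0" by (simp add: poly_class_def)
qed

section \<open>Counting exponent vectors\<close>

definition exponents :: "nat \<Rightarrow> ('n::finite \<Rightarrow> nat) set" where
  "exponents d = {\<alpha>. (\<Sum>i\<in>UNIV. \<alpha> i) = d}"

text \<open>Dropping one coordinate k is injective, because the prescribed total recovers it; each
  remaining entry lies between 0 and d.\<close>

lemma
  shows finite_exponents: "finite (exponents d :: ('n::finite \<Rightarrow> nat) set)"
    and card_exponents_le: "card (exponents d :: ('n::finite \<Rightarrow> nat) set) \<le> (d + 1) ^ (CARD('n) - 1)"
proof -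
  fix k :: 'n
  let ?U = "UNIV - {k}"
  let ?P = "PiE ?U (\<lambda>_. {..d})"
  have le: "\<alpha> i \<le> d" if "\<alpha> \<in> exponents d" for \<alpha> :: "'n \<Rightarrow> nat" and i
    using that member_le_sum[of i UNIV \<alpha>] by (auto simp: exponents_def)
  have inj: "inj_on (\<lambda>\<alpha>. restrict \<alpha> ?U) (exponents d)"
  proof (rule inj_onI)
    fix \<alpha> \<beta> :: "'n \<Rightarrow> nat" assume ab: "\<alpha> \<in> exponents d" "\<beta> \<in> exponents d" "restrict \<alpha> ?U = restrict \<beta> ?U"
    have eq: "\<alpha> i = \<beta> i" if "i \<noteq> k" for i
      using that fun_cong[OF ab(3), of i] by simp
    have "\<alpha> k + (\<Sum>i\<in>?U. \<alpha> i) = \<beta> k + (\<Sum>i\<in>?U. \<beta> i)"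
      using ab by (simp add: exponents_def sum.remove[symmetric])
    moreover have "(\<Sum>i\<in>?U. \<alpha> i) = (\<Sum>i\<in>?U. \<beta> i)" by (intro sum.cong) (auto simp: eq)
    ultimately have "\<alpha> k = \<beta> k" by simp
    show "\<alpha> = \<beta>"
    proof
      fix i show "\<alpha> i = \<beta> i" using \<open>\<alpha> k = \<beta> k\<close> eq by (cases "i = k") auto
    qed
  qed
  have sub: "(\<lambda>\<alpha>. restrict \<alpha> ?U) ` exponents d \<subseteq> ?P"
    by (rule image_subsetI) (simp only: restrict_PiE_iff, simp add: le)
  have fin: "finite ?P" by (intro finite_PiE) auto
  show "finite (exponents d :: ('n \<Rightarrow> nat) set)"
    by (rule inj_on_finite[OF inj sub fin])
  have "card (exponents d :: ('n \<Rightarrow> nat) set) \<le> card ?P" by (rule card_inj_on_le[OF inj sub fin])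
  also have "\<dots> = (d + 1) ^ (CARD('n) - 1)" by (simp add: card_PiE card_Diff_singleton)
  finally show "card (exponents d :: ('n \<Rightarrow> nat) set) \<le> (d + 1) ^ (CARD('n) - 1)" .
qed

text \<open>All coordinates except k may be chosen freely up to d div n: their sum stays at most d,
  and coordinate k takes the rest.\<close>

lemma card_exponents_ge: "card (exponents d :: ('n::finite \<Rightarrow> nat) set) \<ge> (d div CARD('n) + 1) ^ (CARD('n) - 1)"
proof -
  fix k :: 'n
  let ?U = "UNIV - {k}"
  let ?P = "PiE ?U (\<lambda>_. {..d div CARD('n)})"
  define f where "f \<beta> i = (if i = k then d - (\<Sum>j\<in>?U. \<beta> j) else \<beta> i)" for \<beta> :: "'n \<Rightarrow> nat" and i
  have "inj_on f ?P"
  proof (rule inj_onI)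
    fix \<alpha> \<beta> :: "'n \<Rightarrow> nat" assume ab: "\<alpha> \<in> ?P" "\<beta> \<in> ?P" "f \<alpha> = f \<beta>"
    show "\<alpha> = \<beta>"
    proof (rule PiE_ext[OF ab(1,2)])
      fix i assume "i \<in> ?U"
      then show "\<alpha> i = \<beta> i" using fun_cong[OF ab(3), of i] by (simp add: f_def)
    qed
  qed
  moreover have "f ` ?P \<subseteq> exponents d"
  proof
    fix \<alpha> assume "\<alpha> \<in> f ` ?P"
    then obtain \<beta> where \<beta>: "\<beta> \<in> ?P" "\<alpha> = f \<beta>" by auto
    have "(\<Sum>j\<in>?U. \<beta> j) \<le> (\<Sum>j\<in>?U. d div CARD('n))"
      using \<beta> by (intro sum_mono) auto
    also have "\<dots> \<le> CARD('n) * (d div CARD('n))" by (simp add: card_Diff_singleton)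
    also have "\<dots> \<le> d" by simp
    finally have *: "(\<Sum>j\<in>?U. \<beta> j) \<le> d" .
    have "(\<Sum>i\<in>UNIV. \<alpha> i) = f \<beta> k + (\<Sum>i\<in>?U. f \<beta> i)" unfolding \<beta>(2) by (rule sum.remove) auto
    also have "(\<Sum>i\<in>?U. f \<beta> i) = (\<Sum>i\<in>?U. \<beta> i)" by (intro sum.cong) (auto simp: f_def)
    also have "f \<beta> k + (\<Sum>i\<in>?U. \<beta> i) = d" using * by (simp add: f_def)
    finally show "\<alpha> \<in> exponents d" by (simp add: exponents_def)
  qed
  ultimately have "card ?P \<le> card (exponents d :: ('n \<Rightarrow> nat) set)"
    by (rule card_inj_on_le[OF _ _ finite_exponents])
  moreover have "card ?P = (d div CARD('n) + 1) ^ (CARD('n) - 1)" by (simp add: card_PiE card_Diff_singleton)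
  ultimately show ?thesis by simp
qed

section \<open>Dimension bounds\<close>

text \<open>Both sides are polynomials in a that agree everywhere, so their coefficients at a^p
  agree.\<close>

lemma sum_power_coeff_extract:
  fixes g :: "'s \<Rightarrow> complex"
  assumes "finite I" "\<And>a. (\<Sum>s\<in>I. g s * a ^ e s) = a ^ p * v"
  shows "(\<Sum>s\<in>{s\<in>I. e s = p}. g s) = v"
proof -
  define P where "P = (\<Sum>s\<in>I. Polynomial.monom (g s) (e s))"
  have "poly P a = poly (Polynomial.monom v p) a" for a
    using assms(2)[of a] by (simp add: P_def poly_sum poly_monom mult.commute)
  then have "P = Polynomial.monom v p" by (simp add: poly_eq_poly_eq_iff[symmetric] fun_eq_iff)
  then have "poly.coeff P p = v" by simp
  moreover have "poly.coeff P p = (\<Sum>s\<in>{s\<in>I. e s = p}. g s)"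
    using assms(1) by (simp add: P_def coeff_sum sum.inter_filter if_distrib cong: if_cong)
  ultimately show ?thesis by simp
qed

text \<open>With z fixed and w = \<open>vcnj\<close> z, bihomogeneity is a polynomial identity in
  the scalars a and b. Comparing coefficients, first of a^p and then of b^q, leaves only the
  monomials of bidegree (p, q).\<close>

lemma bidegree_harmonics_subset_span:
  "bidegree_harmonics p q \<subseteq> complex_L2.span
     ((\<lambda>s. poly_class (mono2 (fst s) (snd s))) ` (exponents p \<times> exponents q) :: 'n::finite sphere_L2 set)"
proof
  fix f :: "'n sphere_L2" assume "f \<in> bidegree_harmonics p q"
  then obtain F where F: "f = poly_class F" "polynomial2 F" "bihomogeneous p q F"
    by (auto simp: bidegree_harmonics_eq)
  obtain I c where I: "finite I" and Fc: "F = (\<lambda>z w. \<Sum>s\<in>I. c s * mono2 (fst s) (snd s) z w)"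
    using polynomial2_mono2_expansion[OF F(2)] .
  let ?a = "\<lambda>s :: ('n \<Rightarrow> nat) \<times> ('n \<Rightarrow> nat). \<Sum>i\<in>UNIV. fst s i"
  let ?b = "\<lambda>s :: ('n \<Rightarrow> nat) \<times> ('n \<Rightarrow> nat). \<Sum>i\<in>UNIV. snd s i"
  define J where "J = {s \<in> I. s \<in> exponents p \<times> exponents q}"
  have FJ: "F z (vcnj z) = (\<Sum>s\<in>J. c s * mono2 (fst s) (snd s) z (vcnj z))" for z
  proof -
    let ?m = "\<lambda>s. c s * mono2 (fst s) (snd s) z (vcnj z)"
    have *: "(\<Sum>s\<in>I. (?m s * b ^ ?b s) * a ^ ?a s) = a ^ p * (b ^ q * F z (vcnj z))" for a b
      using F(3) unfolding bihomogeneous_def Fc mono2_scale by (simp add: mult_ac)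
    have "(\<Sum>s\<in>{s\<in>I. ?a s = p}. ?m s * b ^ ?b s) = b ^ q * F z (vcnj z)" for b
      by (rule sum_power_coeff_extract[OF I *])
    then have "(\<Sum>s\<in>{s\<in>{s\<in>I. ?a s = p}. ?b s = q}. ?m s) = F z (vcnj z)"
      by (rule sum_power_coeff_extract[rotated]) (use I in simp)
    also have "{s\<in>{s\<in>I. ?a s = p}. ?b s = q} = J" by (auto simp: J_def exponents_def)
    finally show ?thesis ..
  qed
  have "f = poly_class (\<lambda>z w. \<Sum>s\<in>J. c s * mono2 (fst s) (snd s) z w)"
    unfolding F(1)
    by (intro poly_class_cong F polynomial2_sum polynomial2_mult polynomial2_const polynomial2_mono2 FJ)
  also have "\<dots> = (\<Sum>s\<in>J. scaleC (c s) (poly_class (mono2 (fst s) (snd s))))"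
    by (simp add: poly_class_sum poly_class_cmult polynomial2_mono2 polynomial2_mult polynomial2_const)
  also have "\<dots> \<in> complex_L2.span ((\<lambda>s. poly_class (mono2 (fst s) (snd s))) ` (exponents p \<times> exponents q))"
    by (intro complex_L2.span_sum complex_L2.span_scale complex_L2.span_base) (auto simp: J_def)
  finally show "f \<in> complex_L2.span ((\<lambda>s. poly_class (mono2 (fst s) (snd s))) ` (exponents p \<times> exponents q))" .
qed

lemma dim_bidegree_harmonics_le:
  "complex_L2.dim (bidegree_harmonics p q :: 'n::finite sphere_L2 set) \<le> ((p + 1) * (q + 1)) ^ (CARD('n) - 1)"
proof -
  let ?S = "exponents p \<times> exponents q :: (('n \<Rightarrow> nat) \<times> ('n \<Rightarrow> nat)) set"
  have fin: "finite ?S" by (simp add: finite_exponents)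
  have "complex_L2.dim (bidegree_harmonics p q :: 'n sphere_L2 set) \<le>
      card ((\<lambda>s. poly_class (mono2 (fst s) (snd s)) :: 'n sphere_L2) ` ?S)"
    using fin by (intro complex_L2.dim_le_card bidegree_harmonics_subset_span) simp
  also have "\<dots> \<le> card ?S" using fin by (rule card_image_le)
  also have "\<dots> = card (exponents p :: ('n \<Rightarrow> nat) set) * card (exponents q :: ('n \<Rightarrow> nat) set)"
    by (rule card_cartesian_product)
  also have "\<dots> \<le> (p + 1) ^ (CARD('n) - 1) * (q + 1) ^ (CARD('n) - 1)"
    by (intro mult_mono card_exponents_le) auto
  finally show ?thesis by (simp only: power_mult_distrib)
qed

lemma finite_basis_harmonics:
  obtains B :: "'n::finite sphere_L2 set" where "finite B" "complex_L2.independent B" "complex_L2.span B = harmonics s"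
    "B \<subseteq> harmonics s" "card B = complex_L2.dim (harmonics s :: 'n sphere_L2 set)"
proof -
  obtain B :: "'n sphere_L2 set" where B: "B \<subseteq> harmonics s" "complex_L2.independent B" "harmonics s \<subseteq> complex_L2.span B"
    "card B = complex_L2.dim (harmonics s :: 'n sphere_L2 set)"
    by (rule complex_L2.basis_exists[of "harmonics s"])
  have "B \<subseteq> complex_L2.span ((\<lambda>s. poly_class (mono2 (fst s) (snd s))) ` (exponents (fst s) \<times> exponents (snd s)))"
    using B(1) bidegree_harmonics_subset_span unfolding harmonics_def by blast
  with B(2) have "finite B"
    using complex_L2.independent_span_bound[of "(\<lambda>s. poly_class (mono2 (fst s) (snd s))) ` (exponents (fst s) \<times> exponents (snd s))" B]
    by (simp add: finite_exponents)
  moreover have "complex_L2.span B = harmonics s"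
    using B complex_L2.span_minimal[OF B(1) subspace_harmonics] by auto
  ultimately show ?thesis using B that by blast
qed

lemma independent_orthogonal:
  assumes "\<And>f. f \<in> B \<Longrightarrow> f \<noteq> 0" "\<And>f g. f \<in> B \<Longrightarrow> g \<in> B \<Longrightarrow> f \<noteq> g \<Longrightarrow> cinner f g = 0"
  shows "complex_L2.independent B"
  unfolding complex_L2.independent_explicit_finite_subsets
proof (intro allI impI ballI)
  fix S u f assume S: "S \<subseteq> B" "finite S" and 0: "(\<Sum>v\<in>S. scaleC (u v) v) = 0" and f: "f \<in> S"
  have "0 = cinner (\<Sum>v\<in>S. scaleC (u v) v) f" by (simp add: 0)
  also have "\<dots> = (\<Sum>v\<in>S. u v * cinner v f)" by (simp add: cinner_sum_left cinner_scaleC_left)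
  also have "\<dots> = (\<Sum>v\<in>S. if v = f then u f * cinner f f else 0)"
    using S f assms(2) by (intro sum.cong) auto
  also have "\<dots> = u f * cinner f f" using S f by simp
  finally show "u f = 0" using assms(1)[of f] f S by (auto simp: cinner_self)
qed

text \<open>A zero class makes the weighted ball integral of |F|^2 vanish. The integrand is
  continuous and nonnegative, so F vanishes throughout the open ball, and homogeneity carries this
  to every z.\<close>

lemma poly_class_eq_0_imp:
  fixes F :: "'n::finite bifun"
  assumes F: "polynomial2 F" "bihomogeneous p q F" and 0: "poly_class F = 0"
  shows "F z (vcnj z) = 0"
proof (rule ccontr)
  assume nz: "F z (vcnj z) \<noteq> 0"
  let ?f = "\<lambda>x. F x (vcnj x)"
  have int0: "ball_integral 1 (\<lambda>z w. F z w * pcnj F z w) = 0"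
    using ball_integral_eq_cinner[OF F F zero_less_one] 0 by (metis cinner_zero_left mult_zero_right)
  define h where "h x = (norm (?f x))\<^sup>2 * max 0 (1 - (norm x)\<^sup>2)" for x
  have cf: "continuous_on UNIV ?f" by (rule continuous_on_polynomial2[OF F(1)])
  have ch: "continuous_on UNIV h" unfolding h_def by (intro continuous_intros cf)
  have h0: "h x \<ge> 0" for x by (simp add: h_def)
  have int_h: "integrable lborel h"
  proof (rule integrable_compact_support[OF ch, of "cball 0 1"])
    fix x :: "complex ^ 'n" assume "x \<notin> cball 0 1"
    then have "1 \<le> (norm x)\<^sup>2" by simp
    then show "h x = 0" by (simp add: h_def max_def)
  qed auto
  have "of_real (\<integral>x. h x \<partial>lborel) = ball_integral 1 (\<lambda>z w. F z w * pcnj F z w)"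
    unfolding ball_integral_def h_def pcnj_def
    by (simp only: integral_complex_of_real[symmetric] vcnj_vcnj of_real_mult complex_norm_square power_one_right)
  with int0 have "(\<integral>x. h x \<partial>lborel) = 0" by simp
  then have "AE x in lborel. h x = 0"
    using int_h h0 by (subst (asm) integral_nonneg_eq_0_iff_AE) auto
  then have "emeasure lborel {x. h x \<noteq> 0} = 0"
    by (subst (asm) AE_iff_measurable[OF _ refl])
      (use ch in \<open>auto intro!: borel_open open_Collect_neq\<close>)
  moreover have "open {x. h x \<noteq> 0}" by (intro open_Collect_neq ch continuous_on_const)
  ultimately have empty: "{x. h x \<noteq> 0} = {}"
    using emeasure_lborel_open_pos by fastforce
  \<comment> \<open>This factor shrinks z into the open unit ball and is itself nonzero, so
    homogeneity preserves the nonvanishing.\<close>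
  define t where "t = 1 / (norm z + 1)"
  have t: "t > 0" "norm (t *\<^sub>R z) < 1"
    by (auto simp: t_def field_simps add_pos_nonneg add_nonneg_pos)
  have "?f (t *\<^sub>R z) \<noteq> 0" using nz t by (simp add: bihomogeneous_real_scale[OF F(2)])
  moreover have "(norm (t *\<^sub>R z))\<^sup>2 < 1" using t(2) by (simp only: power_less_one_iff norm_ge_zero) simp
  ultimately have "h (t *\<^sub>R z) \<noteq> 0" by (simp add: h_def max_def del: norm_scaleR)
  with empty show False by auto
qed

text \<open>Under the rotation of the \<open>i\<close>-th coordinate by the angle \<open>\<theta>\<close>, the restriction of such an \<open>F\<close>
  to \<open>w = vcnj z\<close> is multiplied by \<open>exp (\<i> c \<theta>)\<close>.\<close>

definition weight :: "'n \<Rightarrow> complex \<Rightarrow> ('n::finite bifun) \<Rightarrow> bool" where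
  "weight i c F \<longleftrightarrow> polynomial2 F \<and> (\<forall>z w. z $ i * pdz i F z w - w $ i * pdw i F z w = c * F z w)"

lemma weight_const: "weight i 0 (\<lambda>z w. c)"
  by (auto simp: weight_def)

lemma weight_fst: "weight i (if i = j then 1 else 0) (\<lambda>z w. z $ j)"
  by (auto simp: weight_def)

lemma weight_snd: "weight i (if i = j then -1 else 0) (\<lambda>z w. w $ j)"
  by (auto simp: weight_def)

lemma weight_add: "weight i c F \<Longrightarrow> weight i c G \<Longrightarrow> weight i c (\<lambda>z w. F z w + G z w)"
  unfolding weight_def by (auto simp: pdz_add pdw_add algebra_simps)

lemma weight_mult:
  assumes "weight i c F" "weight i d G"
  shows "weight i (c + d) (\<lambda>z w. F z w * G z w)"
proof -
  have F: "polynomial2 F" "\<And>z w. z $ i * pdz i F z w - w $ i * pdw i F z w = c * F z w"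
    and G: "polynomial2 G" "\<And>z w. z $ i * pdz i G z w - w $ i * pdw i G z w = d * G z w"
    using assms by (auto simp: weight_def)
  have "z $ i * pdz i (\<lambda>z w. F z w * G z w) z w - w $ i * pdw i (\<lambda>z w. F z w * G z w) z w =
    (z $ i * pdz i F z w - w $ i * pdw i F z w) * G z w + F z w * (z $ i * pdz i G z w - w $ i * pdw i G z w)" for z w
    by (simp add: pdz_mult pdw_mult F(1) G(1) algebra_simps)
  then show ?thesis unfolding weight_def F(2) G(2) using F(1) G(1) by (auto simp: algebra_simps)
qed

lemma weight_power: "weight i c F \<Longrightarrow> weight i (of_nat k * c) (\<lambda>z w. F z w ^ k)"
proof (induction k)
  case (Suc k)
  then show ?case using weight_mult[of i c F "of_nat k * c" "\<lambda>z w. F z w ^ k"] by (simp add: algebra_simps)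
qed (use weight_const[of i 1] in simp)

lemma weight_prod:
  "finite S \<Longrightarrow> (\<And>s. s \<in> S \<Longrightarrow> weight i (c s) (F s)) \<Longrightarrow> weight i (\<Sum>s\<in>S. c s) (\<lambda>z w. \<Prod>s\<in>S. F s z w)"
proof (induction S rule: finite_induct)
  case (insert x S)
  then show ?case using weight_mult[of i "c x" "F x" "\<Sum>s\<in>S. c s" "\<lambda>z w. \<Prod>s\<in>S. F s z w"] by simp
qed (use weight_const[of i 1] in simp)

lemma weight_pcnj:
  assumes "weight i c F"
  shows "weight i (- cnj c) (pcnj F)"
proof -
  have F: "polynomial2 F" "\<And>z w. z $ i * pdz i F z w - w $ i * pdw i F z w = c * F z w"
    using assms by (auto simp: weight_def)
  have "z $ i * pdz i (pcnj F) z w - w $ i * pdw i (pcnj F) z w = - cnj c * pcnj F z w" for z w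
    using arg_cong[OF F(2)[of "vcnj w" "vcnj z"], of "\<lambda>x. - cnj x"]
    by (simp add: pdz_pcnj pdw_pcnj F(1)) (simp add: pcnj_def)
  then show ?thesis using F by (auto simp: weight_def)
qed

section \<open>An orthogonal family of harmonics of bidegree (p, 1)\<close>

definition zmono :: "('n \<Rightarrow> nat) \<Rightarrow> 'n::finite bifun" where
  "zmono \<gamma> z w = (\<Prod>i\<in>UNIV. (z $ i) ^ \<gamma> i)"

lemma weight_zmono: "weight i (of_nat (\<gamma> i)) (zmono \<gamma>)"
proof -
  have "weight i (\<Sum>j\<in>UNIV. of_nat (\<gamma> j) * (if i = j then 1 else 0)) (zmono \<gamma>)"
    unfolding zmono_def[abs_def] by (intro weight_prod weight_power weight_fst) simp
  then show ?thesis by (simp add: if_distrib[of "(*) _"] cong: if_cong)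
qed

lemma polynomial2_zmono [intro]: "polynomial2 (zmono \<gamma>)"
  using weight_zmono[of undefined \<gamma>] by (simp add: weight_def)

lemma pdw_zmono [simp]: "pdw i (zmono \<gamma>) = (\<lambda>z w. 0)"
  by (simp add: pdw_def zmono_def fun_eq_iff)

definition quad :: "'n \<Rightarrow> 'n::finite bifun" where
  "quad i z w = z $ i * w $ i"

lemma polynomial2_quad [intro]: "polynomial2 (quad i)"
  unfolding quad_def[abs_def] by auto

text \<open>Only the i-th term survives: \<open>pdw i\<close> removes the factor w_i, and the
  remaining monomial has degree \<gamma> i + 1 in z_i, so \<open>pdz i\<close> produces that
  factor.\<close>

lemma lap2_zmono_quad: "lap2 (\<lambda>z w. zmono \<gamma> z w * quad i z w) z w = of_nat (\<gamma> i + 1) * zmono \<gamma> z w"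
proof -
  have "pdw j (quad i) = (\<lambda>z w. if j = i then z $ i else 0)" for j
    by (auto simp: quad_def[abs_def] pdw_mult polynomial2_fst polynomial2_snd fun_eq_iff)
  then have "pdw j (\<lambda>z w. zmono \<gamma> z w * quad i z w) = (\<lambda>z w. if j = i then zmono \<gamma> z w * z $ i else 0)" for j
    by (auto simp: pdw_mult polynomial2_zmono polynomial2_quad fun_eq_iff)
  then have "lap2 (\<lambda>z w. zmono \<gamma> z w * quad i z w) z w = pdz i (\<lambda>z w. zmono \<gamma> z w * z $ i) z w"
    unfolding lap2_def by (subst sum.mono_neutral_right[of _ "{i}"]) auto
  also have "\<dots> = zmono \<gamma> z w + z $ i * pdz i (zmono \<gamma>) z w"
    by (simp add: pdz_mult polynomial2_zmono polynomial2_fst)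
  also have "z $ i * pdz i (zmono \<gamma>) z w = of_nat (\<gamma> i) * zmono \<gamma> z w"
    using weight_zmono[of i \<gamma>] by (simp add: weight_def)
  finally show ?thesis by (simp add: algebra_simps)
qed

text \<open>For \<open>g = (\<partial>\<^sub>bz\<^sup>\<alpha>, -\<partial>\<^sub>az\<^sup>\<alpha>)\<close> with \<open>\<alpha> = \<gamma> + e\<^sub>a + e\<^sub>b\<close> the divergence vanishes, so
  \<open>g\<^sub>a w\<^sub>a + g\<^sub>b w\<^sub>b\<close> is harmonic.\<close>

definition zharm :: "'n \<Rightarrow> 'n \<Rightarrow> ('n \<Rightarrow> nat) \<Rightarrow> 'n::finite bifun" where
  "zharm a b \<gamma> z w = of_nat (\<gamma> b + 1) * (zmono \<gamma> z w * quad a z w) +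
     (- of_nat (\<gamma> a + 1)) * (zmono \<gamma> z w * quad b z w)"

lemma polynomial2_zharm: "polynomial2 (zharm a b \<gamma>)"
  unfolding zharm_def[abs_def]
  by (intro polynomial2_add polynomial2_mult polynomial2_const polynomial2_zmono polynomial2_quad)

lemma lap2_zharm: "lap2 (zharm a b \<gamma>) z w = 0"
proof -
  have p: "polynomial2 (\<lambda>z w. zmono \<gamma> z w * quad i z w)" "polynomial2 (\<lambda>z w. c * (zmono \<gamma> z w * quad i z w))" for i c
    by (intro polynomial2_mult polynomial2_const polynomial2_zmono polynomial2_quad)+
  show ?thesis
    unfolding zharm_def[abs_def] lap2_add[OF p(2) p(2)] lap2_cmult[OF p(1)] lap2_zmono_quad
    by (simp add: algebra_simps)
qed

lemma bihomogeneous_zharm: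
  assumes "(\<Sum>i\<in>UNIV. \<gamma> i) = d"
  shows "bihomogeneous (Suc d) 1 (zharm a b \<gamma>)"
proof -
  have "(\<Prod>i\<in>UNIV. t ^ \<gamma> i) = t ^ d" for t :: complex
    using assms by (simp add: power_sum[symmetric])
  then have "zmono \<gamma> (t *s z) (u *s w) = t ^ d * zmono \<gamma> z w" for t u z w
    by (simp add: zmono_def power_mult_distrib prod.distrib)
  then show ?thesis
    unfolding bihomogeneous_def zharm_def quad_def by (simp add: algebra_simps)
qed

lemma weight_zharm: "weight i (of_nat (\<gamma> i)) (zharm a b \<gamma>)"
proof -
  have q: "weight i 0 (quad j)" for j
    using weight_mult[OF weight_fst weight_snd, of i j j] unfolding quad_def[abs_def] by (simp split: if_splits)
  have "weight i (0 + (of_nat (\<gamma> i) + 0)) (\<lambda>z w. c * (zmono \<gamma> z w * quad j z w))" for c j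
    by (intro weight_mult weight_const weight_zmono q)
  then show ?thesis unfolding zharm_def[abs_def] by (intro weight_add) simp_all
qed

text \<open>In a coordinate i where the exponents differ, the product of one polynomial with the
  conjugate of the other has the nonzero weight \<gamma> i - \<delta> i, so it integrates to
  0.\<close>

lemma cinner_zharm_eq_0:
  assumes "\<gamma> \<in> exponents d" "\<delta> \<in> exponents d" "\<gamma> \<noteq> \<delta>"
  shows "cinner (poly_class (zharm a b \<gamma>)) (poly_class (zharm a b \<delta>)) = 0"
proof -
  obtain i where i: "\<gamma> i \<noteq> \<delta> i" using assms(3) by auto
  have "weight i (of_nat (\<gamma> i) + - cnj (of_nat (\<delta> i))) (\<lambda>z w. zharm a b \<gamma> z w * pcnj (zharm a b \<delta>) z w)"
    by (intro weight_mult weight_pcnj weight_zharm)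
  then have "ball_integral 2 (\<lambda>z w. zharm a b \<gamma> z w * pcnj (zharm a b \<delta>) z w) = 0"
    unfolding weight_def
    by (elim conjE, intro ball_integral_torus_weight[where i=i and c="of_nat (\<gamma> i) + - cnj (of_nat (\<delta> i))"])
       (assumption, erule allE, erule allE, assumption, use i in simp)
  then show ?thesis
    using assms
    by (intro cinner_poly_class_eq_0[OF polynomial2_zharm bihomogeneous_zharm polynomial2_zharm bihomogeneous_zharm])
       (auto simp: exponents_def)
qed

lemma poly_class_zharm_nonzero:
  fixes a b :: "'n::finite"
  assumes "\<gamma> \<in> exponents d" "a \<noteq> b"
  shows "poly_class (zharm a b \<gamma>) \<noteq> 0"
proof
  assume 0: "poly_class (zharm a b \<gamma>) = 0"
  \<comment> \<open>Making coordinate a large prevents cancellation: the two terms of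
    \<open>zharm\<close> carry (\<gamma> b + 1) (\<gamma> a + 2)^2 and \<gamma> a + 1, and the first
    is strictly larger.\<close>
  define z :: "complex ^ 'n" where "z = (\<chi> i. of_nat (if i = a then \<gamma> a + 2 else 1))"
  have z: "z $ i \<noteq> 0" for i by (simp add: z_def del: of_nat_add)
  have "zharm a b \<gamma> z (vcnj z) = 0"
    by (rule poly_class_eq_0_imp[OF polynomial2_zharm bihomogeneous_zharm 0]) (use assms in \<open>simp add: exponents_def\<close>)
  moreover have "zharm a b \<gamma> z (vcnj z) =
      zmono \<gamma> z (vcnj z) * of_nat ((\<gamma> b + 1) * (\<gamma> a + 2)\<^sup>2) - zmono \<gamma> z (vcnj z) * of_nat (\<gamma> a + 1)"
    using assms(2) by (simp add: zharm_def quad_def z_def power2_eq_square algebra_simps)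
  moreover have "zmono \<gamma> z (vcnj z) \<noteq> 0" using z by (simp add: zmono_def)
  ultimately have "(of_nat ((\<gamma> b + 1) * (\<gamma> a + 2)\<^sup>2) :: complex) = of_nat (\<gamma> a + 1)" by simp
  then have "(\<gamma> b + 1) * (\<gamma> a + 2)\<^sup>2 = \<gamma> a + 1" by (simp only: of_nat_eq_iff)
  moreover have "(\<gamma> b + 1) * (\<gamma> a + 2)\<^sup>2 > \<gamma> a + 1" by (simp add: power2_eq_square algebra_simps)
  ultimately show False by simp
qed

text \<open>Nonzero, pairwise orthogonal classes are independent, so there is one dimension for each
  exponent vector of degree d. The bound n >= 2 supplies two distinct coordinates a and b.\<close>

lemma dim_bidegree_harmonics_ge:
  assumes "CARD('n::finite) \<ge> 2"
  shows "complex_L2.dim (bidegree_harmonics (Suc d) 1 :: 'n sphere_L2 set) \<ge> (d div CARD('n) + 1) ^ (CARD('n) - 1)"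
proof -
  obtain a b :: 'n where ab: "a \<noteq> b"
    using assms by (metis (full_types) UNIV_eq_I card_1_singleton_iff insert_iff numeral_le_one_iff
      One_nat_def semiring_norm(69))
  let ?f = "\<lambda>\<gamma>. poly_class (zharm a b \<gamma>)"
  let ?B = "?f ` exponents d"
  have sub: "?B \<subseteq> bidegree_harmonics (Suc d) 1"
  proof
    fix f assume "f \<in> ?B"
    then obtain \<gamma> where "\<gamma> \<in> exponents d" "f = ?f \<gamma>" by (elim imageE)
    then show "f \<in> bidegree_harmonics (Suc d) 1"
      unfolding bidegree_harmonics_eq
      by (intro CollectI exI[of _ "zharm a b \<gamma>"])
         (simp only: exponents_def mem_Collect_eq polynomial2_zharm bihomogeneous_zharm lap2_zharm simp_thms)
  qed
  have inj: "inj_on ?f (exponents d)"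
  proof (rule inj_onI, rule ccontr)
    fix \<gamma> \<delta> :: "'n \<Rightarrow> nat" assume *: "\<gamma> \<in> exponents d" "\<delta> \<in> exponents d" "?f \<gamma> = ?f \<delta>" "\<gamma> \<noteq> \<delta>"
    then have "cinner (?f \<gamma>) (?f \<gamma>) = 0" using cinner_zharm_eq_0[OF *(1,2,4), of a b] by simp
    then show False using poly_class_zharm_nonzero[OF *(1) ab] by (simp add: cinner_self)
  qed
  have ind: "complex_L2.independent ?B"
  proof (rule independent_orthogonal)
    fix f g assume "f \<in> ?B" "g \<in> ?B" "f \<noteq> g"
    then obtain \<gamma> \<delta> where "\<gamma> \<in> exponents d" "f = ?f \<gamma>" "\<delta> \<in> exponents d" "g = ?f \<delta>" "\<gamma> \<noteq> \<delta>"
      by (elim imageE) auto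
    then show "cinner f g = 0" using cinner_zharm_eq_0[of \<gamma> d \<delta> a b] by simp
  next
    fix f assume "f \<in> ?B"
    then show "f \<noteq> 0" by (elim imageE) (simp only: poly_class_zharm_nonzero[OF _ ab] not_False_eq_True)
  qed
  obtain C :: "'n sphere_L2 set" where C: "finite C" "complex_L2.span C = bidegree_harmonics (Suc d) 1"
    "card C = complex_L2.dim (bidegree_harmonics (Suc d) 1 :: 'n sphere_L2 set)"
    using finite_basis_harmonics[where s="(Suc d, 1)" and 'n='n] unfolding harmonics_def fst_conv snd_conv by metis
  have "(d div CARD('n) + 1) ^ (CARD('n) - 1) \<le> card (exponents d :: ('n \<Rightarrow> nat) set)" by (rule card_exponents_ge)
  also have "\<dots> = card ?B" using inj by (simp add: card_image)
  also have "\<dots> \<le> card C" using complex_L2.independent_span_bound[OF C(1) ind] sub C(2) by simp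
  finally show ?thesis using C(3) by simp
qed

section \<open>Projections and the Green operator\<close>

declare split_paired_All [simp del] split_paired_Ex [simp del]

lemma cinner_span_eq_0:
  assumes "h \<in> complex_L2.span B" "\<And>b. b \<in> B \<Longrightarrow> cinner f b = 0"
  shows "cinner f h = 0"
  using assms(1)
  by (induction rule: complex_L2.span_induct_alt) (auto simp: cinner_add_right cinner_scaleC_right assms(2))

lemma finite_span_projection:
  fixes B :: "'n::finite sphere_L2 set"
  assumes "finite B"
  shows "\<exists>g\<in>complex_L2.span B. \<forall>b\<in>B. cinner (f - g) b = 0"
  using assms
proof (induction B arbitrary: f rule: finite_induct)
  case empty
  show ?case by (intro bexI[of _ 0]) (auto simp: complex_L2.span_zero)
next
  case (insert b B)
  obtain b0 where b0: "b0 \<in> complex_L2.span B" "\<forall>c\<in>B. cinner (b - b0) c = 0" using insert.IH by blast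
  obtain g where g: "g \<in> complex_L2.span B" "\<forall>c\<in>B. cinner (f - g) c = 0" using insert.IH by blast
  \<comment> \<open>A Gram-Schmidt step: d is the part of b orthogonal to B, and g is corrected by t
    d. If d = 0, the quotient t is 0 by convention and \<open>td\<close> still holds.\<close>
  define d where "d = b - b0"
  define t where "t = cinner f d / cinner d d"
  have sub: "complex_L2.span B \<subseteq> complex_L2.span (insert b B)" by (intro complex_L2.span_mono) auto
  have dsp: "d \<in> complex_L2.span (insert b B)"
    unfolding d_def using b0(1) sub complex_L2.span_base[of b "insert b B"]
    by (intro complex_L2.span_diff) auto
  have dB: "cinner d c = 0" if "c \<in> complex_L2.span B" for c
    using cinner_span_eq_0[OF that, of d] b0(2) by (auto simp: d_def)
  have gB: "cinner (f - g) c = 0" if "c \<in> complex_L2.span B" for c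
    using cinner_span_eq_0[OF that, of "f - g"] g(2) by auto
  have td: "t * cinner d d = cinner f d"
    by (cases "d = 0") (auto simp: t_def cinner_self)
  have 1: "cinner (f - (g + scaleC t d)) c = 0" if "c \<in> complex_L2.span B" for c
    using gB[OF that] dB[OF that] by (simp add: cinner_diff_left cinner_add_left cinner_scaleC_left)
  have gd: "cinner g d = 0"
    using dB[OF g(1)] cinner_commute[of g d] by simp
  have 2: "cinner (f - (g + scaleC t d)) d = 0"
    using gd td by (simp add: cinner_diff_left cinner_add_left cinner_scaleC_left)
  have "cinner (f - (g + scaleC t d)) b = 0"
    using 1[OF b0(1)] 2 by (simp add: d_def cinner_diff_right)
  moreover have "g + scaleC t d \<in> complex_L2.span (insert b B)"
    using g(1) sub dsp by (intro complex_L2.span_add complex_L2.span_scale) auto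
  ultimately show ?case
    using 1[OF complex_L2.span_base] by (intro bexI[of _ "g + scaleC t d"]) auto
qed

section \<open>Orthogonal projections and the expansion into harmonics\<close>

definition proj :: "nat \<times> nat \<Rightarrow> 'n::finite sphere_L2 \<Rightarrow> 'n sphere_L2" where
  "proj s f = (THE g. g \<in> harmonics s \<and> (\<forall>h\<in>harmonics s. cinner (f - g) h = 0))"

lemma proj_unique_aux:
  assumes "g \<in> harmonics s" "\<And>h. h \<in> harmonics s \<Longrightarrow> cinner (f - g) h = 0"
    and "g' \<in> harmonics s" "\<And>h. h \<in> harmonics s \<Longrightarrow> cinner (f - g') h = 0"
  shows "g' = g"
proof -
  have "g - g' \<in> harmonics s" using assms by (intro complex_L2.subspace_diff subspace_harmonics)
  then have "cinner (f - g') (g - g') - cinner (f - g) (g - g') = 0" using assms by simp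
  then have "cinner (g - g') (g - g') = 0" by (simp add: cinner_diff_left)
  then show ?thesis by (simp add: cinner_self)
qed

lemma proj_exists:
  fixes f :: "'n::finite sphere_L2"
  shows "\<exists>g\<in>harmonics s. \<forall>h\<in>harmonics s. cinner (f - g) h = 0"
proof -
  obtain B :: "'n sphere_L2 set" where B: "finite B" "complex_L2.span B = harmonics s"
    by (rule finite_basis_harmonics)
  show ?thesis
    using finite_span_projection[OF B(1), of f] cinner_span_eq_0[of _ B] B(2) by metis
qed

lemma
  fixes f :: "'n::finite sphere_L2"
  shows proj_in_harmonics: "proj s f \<in> harmonics s"
    and proj_orthogonal: "h \<in> harmonics s \<Longrightarrow> cinner (f - proj s f) h = 0"
proof -
  have "\<exists>!g. g \<in> harmonics s \<and> (\<forall>h\<in>harmonics s. cinner (f - g) h = 0)"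
    using proj_exists[where s=s and f=f] proj_unique_aux[where s=s and f=f] by blast
  from theI'[OF this] show "proj s f \<in> harmonics s" "h \<in> harmonics s \<Longrightarrow> cinner (f - proj s f) h = 0"
    unfolding proj_def by blast+
qed

lemma proj_unique:
  assumes "g \<in> harmonics s" "\<And>h. h \<in> harmonics s \<Longrightarrow> cinner (f - g) h = 0"
  shows "proj s f = g"
  using assms proj_in_harmonics proj_orthogonal by (rule proj_unique_aux)

lemma proj_add: "proj s (f + g) = proj s f + proj s g"
proof (rule proj_unique)
  show "proj s f + proj s g \<in> harmonics s"
    by (intro complex_L2.subspace_add subspace_harmonics proj_in_harmonics)
  fix h :: "'a sphere_L2" assume h: "h \<in> harmonics s"
  have "f + g - (proj s f + proj s g) = (f - proj s f) + (g - proj s g)" by simp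
  then show "cinner (f + g - (proj s f + proj s g)) h = 0"
    using proj_orthogonal[OF h] by (simp only: cinner_add_left) simp
qed

lemma proj_scaleC: "proj s (scaleC c f) = scaleC c (proj s f)"
proof (rule proj_unique)
  show "scaleC c (proj s f) \<in> harmonics s"
    by (intro complex_L2.subspace_scale subspace_harmonics proj_in_harmonics)
  fix h :: "'a sphere_L2" assume h: "h \<in> harmonics s"
  then show "cinner (scaleC c f - scaleC c (proj s f)) h = 0"
    using proj_orthogonal[OF h, of f]
    by (simp add: complex_L2.scale_right_diff_distrib[symmetric] cinner_scaleC_left)
qed

lemma proj_diff: "proj s (f - g) = proj s f - proj s g"
  using proj_add[of s "f - g" g] by simp

lemma proj_zero [simp]: "proj s 0 = 0"
  using proj_scaleC[of s 0 0] by simp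

lemma proj_sum: "proj s (\<Sum>i\<in>I. f i) = (\<Sum>i\<in>I. proj s (f i))"
  by (induction I rule: infinite_finite_induct) (auto simp: proj_add)

lemma proj_same: "f \<in> harmonics s \<Longrightarrow> proj s f = f"
  by (rule proj_unique) auto

lemma proj_other: "f \<in> harmonics t \<Longrightarrow> s \<noteq> t \<Longrightarrow> proj s f = 0"
  by (rule proj_unique) (auto simp: complex_L2.subspace_0[OF subspace_harmonics] harmonics_orthogonal)

lemma cinner_proj: "h \<in> harmonics s \<Longrightarrow> cinner f h = cinner (proj s f) h"
  using proj_orthogonal[of h s f] by (simp add: cinner_diff_left)

lemma norm_sum_harmonics:
  assumes "finite S" "\<And>s. a s \<in> harmonics s"
  shows "(norm (\<Sum>s\<in>S. a s))\<^sup>2 = (\<Sum>s\<in>S. (norm (a s))\<^sup>2)"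
proof (rule norm_sum_Pythagorean[OF assms(1)])
  show "pairwise (\<lambda>s t. orthogonal (a s) (a t)) S"
    using harmonics_orthogonal[OF assms(2) assms(2)]
    unfolding pairwise_def orthogonal_def inner_eq_Re_cinner by simp
qed

lemma bessel:
  assumes "finite S"
  shows "(\<Sum>s\<in>S. (norm (proj s f))\<^sup>2) \<le> (norm f)\<^sup>2"
proof -
  let ?g = "\<Sum>s\<in>S. proj s f"
  have "cinner f ?g = (\<Sum>s\<in>S. of_real ((norm (proj s f))\<^sup>2))"
    by (simp add: cinner_sum_right cinner_proj[OF proj_in_harmonics, of f] cinner_self)
  then have "inner f ?g = (norm ?g)\<^sup>2"
    by (simp add: inner_eq_Re_cinner norm_sum_harmonics[OF assms proj_in_harmonics])
  then have "(norm (f - ?g))\<^sup>2 = (norm f)\<^sup>2 - (norm ?g)\<^sup>2"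
    by (simp add: power2_norm_eq_inner inner_diff_left inner_diff_right inner_commute)
  then have "(norm ?g)\<^sup>2 \<le> (norm f)\<^sup>2"
    by (metis diff_ge_0_iff_ge zero_le_power2)
  then show ?thesis by (simp add: norm_sum_harmonics[OF assms proj_in_harmonics])
qed

text \<open>By Pythagoras the squared distance of two nested partial sums is the difference of the
  sums of squares, which converge. The partial sums are therefore Cauchy over finite sets of
  indices, and completeness gives the limit.\<close>

lemma harmonics_summable:
  fixes a :: "nat \<times> nat \<Rightarrow> 'n::finite sphere_L2"
  assumes a: "\<And>s. a s \<in> harmonics s" and bound: "\<And>S. finite S \<Longrightarrow> (\<Sum>s\<in>S. (norm (a s))\<^sup>2) \<le> M"
  shows "a summable_on UNIV"
proof -
  have "(\<lambda>s. (norm (a s))\<^sup>2) summable_on UNIV"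
    using bound by (intro nonneg_bdd_above_summable_on bdd_aboveI[of _ M]) auto
  then obtain L where L: "((\<lambda>s. (norm (a s))\<^sup>2) has_sum L) UNIV" by (auto simp: summable_on_def)
  have "\<exists>P. eventually P (finite_subsets_at_top UNIV) \<and>
      (\<forall>F F'. P F \<and> P F' \<longrightarrow> dist (sum a F) (sum a F') < e)" if "e > 0" for e
  proof -
    \<comment> \<open>Halving the square of e/2 leaves room for a strict inequality: every larger
      finite set stays closer than e/2, and any two of them closer than e.\<close>
    obtain F0 where F0: "finite F0" "dist (\<Sum>s\<in>F0. (norm (a s))\<^sup>2) L \<le> (e/2)\<^sup>2 / 2"
      using has_sum_finite_approximation[OF L, of "(e/2)\<^sup>2 / 2"] \<open>e > 0\<close> by auto
    have "(e/2)\<^sup>2 / 2 < (e/2)\<^sup>2" using \<open>e > 0\<close> by simp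
    have near: "dist (sum a F) (sum a F0) < e / 2" if F: "finite F" "F0 \<subseteq> F" for F
    proof -
      have "(dist (sum a F) (sum a F0))\<^sup>2 = (norm (\<Sum>s\<in>F - F0. a s))\<^sup>2"
        using F by (simp add: dist_norm sum_diff)
      also have "\<dots> = (\<Sum>s\<in>F. (norm (a s))\<^sup>2) - (\<Sum>s\<in>F0. (norm (a s))\<^sup>2)"
        unfolding norm_sum_harmonics[OF finite_Diff[OF F(1)] a] using F by (simp add: sum_diff)
      also have "\<dots> \<le> L - (\<Sum>s\<in>F0. (norm (a s))\<^sup>2)"
        using finite_sum_le_has_sum[OF L F(1)] by simp
      also have "\<dots> < (e/2)\<^sup>2" using F0(2) \<open>(e/2)\<^sup>2 / 2 < (e/2)\<^sup>2\<close> unfolding dist_real_def by linarith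
      finally show ?thesis by (rule power2_less_imp_less) (use \<open>e > 0\<close> in simp)
    qed
    have "eventually (\<lambda>F. finite F \<and> F0 \<subseteq> F) (finite_subsets_at_top UNIV)"
      using F0(1) by (auto simp: eventually_finite_subsets_at_top)
    moreover have "dist (sum a F) (sum a F') < e" if "finite F \<and> F0 \<subseteq> F" "finite F' \<and> F0 \<subseteq> F'" for F F'
      using near[of F] near[of F'] that dist_triangle_half_l[of "sum a F" "sum a F0" e "sum a F'"]
      by (auto simp: dist_commute)
    ultimately show ?thesis by blast
  qed
  then have "cauchy_filter (filtermap (sum a) (finite_subsets_at_top UNIV))"
    by (simp add: cauchy_filter_metric_filtermap)
  moreover have "complete (UNIV :: 'n sphere_L2 set)"
    by (meson Cauchy_convergent UNIV_I complete_def convergent_def)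
  ultimately obtain L' where "(sum a \<longlongrightarrow> L') (finite_subsets_at_top UNIV)"
    using complete_uniform[where S="UNIV :: 'n sphere_L2 set"] by (force simp add: filterlim_def)
  then show ?thesis using summable_on_def has_sum_def by blast
qed

lemma has_sum_inner:
  fixes a :: "'i \<Rightarrow> 'b::real_inner"
  assumes "(a has_sum f) A"
  shows "((\<lambda>s. inner (a s) h) has_sum inner f h) A"
proof -
  have "((\<lambda>x. inner x h) \<circ> a has_sum inner f h) A"
    by (rule has_sum_comm_additive_general[OF _ _ assms]) (auto simp: inner_sum_left intro!: tendsto_intros)
  then show ?thesis by (simp add: o_def)
qed

text \<open>Pairing the series with h in \<open>harmonics s\<close> leaves only the term a s.
  Applying this also to \<i> h upgrades the real pairing to the complex one.\<close>

lemma proj_has_sum: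
  fixes a :: "nat \<times> nat \<Rightarrow> 'n::finite sphere_L2"
  assumes a: "\<And>s. a s \<in> harmonics s" and sum: "(a has_sum f) UNIV"
  shows "proj s f = a s"
proof (rule proj_unique[OF a])
  have inner: "inner f h = inner (a s) h" if h: "h \<in> harmonics s" for h
  proof -
    have "((\<lambda>t. inner (a t) h) has_sum inner f h) UNIV" by (rule has_sum_inner[OF sum])
    moreover have "((\<lambda>t. inner (a t) h) has_sum inner (a s) h) UNIV"
    proof -
      have "((\<lambda>t. inner (a t) h) has_sum inner (a s) h) {s}" by (rule has_sum_finiteI) auto
      then show ?thesis
        by (rule has_sum_cong_neutral[THEN iffD1, rotated -1])
           (use harmonics_orthogonal[OF a h] in \<open>auto simp: inner_eq_Re_cinner\<close>)
    qed
    ultimately show ?thesis by (rule has_sum_unique)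
  qed
  fix h :: "'n sphere_L2" assume h: "h \<in> harmonics s"
  then have "scaleC \<i> h \<in> harmonics s" by (intro complex_L2.subspace_scale subspace_harmonics)
  then show "cinner (f - a s) h = 0"
    unfolding cinner_eq_Complex using inner h by (simp add: inner_diff_left complex_eq_iff)
qed

text \<open>Bessel's inequality makes the series converge to some g with the same projections as f;
  then f - g is orthogonal to all harmonics and vanishes by totality.\<close>

lemma harmonics_expansion: "((\<lambda>s. proj s f) has_sum f) UNIV"
proof -
  have "(\<lambda>s. proj s f) summable_on UNIV"
    by (rule harmonics_summable[OF proj_in_harmonics bessel])
  then obtain g where g: "((\<lambda>s. proj s f) has_sum g) UNIV" by (auto simp: summable_on_def)
  have "f - g = 0"
  proof (rule harmonics_total)
    fix s h assume h: "h \<in> (harmonics s :: 'a sphere_L2 set)"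
    have "proj s g = proj s f" by (rule proj_has_sum[OF proj_in_harmonics g])
    then have "cinner (f - g) h = 0" by (simp add: cinner_proj[OF h, of "f - g"] proj_diff)
    then show "cinner h (f - g) = 0" using cinner_commute[of h "f - g"] by simp
  qed
  with g show ?thesis by simp
qed

text \<open>This reduces identities between operators to scalar identities in each
  component.\<close>

lemma proj_eqI: "(\<And>s. proj s f = proj s g) \<Longrightarrow> f = g"
  using harmonics_expansion[of f] harmonics_expansion[of g] has_sum_unique by fastforce

section \<open>The Kohn Laplacian in components\<close>

definition ev :: "'n::finite itself \<Rightarrow> nat \<times> nat \<Rightarrow> real" where
  "ev T s = kohn_eigenvalue T (fst s) (snd s)"

lemma ev_eq: "ev TYPE('n::finite) (p, q) = 2 * real (q * (p + CARD('n) - 1))"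
proof -
  have "real (p + CARD('n) - 1) = real p + real CARD('n) - 1"
    using zero_less_card_finite[where 'a='n] by (simp add: of_nat_diff Suc_leI trans_le_add2)
  then show ?thesis by (simp add: ev_def kohn_eigenvalue_def)
qed

text \<open>For n >= 2 the factor p + n - 1 is positive, so the eigenvalue vanishes only through
  q.\<close>

lemma ev_eq_0_iff: "CARD('n::finite) \<ge> 2 \<Longrightarrow> ev TYPE('n) s = 0 \<longleftrightarrow> snd s = 0"
  by (cases s) (auto simp: ev_eq)

text \<open>A nonzero value of \<open>ev\<close> is twice a positive integer, and inverse 0 = 0. The
  bound lets Bessel's inequality control the series for the Green operator.\<close>

lemma inverse_ev_le_1: "0 \<le> inverse (ev TYPE('n::finite) s) \<and> inverse (ev TYPE('n) s) \<le> 1"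
proof (cases s)
  case (Pair p q)
  let ?k = "q * (p + CARD('n) - 1)"
  show ?thesis
  proof (cases "?k = 0")
    case False
    have *: "0 \<le> inverse (2 * x) \<and> inverse (2 * x) \<le> 1" if "x \<ge> 1" for x :: real
      using that by (simp add: inverse_eq_divide divide_le_eq)
    from False have "real ?k \<ge> 1" by linarith
    then show ?thesis unfolding Pair ev_eq by (rule *)
  next
    case True
    show ?thesis unfolding Pair ev_eq True by simp
  qed
qed

text \<open>The components F in the graph are forced to be the projections of f, by
  \<open>proj_has_sum\<close>. Conversely, expanding both f and g supplies the two convergent
  series.\<close>

lemma kohn_laplacian_iff:
  "(f, g) \<in> kohn_laplacian \<longleftrightarrow> (\<forall>s. proj s g = ev TYPE('n::finite) s *\<^sub>R proj s (f :: 'n sphere_L2))"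
proof
  assume "(f, g) \<in> kohn_laplacian"
  then obtain F where F: "\<And>p q. F (p, q) \<in> bidegree_harmonics p q" "(F has_sum f) UNIV"
    "((\<lambda>(p, q). kohn_eigenvalue TYPE('n) p q *\<^sub>R F (p, q)) has_sum g) UNIV"
    by (auto simp: kohn_laplacian_def)
  have Fs: "F s \<in> harmonics s" for s using F(1) by (cases s) (simp add: harmonics_def)
  have "proj s f = F s" for s by (rule proj_has_sum[OF Fs F(2)])
  moreover have "proj s g = ev TYPE('n) s *\<^sub>R F s" for s
  proof (rule proj_has_sum)
    show "ev TYPE('n) s *\<^sub>R F s \<in> harmonics s" for s
      unfolding scaleC_of_real[symmetric] by (intro complex_L2.subspace_scale subspace_harmonics Fs)
    show "((\<lambda>s. ev TYPE('n) s *\<^sub>R F s) has_sum g) UNIV"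
      using F(3) by (simp add: ev_def case_prod_unfold)
  qed
  ultimately show "\<forall>s. proj s g = ev TYPE('n) s *\<^sub>R proj s f" by simp
next
  assume *: "\<forall>s. proj s g = ev TYPE('n) s *\<^sub>R proj s f"
  have "(\<lambda>(p, q). kohn_eigenvalue TYPE('n) p q *\<^sub>R proj (p, q) f) = (\<lambda>s. proj s g)"
    using * by (auto simp: ev_def)
  then have "((\<lambda>(p, q). kohn_eigenvalue TYPE('n) p q *\<^sub>R proj (p, q) f) has_sum g) UNIV"
    using harmonics_expansion[of g] by simp
  then show "(f, g) \<in> kohn_laplacian"
    unfolding kohn_laplacian_def using harmonics_expansion[of f] proj_in_harmonics[of _ f]
    by (auto simp: harmonics_def intro!: exI[of _ "\<lambda>s. proj s f"])
qed

section \<open>The Green operator for n >= 2 and its eigenspaces\<close>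

context
  assumes n: "CARD('n::finite) \<ge> 2"
begin

lemma kohn_kernel_iff: "f \<in> kohn_kernel \<longleftrightarrow> (\<forall>s. snd s \<noteq> 0 \<longrightarrow> proj s (f :: 'n sphere_L2) = 0)"
  by (simp add: kohn_kernel_def kohn_laplacian_iff ev_eq_0_iff[OF n] eq_commute[of 0] del: neq0_conv) metis

lemma harmonics_kernel: "snd s = 0 \<Longrightarrow> h \<in> harmonics s \<Longrightarrow> h \<in> (kohn_kernel :: 'n sphere_L2 set)"
  by (auto simp: kohn_kernel_iff intro: proj_other)

text \<open>In one direction f is tested against its own components with q = 0, which lie in the
  kernel. In the other, the expansion of f pairs to 0 term by term with every kernel
  element.\<close>

lemma orthogonal_complement_kernel_iff:
  "f \<in> orthogonal_complement kohn_kernel \<longleftrightarrow> (\<forall>s. snd s = 0 \<longrightarrow> proj s (f :: 'n sphere_L2) = 0)"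
proof
  assume f: "f \<in> orthogonal_complement kohn_kernel"
  show "\<forall>s. snd s = 0 \<longrightarrow> proj s f = 0"
  proof (intro allI impI)
    fix s :: "nat \<times> nat" assume "snd s = 0"
    then have "proj s f \<in> kohn_kernel" by (intro harmonics_kernel[of s] proj_in_harmonics)
    then have "cinner f (proj s f) = 0" using f by (auto simp: orthogonal_complement_def)
    then show "proj s f = 0" by (simp add: cinner_proj[OF proj_in_harmonics, of f] cinner_self)
  qed
next
  assume f: "\<forall>s. snd s = 0 \<longrightarrow> proj s f = 0"
  have inner: "inner f g = 0" if g: "g \<in> kohn_kernel" for g
  proof -
    have "inner (proj s f) g = 0" for s
    proof (cases "snd s = 0")
      case False
      then have "proj s g = 0" using g by (simp add: kohn_kernel_iff)
      then have "cinner g (proj s f) = 0" by (simp add: cinner_proj[OF proj_in_harmonics, of g])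
      then show ?thesis using cinner_commute[of g "proj s f"] by (simp add: inner_eq_Re_cinner)
    qed (use f in simp)
    then have "((\<lambda>s. 0) has_sum inner f g) (UNIV :: (nat \<times> nat) set)"
      using has_sum_inner[OF harmonics_expansion[of f], of g] by simp
    then show ?thesis using has_sum_unique has_sum_0_simp by blast
  qed
  show "f \<in> orthogonal_complement kohn_kernel"
    unfolding orthogonal_complement_def
  proof (intro CollectI ballI)
    fix g :: "'n sphere_L2" assume g: "g \<in> kohn_kernel"
    then have "scaleC \<i> g \<in> kohn_kernel" by (simp add: kohn_kernel_iff proj_scaleC)
    then show "cinner f g = 0" using inner g by (simp add: cinner_eq_Complex complex_eq_iff)
  qed
qed

text \<open>Since inverse 0 = 0, the components with q = 0 are sent to 0 without a case
  distinction.\<close>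

definition green_op :: "'n sphere_L2 \<Rightarrow> 'n sphere_L2" where
  "green_op f = infsum (\<lambda>s. inverse (ev TYPE('n) s) *\<^sub>R proj s f) UNIV"

lemma proj_green_op: "proj s (green_op f) = inverse (ev TYPE('n) s) *\<^sub>R proj s f"
proof (rule proj_has_sum[where a="\<lambda>s. inverse (ev TYPE('n) s) *\<^sub>R proj s f"])
  show h: "inverse (ev TYPE('n) s) *\<^sub>R proj s f \<in> harmonics s" for s
    unfolding scaleC_of_real[symmetric] by (intro complex_L2.subspace_scale subspace_harmonics proj_in_harmonics)
  have le: "(norm (inverse (ev TYPE('n) s) *\<^sub>R proj s f))\<^sup>2 \<le> (norm (proj s f))\<^sup>2" for s
    using inverse_ev_le_1[where 'n='n, of s] by (intro power_mono) (auto simp: mult_left_le_one_le)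
  have "(\<lambda>s. inverse (ev TYPE('n) s) *\<^sub>R proj s f) summable_on UNIV"
    by (rule harmonics_summable[OF h]) (use order_trans[OF sum_mono[OF le] bessel] in blast)
  then show "((\<lambda>s. inverse (ev TYPE('n) s) *\<^sub>R proj s f) has_sum green_op f) UNIV"
    unfolding green_op_def by (rule has_sum_infsum)
qed

lemma linear_green_op: "Vector_Spaces.linear scaleC scaleC green_op"
proof -
  have "vector_space (scaleC :: complex \<Rightarrow> 'n sphere_L2 \<Rightarrow> 'n sphere_L2)" ..
  moreover have "green_op (f + g) = green_op f + green_op g" for f g
    by (rule proj_eqI) (simp add: proj_green_op proj_add scaleR_add_right)
  moreover have "green_op (scaleC c f) = scaleC c (green_op f)" for c f
    by (rule proj_eqI) (simp add: proj_green_op proj_scaleC flip: scaleC_of_real)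
  ultimately show ?thesis
    by (simp add: Vector_Spaces.linear_def module_hom_def module_hom_axioms_def vector_space_def
      module_iff_vector_space)
qed

lemma is_complex_green_operator_green_op: "is_complex_green_operator green_op"
  unfolding is_complex_green_operator_def
proof (intro conjI ballI linear_green_op)
  fix f :: "'n sphere_L2" assume f: "f \<in> kohn_kernel"
  show "green_op f = 0"
  proof (rule proj_eqI)
    fix s show "proj s (green_op f) = proj s 0"
      using f by (cases "snd s = 0") (auto simp: proj_green_op kohn_kernel_iff ev_eq_0_iff[OF n, THEN iffD2])
  qed
next
  fix f :: "'n sphere_L2" assume f: "f \<in> orthogonal_complement kohn_kernel"
  then show "green_op f \<in> orthogonal_complement kohn_kernel"
    by (simp add: orthogonal_complement_kernel_iff proj_green_op)
  show "(green_op f, f) \<in> kohn_laplacian"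
    unfolding kohn_laplacian_iff
  proof
    fix s show "proj s f = ev TYPE('n) s *\<^sub>R proj s (green_op f)"
      using f ev_eq_0_iff[OF n, of s]
      by (cases "snd s = 0") (auto simp: orthogonal_complement_kernel_iff proj_green_op)
  qed
qed

lemma is_complex_green_operator_unique:
  fixes G :: "'n sphere_L2 \<Rightarrow> 'n sphere_L2"
  assumes G: "is_complex_green_operator G"
  shows "G = green_op"
proof
  fix f :: "'n sphere_L2"
  have lin: "Vector_Spaces.linear scaleC scaleC G" and ker: "\<And>f. f \<in> kohn_kernel \<Longrightarrow> G f = 0"
    and orth: "\<And>f. f \<in> orthogonal_complement kohn_kernel \<Longrightarrow> G f \<in> orthogonal_complement kohn_kernel"
      "\<And>f. f \<in> orthogonal_complement kohn_kernel \<Longrightarrow> (G f, f) \<in> kohn_laplacian"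
    using G by (auto simp: is_complex_green_operator_def)
  \<comment> \<open>The components with q = 0 sum to f0 in the kernel, and f - f0 lies in its
    orthogonal complement. Linearity and the two defining conditions then determine G f.\<close>
  define a where "a s = (if snd s = 0 then proj s f else 0)" for s
  have a: "a s \<in> harmonics s" for s
    by (auto simp: a_def proj_in_harmonics complex_L2.subspace_0[OF subspace_harmonics])
  have "(\<lambda>s. proj s f) summable_on UNIV" using harmonics_expansion by (auto simp: summable_on_def)
  have le: "(norm (a s))\<^sup>2 \<le> (norm (proj s f))\<^sup>2" for s by (simp add: a_def)
  have "a summable_on UNIV"
    by (rule harmonics_summable[OF a]) (use order_trans[OF sum_mono[OF le] bessel] in blast)
  then obtain f0 where f0: "(a has_sum f0) UNIV" by (auto simp: summable_on_def)
  have pf0: "proj s f0 = a s" for s by (rule proj_has_sum[OF a f0])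
  define f1 where "f1 = f - f0"
  have f0k: "f0 \<in> kohn_kernel" by (simp add: kohn_kernel_iff pf0 a_def)
  have f1k: "f1 \<in> orthogonal_complement kohn_kernel"
    by (simp add: orthogonal_complement_kernel_iff f1_def proj_diff pf0 a_def)
  have "G f = G f1 + G f0"
    using lin unfolding f1_def Vector_Spaces.linear_def module_hom_def module_hom_axioms_def
    by (metis diff_add_cancel)
  then have Gf: "G f = G f1" using ker[OF f0k] by simp
  show "G f = green_op f"
  proof (rule proj_eqI)
    fix s
    show "proj s (G f) = proj s (green_op f)"
    proof (cases "snd s = 0")
      case True
      then show ?thesis using orth(1)[OF f1k] ev_eq_0_iff[OF n, of s]
        by (simp add: Gf orthogonal_complement_kernel_iff proj_green_op)
    next
      case False
      then have "ev TYPE('n) s \<noteq> 0" using ev_eq_0_iff[OF n, of s] by simp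
      moreover have "proj s f1 = ev TYPE('n) s *\<^sub>R proj s (G f1)" using orth(2)[OF f1k] by (simp add: kohn_laplacian_iff)
      moreover have "proj s f1 = proj s f" using False by (simp add: f1_def proj_diff pf0 a_def)
      ultimately show ?thesis by (simp add: Gf proj_green_op)
    qed
  qed
qed

lemma complex_green_operator_eq: "complex_green_operator = green_op"
  unfolding complex_green_operator_def
  by (rule the_equality) (auto intro: is_complex_green_operator_green_op is_complex_green_operator_unique)

lemma eigenspace_green_op_iff:
  "f \<in> eigenspace green_op (of_real \<mu>) \<longleftrightarrow> (\<forall>s. inverse (ev TYPE('n) s) \<noteq> \<mu> \<longrightarrow> proj s f = 0)"
proof -
  have "f \<in> eigenspace green_op (of_real \<mu>) \<longleftrightarrow> (\<forall>s. proj s (green_op f) = proj s (scaleC (of_real \<mu>) f))"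
    unfolding eigenspace_def using proj_eqI by auto
  also have "\<dots> \<longleftrightarrow> (\<forall>s. (inverse (ev TYPE('n) s) - \<mu>) *\<^sub>R proj s f = 0)"
    unfolding proj_green_op proj_scaleC unfolding scaleC_of_real scaleR_diff_left right_minus_eq ..
  finally show ?thesis by (auto simp: scaleR_eq_0_iff)
qed

text \<open>The eigenspace is the orthogonal sum of the finitely many \<open>harmonics s\<close>
  with eigenvalue \<mu>, so their bases together form a basis of it. Finiteness of the fibre makes
  the expansion of an eigenvector a finite sum.\<close>

lemma dim_eigenspace_green_op:
  fixes \<mu> :: real
  assumes T: "finite {s. inverse (ev TYPE('n) s) = \<mu>}"
  shows "complex_L2.dim (eigenspace green_op (of_real \<mu>)) =
    (\<Sum>s\<in>{s. inverse (ev TYPE('n) s) = \<mu>}. complex_L2.dim (harmonics s :: 'n sphere_L2 set))"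
proof -
  let ?T = "{s. inverse (ev TYPE('n) s) = \<mu>}"
  have "\<forall>s. \<exists>B :: 'n sphere_L2 set. finite B \<and> complex_L2.independent B \<and> complex_L2.span B = harmonics s \<and>
      B \<subseteq> harmonics s \<and> card B = complex_L2.dim (harmonics s :: 'n sphere_L2 set)"
  proof
    fix s
    obtain B :: "'n sphere_L2 set" where "finite B" "complex_L2.independent B" "complex_L2.span B = harmonics s"
      "B \<subseteq> harmonics s" "card B = complex_L2.dim (harmonics s :: 'n sphere_L2 set)"
      by (rule finite_basis_harmonics)
    then show "\<exists>B :: 'n sphere_L2 set. finite B \<and> complex_L2.independent B \<and> complex_L2.span B = harmonics s \<and>
      B \<subseteq> harmonics s \<and> card B = complex_L2.dim (harmonics s :: 'n sphere_L2 set)" by (intro exI[of _ B] conjI)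
  qed
  from choice[OF this] obtain B :: "nat \<times> nat \<Rightarrow> 'n sphere_L2 set" where
    B': "\<forall>s. finite (B s) \<and> complex_L2.independent (B s) \<and> complex_L2.span (B s) = harmonics s \<and>
      B s \<subseteq> harmonics s \<and> card (B s) = complex_L2.dim (harmonics s :: 'n sphere_L2 set)" ..
  have B: "finite (B s)" "complex_L2.independent (B s)" "complex_L2.span (B s) = harmonics s"
    "B s \<subseteq> harmonics s" "card (B s) = complex_L2.dim (harmonics s :: 'n sphere_L2 set)" for s
    using B'[rule_format, of s] by simp_all
  let ?B = "\<Union>s\<in>?T. B s"
  have disj: "B s \<inter> B t = {}" if "s \<noteq> t" for s t
  proof (rule ccontr)
    assume "B s \<inter> B t \<noteq> {}"
    then obtain b where b: "b \<in> B s" "b \<in> B t" by blast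
    then have "b = 0" using proj_same[of b s] proj_other[of b t s] subsetD[OF B(4)] that by simp
    then show False using b complex_L2.dependent_zero B(2) by blast
  qed
  have "complex_L2.independent ?B"
    unfolding complex_L2.independent_explicit_finite_subsets
  proof (intro allI impI ballI)
    fix S u v assume S: "S \<subseteq> ?B" "finite S" and 0: "(\<Sum>v\<in>S. scaleC (u v) v) = 0" and v: "v \<in> S"
    then obtain s where s: "v \<in> B s" by auto
    \<comment> \<open>Projecting a linear relation to the component s leaves a relation among the
      vectors of B s alone.\<close>
    have "0 = proj s (\<Sum>v\<in>S. scaleC (u v) v)" by (simp add: 0)
    also have "\<dots> = (\<Sum>v\<in>S. scaleC (u v) (proj s v))" by (simp add: proj_sum proj_scaleC)
    also have "\<dots> = (\<Sum>v\<in>S \<inter> B s. scaleC (u v) v)"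
    proof (rule sum.mono_neutral_cong_right[OF S(2)])
      show "\<forall>v\<in>S - S \<inter> B s. scaleC (u v) (proj s v) = 0"
      proof
        fix v assume "v \<in> S - S \<inter> B s"
        then obtain t where "v \<in> B t" "t \<noteq> s" using S(1) by blast
        then have "proj s v = 0" using B(4)[of t] by (intro proj_other[of v t s]) auto
        then show "scaleC (u v) (proj s v) = 0" by simp
      qed
      show "scaleC (u v) (proj s v) = scaleC (u v) v" if "v \<in> S \<inter> B s" for v
        using that B(4)[of s] by (auto simp: proj_same)
    qed auto
    finally have sum0: "(\<Sum>v\<in>S \<inter> B s. scaleC (u v) v) = 0" by (rule sym)
    show "u v = 0"
      by (rule complex_L2.independentD[OF B(2) _ _ sum0]) (use S(2) v s in auto)
  qed
  moreover have "complex_L2.span ?B = eigenspace green_op (of_real \<mu>)"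
  proof (intro subset_antisym subsetI)
    fix f assume "f \<in> complex_L2.span ?B"
    then show "f \<in> eigenspace green_op (of_real \<mu>)"
    proof (induction rule: complex_L2.span_induct_alt)
      case base
      show ?case by (simp add: eigenspace_green_op_iff)
    next
      case (step c x y)
      then obtain s where "x \<in> harmonics s" "inverse (ev TYPE('n) s) = \<mu>" using B(4) by blast
      note s = this
      show ?case
        unfolding eigenspace_green_op_iff
      proof (intro allI impI)
        fix t assume t: "inverse (ev TYPE('n) t) \<noteq> \<mu>"
        then have "proj t y = 0" using step(2) by (simp add: eigenspace_green_op_iff)
        moreover have "proj t x = 0" using s t by (intro proj_other[of x s]) auto
        ultimately show "proj t (scaleC c x + y) = 0" by (simp add: proj_add proj_scaleC)
      qed
    qed
  next
    fix f assume f: "f \<in> eigenspace green_op (of_real \<mu>)"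
    have "((\<lambda>s. proj s f) has_sum (\<Sum>s\<in>?T. proj s f)) UNIV"
    proof -
      have "((\<lambda>s. proj s f) has_sum (\<Sum>s\<in>?T. proj s f)) ?T" using T by (intro has_sum_finiteI) auto
      then show ?thesis
        by (rule has_sum_cong_neutral[THEN iffD1, rotated -1])
           (use f in \<open>simp_all only: eigenspace_green_op_iff Diff_iff mem_Collect_eq not_True_eq_False simp_thms UNIV_I\<close>)
    qed
    with harmonics_expansion have "f = (\<Sum>s\<in>?T. proj s f)" by (rule has_sum_unique)
    also have "\<dots> \<in> complex_L2.span ?B"
    proof (rule complex_L2.span_sum)
      fix s assume "s \<in> ?T"
      then have "complex_L2.span (B s) \<subseteq> complex_L2.span ?B" by (intro complex_L2.span_mono) blast
      then show "proj s f \<in> complex_L2.span ?B" using proj_in_harmonics[of s f] B(3) by blast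
    qed
    finally show "f \<in> complex_L2.span ?B" .
  qed
  ultimately have "complex_L2.dim (eigenspace green_op (of_real \<mu>)) = card ?B"
    by (metis complex_L2.dim_span_eq_card_independent)
  also have "\<dots> = (\<Sum>s\<in>?T. card (B s))"
    using T B(1) disj by (intro card_UN_disjoint) auto
  finally show ?thesis by (simp add: B(5))
qed

end

section \<open>The Schatten sums\<close>

lemma inverse_powr_minus: "x \<ge> 0 \<Longrightarrow> inverse x powr a = x powr (- a)" for x a :: real
  by (simp add: powr_minus inverse_powr)

text \<open>The sequence \<open>index\<close> lists each positive w in increasing order, repeated m
  w times. The condition m 0 = 0 keeps 0 out of the list, and unboundedness makes it
  infinite.\<close>

locale multiplicity_enumeration =
  fixes m :: "nat \<Rightarrow> nat"
  assumes m0: "m 0 = 0" and unbounded: "\<exists>w. k < (\<Sum>v\<le>w. m v)"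
begin

definition cum :: "nat \<Rightarrow> nat" where "cum w = (\<Sum>v\<le>w. m v)"

definition index :: "nat \<Rightarrow> nat" where "index k = (LEAST w. k < cum w)"

lemma cum_mono: "v \<le> w \<Longrightarrow> cum v \<le> cum w"
  unfolding cum_def by (intro sum_mono2) auto

lemma less_cum_index: "k < cum (index k)"
proof -
  have "\<exists>w. k < cum w" using unbounded[of k] by (simp only: cum_def)
  then show ?thesis unfolding index_def by (rule LeastI_ex)
qed

text \<open>This adjunction reduces statements about \<open>index\<close> to comparisons with the
  cumulative counts.\<close>

lemma index_le_iff: "index k \<le> w \<longleftrightarrow> k < cum w"
proof
  assume "index k \<le> w"
  then show "k < cum w" using less_cum_index[of k] cum_mono[of "index k" w] by linarith
next
  assume "k < cum w"
  then show "index k \<le> w" unfolding index_def by (rule Least_le)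
qed

lemma index_mono: "j \<le> k \<Longrightarrow> index j \<le> index k"
  using less_cum_index[of k] by (simp add: index_le_iff)

lemma index_pos: "index k > 0"
  using index_le_iff[of k 0] by (simp add: cum_def m0)

lemma index_fiber: "w > 0 \<Longrightarrow> {k. index k = w} = {cum (w - 1)..<cum w}"
proof -
  assume w: "w > 0"
  have "index k = w \<longleftrightarrow> index k \<le> w \<and> \<not> index k \<le> w - 1" for k using w by linarith
  then have "index k = w \<longleftrightarrow> k < cum w \<and> \<not> k < cum (w - 1)" for k by (simp only: index_le_iff)
  then show ?thesis by (intro set_eqI) (simp add: not_less conj_commute)
qed

lemma cum_Suc: "cum (Suc w) = cum w + m (Suc w)"
  by (simp add: cum_def)

lemma card_index_fiber: "w > 0 \<Longrightarrow> finite {k. index k = w} \<and> card {k. index k = w} = m w"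
  using cum_Suc[of "w - 1"] by (simp add: index_fiber)

lemma sum_index: "(\<Sum>k<cum w. f (index k)) = (\<Sum>v\<le>w. real (m v) * f v)"
proof (induction w)
  case 0
  show ?case by (simp add: cum_def m0)
next
  case (Suc w)
  have "{..<cum (Suc w)} = {..<cum w} \<union> {cum w..<cum (Suc w)}"
    using cum_mono[of w "Suc w"] by auto
  then have "(\<Sum>k<cum (Suc w). f (index k)) = (\<Sum>k<cum w. f (index k)) + (\<Sum>k\<in>{cum w..<cum (Suc w)}. f (index k))"
    by (rule ssubst) (rule sum.union_disjoint; auto)
  also have "(\<Sum>k\<in>{cum w..<cum (Suc w)}. f (index k)) = (\<Sum>k\<in>{cum w..<cum (Suc w)}. f (Suc w))"
  proof (intro sum.cong refl)
    fix k assume "k \<in> {cum w..<cum (Suc w)}"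
    then have "k \<in> {k. index k = Suc w}" using index_fiber[of "Suc w"] by simp
    then show "f (index k) = f (Suc w)" by simp
  qed
  also have "\<dots> = real (m (Suc w)) * f (Suc w)" by (simp add: cum_Suc)
  finally show ?case by (simp add: Suc.IH)
qed

text \<open>Every initial segment of the list lies in one of length \<open>cum w\<close>, and those
  segments regroup by value through \<open>sum_index\<close>.\<close>

lemma summable_index_iff:
  assumes f: "\<And>v. f v \<ge> 0"
  shows "summable (\<lambda>k. f (index k)) \<longleftrightarrow> (\<exists>M. \<forall>w. (\<Sum>v\<le>w. real (m v) * f v) \<le> M)"
proof
  assume s: "summable (\<lambda>k. f (index k))"
  show "\<exists>M. \<forall>w. (\<Sum>v\<le>w. real (m v) * f v) \<le> M"
    by (rule exI[of _ "suminf (\<lambda>k. f (index k))"]) (auto simp: sum_index[symmetric] f intro!: sum_le_suminf[OF s])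
next
  assume "\<exists>M. \<forall>w. (\<Sum>v\<le>w. real (m v) * f v) \<le> M"
  then obtain M where M: "\<And>w. (\<Sum>k<cum w. f (index k)) \<le> M" by (auto simp: sum_index)
  show "summable (\<lambda>k. f (index k))"
  proof (rule summableI_nonneg_bounded)
    fix K
    have "(\<Sum>k<K. f (index k)) \<le> (\<Sum>k<cum (index K). f (index k))"
      using less_cum_index[of K] by (intro sum_mono2) (auto simp: f)
    also have "\<dots> \<le> M" by (rule M)
    finally show "(\<Sum>k<K. f (index k)) \<le> M" .
  qed (rule f)
qed

end

section \<open>Multiplicities grouped by half the Kohn eigenvalue\<close>

definition key :: "'n::finite itself \<Rightarrow> nat \<times> nat \<Rightarrow> nat" where
  "key T s = snd s * (fst s + CARD('n) - 1)"

lemma ev_key: "ev TYPE('n::finite) s = 2 * real (key TYPE('n) s)"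
  by (cases s) (simp add: key_def ev_eq)

definition harmonics_dim :: "'n::finite itself \<Rightarrow> nat \<times> nat \<Rightarrow> nat" where
  "harmonics_dim T s = complex_L2.dim (harmonics s :: 'n sphere_L2 set)"

text \<open>For n >= 2 the key 0 belongs to the kernel, which contributes no positive eigenvalue; it
  therefore gets multiplicity 0.\<close>

definition eigen_mult :: "'n::finite itself \<Rightarrow> nat \<Rightarrow> nat" where
  "eigen_mult T w = (if w = 0 then 0 else \<Sum>s\<in>{s. key T s = w}. harmonics_dim T s)"

definition keyset :: "'n::finite itself \<Rightarrow> nat \<Rightarrow> (nat \<times> nat) set" where
  "keyset T w = (\<Union>v\<in>{1..w}. {s. key T s = v})"

context
  fixes N :: nat
  assumes n: "CARD('n::finite) \<ge> 2" and N: "N = CARD('n)"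
begin

lemma key_ge: "key TYPE('n) (p, q) \<ge> q * (p + 1)"
  unfolding key_def fst_conv snd_conv using n by (intro mult_le_mono2) linarith

lemma key_fiber_subset:
  assumes "w > 0"
  shows "{s. key TYPE('n) s = w} \<subseteq> {..w} \<times> {1..w}"
proof
  fix s assume s: "s \<in> {s. key TYPE('n) s = w}"
  obtain p q where pq: "s = (p, q)" by (cases s)
  have k: "key TYPE('n) (p, q) = w" using s pq by simp
  have q: "q > 0" using k assms by (auto simp: key_def intro: Nat.gr0I)
  have "q * (p + 1) \<le> w" using key_ge[of q p] k by simp
  moreover have "q \<le> q * (p + 1)" "p + 1 \<le> q * (p + 1)"
    using q mult_le_mono1[of 1 q "p + 1"] by simp_all
  ultimately have "q \<le> w" "p + 1 \<le> w" by (blast intro: le_trans)+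
  then show "s \<in> {..w} \<times> {1..w}" using q pq by simp
qed

lemma finite_key_fiber: "w > 0 \<Longrightarrow> finite {s. key TYPE('n) s = w}"
  using key_fiber_subset by (rule finite_subset) auto

lemma harmonics_dim_ge: "real (harmonics_dim TYPE('n) (Suc d, 1)) \<ge> (real (d + 1) / real N) ^ (N - 1)"
proof -
  \<comment> \<open>Rounding down loses less than one unit, so the integer count dominates the real
    quotient (d + 1) / N.\<close>
  have "d < (d div N + 1) * N"
    using n N by (simp add: dividend_less_div_times)
  then have "real (d + 1) \<le> real (d div N + 1) * real N"
    by (metis Suc_eq_plus1 Suc_leI of_nat_le_iff of_nat_mult)
  then have "real (d + 1) / real N \<le> real (d div N + 1)"
    using n N by (simp add: divide_le_eq)
  then have "(real (d + 1) / real N) ^ (N - 1) \<le> real (d div N + 1) ^ (N - 1)"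
    by (intro power_mono) auto
  also have "\<dots> \<le> real (harmonics_dim TYPE('n) (Suc d, 1))"
    using dim_bidegree_harmonics_ge[OF n, of d] unfolding harmonics_dim_def harmonics_def fst_conv snd_conv N
    by (metis of_nat_le_iff of_nat_power)
  finally show ?thesis .
qed

text \<open>The pair (d + 1, 1) has key N + d and a nonzero space of harmonics. Hence infinitely
  many keys occur, as the enumeration requires.\<close>

lemma eigen_mult_pos: "eigen_mult TYPE('n) (N + d) \<ge> 1"
proof -
  have k: "key TYPE('n) (Suc d, 1) = N + d" using N by (simp add: key_def)
  have "harmonics_dim TYPE('n) (Suc d, 1) > 0"
  proof (rule ccontr)
    assume "\<not> harmonics_dim TYPE('n) (Suc d, 1) > 0"
    then have "(real (d + 1) / real N) ^ (N - 1) \<le> 0" using harmonics_dim_ge[of d] by simp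
    moreover have "(real (d + 1) / real N) ^ (N - 1) > 0" using n N by simp
    ultimately show False by simp
  qed
  also have "harmonics_dim TYPE('n) (Suc d, 1) \<le> (\<Sum>s\<in>{s. key TYPE('n) s = N + d}. harmonics_dim TYPE('n) s)"
    using k n N by (intro member_le_sum finite_key_fiber) auto
  finally show ?thesis using n N by (simp add: eigen_mult_def)
qed

interpretation multiplicity_enumeration "eigen_mult TYPE('n)"
proof
  show "eigen_mult TYPE('n) 0 = 0" by (simp add: eigen_mult_def)
  fix k
  have "(\<Sum>v\<le>N + d. eigen_mult TYPE('n) v) > d" for d
  proof (induction d)
    case 0
    have "eigen_mult TYPE('n) N \<le> (\<Sum>v\<le>N. eigen_mult TYPE('n) v)" by (intro member_le_sum) auto
    then show ?case using eigen_mult_pos[of 0] by simp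
  next
    case (Suc d)
    then show ?case using eigen_mult_pos[of "Suc d"] by simp
  qed
  then show "\<exists>w. k < (\<Sum>v\<le>w. eigen_mult TYPE('n) v)" by blast
qed

lemma is_eigenvalue_sequence_green:
  "is_eigenvalue_sequence (complex_green_operator :: 'n sphere_L2 \<Rightarrow> 'n sphere_L2) (\<lambda>k. inverse (2 * real (index k)))"
  unfolding is_eigenvalue_sequence_def complex_green_operator_eq[OF n]
proof (intro conjI allI impI)
  show "decseq (\<lambda>k. inverse (2 * real (index k)))"
    unfolding decseq_def using index_mono index_pos by (auto intro!: le_imp_inverse_le)
  show "0 \<le> inverse (2 * real (index k))" for k by simp
  fix \<mu> :: real assume \<mu>: "\<mu> > 0"
  let ?K = "{k. inverse (2 * real (index k)) = \<mu>}" and ?T = "{s. inverse (ev TYPE('n) s) = \<mu>}"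
  have "finite ?K \<and> finite ?T \<and> card ?K = (\<Sum>s\<in>?T. harmonics_dim TYPE('n) s)"
  proof (cases "\<exists>w>0. \<mu> = inverse (2 * real w)")
    case True
    then obtain w where w: "w > 0" "\<mu> = inverse (2 * real w)" by blast
    have K: "?K = {k. index k = w}" using w(2) by simp
    have T: "?T = {s. key TYPE('n) s = w}" using w(2) by (simp add: ev_key)
    show ?thesis unfolding K T
      using card_index_fiber[OF w(1)] finite_key_fiber[OF w(1)] w(1) by (simp add: eigen_mult_def)
  next
    case False
    have "inverse (2 * real (index k)) \<noteq> \<mu>" for k using False index_pos[of k] by metis
    then have K: "?K = {}" by simp
    have "inverse (ev TYPE('n) s) \<noteq> \<mu>" for s
    proof (cases "key TYPE('n) s = 0")
      case True
      then show ?thesis using \<mu> by (simp add: ev_key)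
    next
      \<comment> \<open>A nonzero key is excluded by the assumption that \<mu> is not of the form 1
        / (2 w); the key 0 gave inverse 0 = 0, which is not positive.\<close>
      case nz: False
      then show ?thesis unfolding ev_key using False by (metis neq0_conv)
    qed
    then have T: "?T = {}" by simp
    show ?thesis unfolding K T by simp
  qed
  then show "finite ?K" "card ?K = complex_L2.dim (eigenspace (green_op :: 'n sphere_L2 \<Rightarrow> 'n sphere_L2) (of_real \<mu>))"
    using dim_eigenspace_green_op[OF n, of \<mu>] by (simp_all add: harmonics_dim_def)
qed

lemma schatten_norm_green_finite_iff:
  "schatten_norm r (complex_green_operator :: 'n sphere_L2 \<Rightarrow> 'n sphere_L2) < \<infinity> \<longleftrightarrow>
    (\<exists>M. \<forall>w. (\<Sum>v\<le>w. real (eigen_mult TYPE('n) v) * inverse (2 * real v) powr r) \<le> M)"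
proof -
  have "eigenvalue_sequence (complex_green_operator :: 'n sphere_L2 \<Rightarrow> 'n sphere_L2) = (\<lambda>k. inverse (2 * real (index k)))"
    unfolding eigenvalue_sequence_def
  proof (rule the_equality, rule is_eigenvalue_sequence_green)
    fix l assume "is_eigenvalue_sequence (complex_green_operator :: 'n sphere_L2 \<Rightarrow> 'n sphere_L2) l"
    then show "l = (\<lambda>k. inverse (2 * real (index k)))"
      using is_eigenvalue_sequence_green by (rule is_eigenvalue_sequence_unique)
  qed
  then have "schatten_norm r (complex_green_operator :: 'n sphere_L2 \<Rightarrow> 'n sphere_L2) < \<infinity> \<longleftrightarrow>
      (\<Sum>k. ennreal (inverse (2 * real (index k)) powr r)) \<noteq> \<infinity>"
  proof -
    assume eq: "eigenvalue_sequence (complex_green_operator :: 'n sphere_L2 \<Rightarrow> 'n sphere_L2) = (\<lambda>k. inverse (2 * real (index k)))"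
    have "(if S = \<infinity> then \<infinity> else ennreal x) < \<infinity> \<longleftrightarrow> S \<noteq> \<infinity>" for S :: ennreal and x by simp
    then show ?thesis unfolding schatten_norm_def Let_def eq .
  qed
  also have "\<dots> \<longleftrightarrow> summable (\<lambda>k. inverse (2 * real (index k)) powr r)"
    unfolding infinity_ennreal_def
    by (rule iffI, erule summable_suminf_not_top[rotated], rule powr_ge_zero,
        erule ennreal_suminf_neq_top, rule powr_ge_zero)
  also have "\<dots> \<longleftrightarrow> (\<exists>M. \<forall>w. (\<Sum>v\<le>w. real (eigen_mult TYPE('n) v) * inverse (2 * real v) powr r) \<le> M)"
    by (rule summable_index_iff) (rule powr_ge_zero)
  finally show ?thesis .
qed

lemma keyset_subset: "keyset TYPE('n) w \<subseteq> {..w} \<times> {1..w}"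
  unfolding keyset_def
proof (rule UN_least)
  fix v assume v: "v \<in> {1..w}"
  then have "{s. key TYPE('n) s = v} \<subseteq> {..v} \<times> {1..v}" by (intro key_fiber_subset) simp
  also have "\<dots> \<subseteq> {..w} \<times> {1..w}" using v by (intro Sigma_mono) auto
  finally show "{s. key TYPE('n) s = v} \<subseteq> {..w} \<times> {1..w}" .
qed

lemma finite_keyset: "finite (keyset TYPE('n) w)"
  by (rule finite_subset[OF keyset_subset]) auto

lemma sum_eigen_mult: "(\<Sum>v\<le>w. real (eigen_mult TYPE('n) v) * f v) =
    (\<Sum>s\<in>keyset TYPE('n) w. real (harmonics_dim TYPE('n) s) * f (key TYPE('n) s))"
proof -
  have "(\<Sum>s\<in>keyset TYPE('n) w. real (harmonics_dim TYPE('n) s) * f (key TYPE('n) s)) =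
      (\<Sum>v\<in>{1..w}. \<Sum>s\<in>{s. key TYPE('n) s = v}. real (harmonics_dim TYPE('n) s) * f (key TYPE('n) s))"
    unfolding keyset_def by (rule sum.UNION_disjoint) (auto simp: finite_key_fiber)
  also have "\<dots> = (\<Sum>v\<in>{1..w}. real (eigen_mult TYPE('n) v) * f v)"
    by (intro sum.cong refl) (simp add: eigen_mult_def sum_distrib_right)
  also have "\<dots> = (\<Sum>v\<le>w. real (eigen_mult TYPE('n) v) * f v)"
    by (intro sum.mono_neutral_left) (auto simp: eigen_mult_def)
  finally show ?thesis ..
qed

text \<open>With y = q (p + 1), the dimension is at most (2 y)^(N-1) and the eigenvalue at most 1 /
  (2 y). Each term is then at most y to the power N - 1 - r, which factors into a power of p + 1 and
  one of q.\<close>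

lemma schatten_sums_bounded:
  assumes r: "r > real N"
  shows "\<exists>M. \<forall>w. (\<Sum>v\<le>w. real (eigen_mult TYPE('n) v) * inverse (2 * real v) powr r) \<le> M"
proof -
  \<comment> \<open>This is r - (N - 1), the decay left after the growth of the dimension; r > N is
    exactly e > 1.\<close>
  define e where "e = r - real N + 1"
  have e: "e > 1" using r by (simp add: e_def)
  have s: "summable (\<lambda>k. real k powr (- e))" using e by (simp add: summable_real_powr_iff)
  define Z where "Z = (\<Sum>k. real k powr (- e))"
  have Z0: "Z \<ge> 0" unfolding Z_def by (intro suminf_nonneg s) auto
  have Z: "(\<Sum>k\<in>A. real k powr (- e)) \<le> Z" if "finite A" for A
    unfolding Z_def by (rule sum_le_suminf[OF s that]) auto
  have summand: "real (harmonics_dim TYPE('n) (p, q)) * inverse (2 * real (key TYPE('n) (p, q))) powr r \<le>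
      real (Suc p) powr (- e) * real q powr (- e)" if q: "q \<ge> 1" for p q
  proof -
    define y where "y = real (q * (p + 1))"
    have "q * (p + 1) \<ge> 1" using q by simp
    then have y: "y \<ge> 1" unfolding y_def by linarith
    have "harmonics_dim TYPE('n) (p, q) \<le> ((p + 1) * (q + 1)) ^ (N - 1)"
      using dim_bidegree_harmonics_le[where 'n='n, of p q] by (simp add: harmonics_dim_def harmonics_def N)
    also have "\<dots> \<le> (2 * (q * (p + 1))) ^ (N - 1)"
    proof (rule power_mono)
      \<comment> \<open>Here q >= 1 gives q + 1 \<le> 2 q, so the dimension bound is absorbed into a
        power of the product q (p + 1).\<close>
      have "(p + 1) * (q + 1) \<le> (p + 1) * (2 * q)" using q by (intro mult_le_mono2) simp
      then show "(p + 1) * (q + 1) \<le> 2 * (q * (p + 1))" by (simp add: mult_ac)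
    qed simp
    finally have "real (harmonics_dim TYPE('n) (p, q)) \<le> (2 * y) ^ (N - 1)"
      unfolding y_def by (metis of_nat_le_iff of_nat_mult of_nat_numeral of_nat_power)
    also have "\<dots> = (2 * y) powr (real N - 1)"
      using y n N by (subst powr_realpow[symmetric]) (auto simp: of_nat_diff)
    finally have h: "real (harmonics_dim TYPE('n) (p, q)) \<le> (2 * y) powr (real N - 1)" .
    have ky: "y \<le> real (key TYPE('n) (p, q))" unfolding y_def of_nat_le_iff by (rule key_ge)
    have "inverse (2 * real (key TYPE('n) (p, q))) powr r \<le> inverse (2 * y) powr r"
      using ky y r by (intro powr_mono2 le_imp_inverse_le) auto
    also have "\<dots> = (2 * y) powr (- r)" using y by (intro inverse_powr_minus) simp
    finally have g: "inverse (2 * real (key TYPE('n) (p, q))) powr r \<le> (2 * y) powr (- r)" .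
    have "real (harmonics_dim TYPE('n) (p, q)) * inverse (2 * real (key TYPE('n) (p, q))) powr r \<le>
        (2 * y) powr (real N - 1) * (2 * y) powr (- r)"
      by (intro mult_mono h g) auto
    also have "\<dots> = (2 * y) powr (- e)" by (simp add: powr_add[symmetric] e_def algebra_simps)
    also have "\<dots> \<le> y powr (- e)" using y e by (intro powr_mono2') auto
    also have "\<dots> = real (Suc p) powr (- e) * real q powr (- e)"
    proof -
      have "y = real (Suc p) * real q" by (simp add: y_def algebra_simps)
      then show ?thesis by (simp only: powr_mult of_nat_0_le_iff)
    qed
    finally show ?thesis .
  qed
  show ?thesis
  proof (intro exI[of _ "Z * Z"] allI)
    fix w
    have "(\<Sum>v\<le>w. real (eigen_mult TYPE('n) v) * inverse (2 * real v) powr r) =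
        (\<Sum>s\<in>keyset TYPE('n) w. real (harmonics_dim TYPE('n) s) * inverse (2 * real (key TYPE('n) s)) powr r)"
      by (rule sum_eigen_mult)
    also have "\<dots> \<le> (\<Sum>s\<in>{..w} \<times> {1..w}. real (harmonics_dim TYPE('n) s) * inverse (2 * real (key TYPE('n) s)) powr r)"
      by (intro sum_mono2 keyset_subset) auto
    also have "\<dots> \<le> (\<Sum>(p, q)\<in>{..w} \<times> {1..w}. real (Suc p) powr (- e) * real q powr (- e))"
      using summand by (intro sum_mono) auto
    also have "\<dots> = (\<Sum>p\<le>w. real (Suc p) powr (- e)) * (\<Sum>q\<in>{1..w}. real q powr (- e))"
      by (simp add: sum_product sum.cartesian_product)
    also have "(\<Sum>p\<le>w. real (Suc p) powr (- e)) = (\<Sum>k\<in>Suc ` {..w}. real k powr (- e))"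
      by (simp add: sum.reindex)
    also have "(\<Sum>k\<in>Suc ` {..w}. real k powr (- e)) * (\<Sum>q\<in>{1..w}. real q powr (- e)) \<le> Z * Z"
      by (intro mult_mono Z Z0 sum_nonneg) auto
    finally show "(\<Sum>v\<le>w. real (eigen_mult TYPE('n) v) * inverse (2 * real v) powr r) \<le> Z * Z" .
  qed
qed

text \<open>For r \<le> N the terms of the row q = 1 are at least c / (d + 1), so bounded sums would
  make the harmonic series converge.\<close>

lemma schatten_sums_bounded_imp_gt:
  assumes r: "0 \<le> r" and M: "\<And>w. (\<Sum>v\<le>w. real (eigen_mult TYPE('n) v) * inverse (2 * real v) powr r) \<le> M"
  shows "r > real N"
proof (rule ccontr)
  assume "\<not> r > real N"
  then have rN: "r \<le> real N" by simp
  \<comment> \<open>With x = d + 1, the lower bounds (x / N)^(N-1) for the dimension and (2 N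
    x)^(-N) for the eigenvalue power multiply to c / x.\<close>
  define c where "c = 1 / (real N ^ (N - 1) * (2 * real N) ^ N)"
  have N0: "N > 0" using n N by simp
  then have c: "c > 0" by (simp add: c_def)
  have summand: "c * (1 / real (Suc d)) \<le>
      real (harmonics_dim TYPE('n) (Suc d, 1)) * inverse (2 * real (key TYPE('n) (Suc d, 1))) powr r" for d
  proof -
    define x where "x = real (Suc d)"
    have x: "x \<ge> 1" by (simp add: x_def)
    have key: "real (key TYPE('n) (Suc d, 1)) = real (d + N)" using N by (simp add: key_def)
    have kp: "1 \<le> 2 * real (d + N)" using N0 by simp
    \<comment> \<open>The key d + N is bounded by a fixed multiple of d + 1, which removes the shift
      by N at the cost of a constant.\<close>
    have "d + N \<le> N * (d + 1)" using N0 by (cases N) auto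
    then have "real (d + N) \<le> real N * x"
      unfolding x_def by (metis Suc_eq_plus1 of_nat_le_iff of_nat_mult)
    then have "(2 * real (d + N)) ^ N \<le> (2 * real N * x) ^ N"
      by (intro power_mono) auto
    then have "inverse ((2 * real N * x) ^ N) \<le> inverse ((2 * real (d + N)) ^ N)"
      using kp by (intro le_imp_inverse_le) auto
    also have "\<dots> = (2 * real (d + N)) powr (- real N)"
      using kp by (simp add: powr_minus powr_realpow)
    \<comment> \<open>The base is at least 1, so lowering the exponent from N to r can only enlarge
      the negative power.\<close>
    also have "\<dots> \<le> (2 * real (d + N)) powr (- r)"
      using rN kp by (intro powr_mono) auto
    also have "\<dots> = inverse (2 * real (d + N)) powr r"
      using kp by (intro inverse_powr_minus[symmetric]) simp
    finally have g: "inverse ((2 * real N * x) ^ N) \<le> inverse (2 * real (key TYPE('n) (Suc d, 1))) powr r"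
      unfolding key .
    have h: "(x / real N) ^ (N - 1) \<le> real (harmonics_dim TYPE('n) (Suc d, 1))"
      using harmonics_dim_ge[of d] by (simp add: x_def)
    have "c * (1 / x) = (x / real N) ^ (N - 1) * inverse ((2 * real N * x) ^ N)"
    proof -
      have "x ^ N = x ^ (N - 1) * x" using N0 by (metis power_minus_mult)
      then show ?thesis using x N0
        by (simp add: c_def power_divide power_mult_distrib field_simps)
    qed
    also have "\<dots> \<le> real (harmonics_dim TYPE('n) (Suc d, 1)) * inverse (2 * real (key TYPE('n) (Suc d, 1))) powr r"
      using x by (intro mult_mono g h) auto
    finally show ?thesis by (simp add: x_def)
  qed
  have "(\<Sum>d<D. c * (1 / real (Suc d))) \<le> M" for D
  proof -
    have "(\<Sum>d<D. c * (1 / real (Suc d))) \<le>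
        (\<Sum>d<D. real (harmonics_dim TYPE('n) (Suc d, 1)) * inverse (2 * real (key TYPE('n) (Suc d, 1))) powr r)"
      by (intro sum_mono summand)
    also have "\<dots> = (\<Sum>s\<in>(\<lambda>d. (Suc d, 1)) ` {..<D}. real (harmonics_dim TYPE('n) s) * inverse (2 * real (key TYPE('n) s)) powr r)"
      by (subst sum.reindex) (auto simp: inj_on_def)
    \<comment> \<open>The pairs (d + 1, 1) with d < D have keys d + N, which lie between 1 and D +
      N; all other terms are nonnegative.\<close>
    also have "\<dots> \<le> (\<Sum>s\<in>keyset TYPE('n) (D + N). real (harmonics_dim TYPE('n) s) * inverse (2 * real (key TYPE('n) s)) powr r)"
      using n N by (intro sum_mono2 finite_keyset) (auto simp: keyset_def key_def)
    also have "\<dots> \<le> M" unfolding sum_eigen_mult[symmetric, of "\<lambda>v. inverse (2 * real v) powr r"] by (rule M)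
    finally show ?thesis .
  qed
  then have "summable (\<lambda>d. c * (1 / real (Suc d)))"
    using c by (intro summableI_nonneg_bounded[where x=M]) auto
  then have "summable (\<lambda>d. 1 / real (Suc d))" using c by (simp only: summable_cmult_iff) blast
  then have "summable (\<lambda>d. real (Suc d) powr (- 1))" by (simp add: powr_minus_divide)
  then have "summable (\<lambda>d. real d powr (- 1))" by (simp only: summable_Suc_iff[of "\<lambda>d. real d powr (- 1)"])
  then show False by (simp only: summable_real_powr_iff)
qed

end

theorem theorem2p1:
  fixes r :: real
  assumes "CARD('n::finite) \<ge> 2" and "r \<ge> 1"
  shows "schatten_norm r (complex_green_operator :: 'n sphere_L2 \<Rightarrow> 'n sphere_L2) < \<infinity>
    \<longleftrightarrow> r > real CARD('n)"
proof -
  have "0 \<le> r" using assms(2) by simp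
  then show ?thesis
    unfolding schatten_norm_green_finite_iff[OF assms(1) refl]
    by (intro iffI; (elim exE)?) (blast intro: schatten_sums_bounded_imp_gt[OF assms(1) refl] schatten_sums_bounded[OF assms(1) refl])+
qed

end
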